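(* Let $n\ge 2$ be an integer, let $a\ge 0$ be a constant, let $\Omega$ be a bounded domain in $\mathbb{R}^n$, and let $\Gamma_j$ denote the $j$-th eigenvalue of the Dirichlet problem $$\Delta^2u-a\Delta u=\Gamma u\ \text{ on }\Omega,\qquad u|_{\partial\Omega}=\frac{\partial u}{\partial\nu}\Big|_{\partial\Omega}=0 .$$ Then there is a sequence $\varepsilon_n(k)$, $k\ge 1$, with $\varepsilon_n(k)\ge 0$ and $\varepsilon_n(k)=O(k^{-2/n})$ as $k\to\infty$, such that for every integer $k\ge 1$ $$\frac1k\sum_{j=1}^k\Gamma_j\ \ge\ \frac{n}{n+4}\,\frac{(2\pi)^4}{(\omega_nV(\Omega))^{\frac4n}}\,k^{\frac4n}+\left(\frac{n}{24}\frac{V(\Omega)}{I(\Omega)}+\frac{na}{n+2}\right)\frac{(2\pi)^2}{(\omega_nV(\Omega))^{\frac2n}}\,k^{\frac2n}+\left[-\frac{n(n^2-4)}{3840}\frac{V(\Omega)}{I(\Omega)}+\frac{na}{48}\right]\frac{V(\Omega)}{I(\Omega)}\bigl(1-\varepsilon_n(k)\bigr).$$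
   Context: $\omega_n$ is the volume of the unit ball in $\mathbb{R}^n$; $V(\Omega)$ is the volume of $\Omega$; $I(\Omega)=\min_{c\in\mathbb{R}^n}\int_\Omega |x-c|^2\,dx$ is the moment of inertia of $\Omega$. $\Delta$ is the Laplacian and $\nu$ is the outward unit normal vector field of $\partial\Omega$. The eigenvalues $\Gamma_1\le\Gamma_2\le\cdots\to\infty$ are real and discrete, each repeated according to its multiplicity. (For a general bounded domain the eigenvalue problem is understood in the usual weak sense, in the Sobolev space $H_0^2(\Omega)$.) The sequence $\varepsilon_n(k)$ is for the given $n,a,\Omega$. *)

theory Defs
  imports "HOL-Analysis.Analysis" "HOL-Library.Landau_Symbols"
begin

text \<open>
  Functions on \<open>\<Omega>\<close> are total functions of which only the values on \<open>\<Omega>\<close> matter: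
  every integral below is taken with respect to \<open>lebesgue_on \<Omega>\<close>.
\<close>

definition volume :: "(real ^ 'n) set \<Rightarrow> real" where
  "volume \<Omega> = measure lebesgue \<Omega>"

text \<open>For bounded \<open>\<Omega>\<close> of positive volume the infimum is attained, at the centroid of \<open>\<Omega>\<close>.\<close>

definition moment_of_inertia :: "(real ^ 'n) set \<Rightarrow> real" where
  "moment_of_inertia \<Omega> = (INF c. LINT x|lebesgue_on \<Omega>. (norm (x - c))\<^sup>2)"


definition partial :: "'n \<Rightarrow> (real ^ 'n \<Rightarrow> real) \<Rightarrow> real ^ 'n \<Rightarrow> real" where
  "partial i f x = frechet_derivative f (at x) (axis i 1)"

fun C_k :: "nat \<Rightarrow> (real ^ 'n \<Rightarrow> real) \<Rightarrow> bool" where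
  "C_k 0 f \<longleftrightarrow> continuous_on UNIV f"
| "C_k (Suc k) f \<longleftrightarrow> (\<forall>x. f differentiable (at x)) \<and> (\<forall>i. C_k k (partial i f))"

definition test_functions :: "(real ^ 'n) set \<Rightarrow> (real ^ 'n \<Rightarrow> real) set" where
  "test_functions \<Omega> =
     {\<phi>. (\<forall>k. C_k k \<phi>) \<and> (\<exists>K. compact K \<and> K \<subseteq> \<Omega> \<and> (\<forall>x. x \<notin> K \<longrightarrow> \<phi> x = 0))}"


definition L2 :: "(real ^ 'n) set \<Rightarrow> (real ^ 'n \<Rightarrow> real) set" where
  "L2 \<Omega> = {u \<in> borel_measurable (lebesgue_on \<Omega>). integrable (lebesgue_on \<Omega>) (\<lambda>x. (u x)\<^sup>2)}"

definition is_weak_partial ::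
    "(real ^ 'n) set \<Rightarrow> 'n \<Rightarrow> (real ^ 'n \<Rightarrow> real) \<Rightarrow> (real ^ 'n \<Rightarrow> real) \<Rightarrow> bool" where
  "is_weak_partial \<Omega> i u g \<longleftrightarrow>
     u \<in> L2 \<Omega> \<and> g \<in> L2 \<Omega> \<and>
     (\<forall>\<phi>\<in>test_functions \<Omega>.
        (LINT x|lebesgue_on \<Omega>. u x * partial i \<phi> x) = - (LINT x|lebesgue_on \<Omega>. g x * \<phi> x))"

text \<open>
  A weak derivative is unique almost everywhere on \<open>\<Omega>\<close>, so the choice of a representative does
  not affect any of the notions defined from it.
\<close>

definition weak_partial ::
    "(real ^ 'n) set \<Rightarrow> 'n \<Rightarrow> (real ^ 'n \<Rightarrow> real) \<Rightarrow> real ^ 'n \<Rightarrow> real" where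
  "weak_partial \<Omega> i u = (SOME g. is_weak_partial \<Omega> i u g)"

definition H2 :: "(real ^ 'n) set \<Rightarrow> (real ^ 'n \<Rightarrow> real) set" where
  "H2 \<Omega> = {u \<in> L2 \<Omega>. \<forall>i. (\<exists>g. is_weak_partial \<Omega> i u g) \<and>
                       (\<forall>j. \<exists>g. is_weak_partial \<Omega> j (weak_partial \<Omega> i u) g)}"

definition H2_norm :: "(real ^ 'n) set \<Rightarrow> (real ^ 'n \<Rightarrow> real) \<Rightarrow> real" where
  "H2_norm \<Omega> u = sqrt (
     (LINT x|lebesgue_on \<Omega>. (u x)\<^sup>2) +
     (\<Sum>i\<in>UNIV. LINT x|lebesgue_on \<Omega>. (weak_partial \<Omega> i u x)\<^sup>2) +
     (\<Sum>i\<in>UNIV. \<Sum>j\<in>UNIV. LINT x|lebesgue_on \<Omega>. (weak_partial \<Omega> j (weak_partial \<Omega> i u) x)\<^sup>2))"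

definition H2_0 :: "(real ^ 'n) set \<Rightarrow> (real ^ 'n \<Rightarrow> real) set" where
  "H2_0 \<Omega> = {u \<in> H2 \<Omega>. \<forall>e>0. \<exists>\<phi>\<in>test_functions \<Omega>. H2_norm \<Omega> (\<lambda>x. u x - \<phi> x) < e}"

definition weak_laplacian :: "(real ^ 'n) set \<Rightarrow> (real ^ 'n \<Rightarrow> real) \<Rightarrow> real ^ 'n \<Rightarrow> real" where
  "weak_laplacian \<Omega> u x = (\<Sum>i\<in>UNIV. weak_partial \<Omega> i (weak_partial \<Omega> i u) x)"


text \<open>
  The weak solutions of \<open>\<Delta>\<^sup>2u - a\<Delta>u = \<gamma>u\<close>, obtained by testing with \<open>v\<close> and integrating by parts.
  Both boundary conditions are encoded in the membership of \<open>u\<close> in \<open>H\<^sub>0\<^sup>2(\<Omega>)\<close>. The zero function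
  is included.
\<close>

definition eigenspace :: "real \<Rightarrow> (real ^ 'n) set \<Rightarrow> real \<Rightarrow> (real ^ 'n \<Rightarrow> real) set" where
  "eigenspace a \<Omega> \<gamma> = {u \<in> H2_0 \<Omega>. \<forall>v\<in>H2_0 \<Omega>.
     (LINT x|lebesgue_on \<Omega>. weak_laplacian \<Omega> u x * weak_laplacian \<Omega> v x) +
     a * (LINT x|lebesgue_on \<Omega>. (\<Sum>i\<in>UNIV. weak_partial \<Omega> i u x * weak_partial \<Omega> i v x)) =
     \<gamma> * (LINT x|lebesgue_on \<Omega>. u x * v x)}"

text \<open>
  \<open>E\<close>, taken modulo equality almost everywhere, has a basis of \<open>m\<close> elements.
\<close>

definition has_dim_ae :: "'a measure \<Rightarrow> ('a \<Rightarrow> real) set \<Rightarrow> nat \<Rightarrow> bool" where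
  "has_dim_ae M E m \<longleftrightarrow> (\<exists>b. (\<forall>i<m. b i \<in> E) \<and>
     (\<forall>c. (AE x in M. (\<Sum>i<m. c i * b i x) = 0) \<longrightarrow> (\<forall>i<m. c i = 0)) \<and>
     (\<forall>u\<in>E. \<exists>c. AE x in M. u x = (\<Sum>i<m. c i * b i x)))"

text \<open>
  \<open>\<Gamma> 1 \<le> \<Gamma> 2 \<le> \<dots>\<close> lists the eigenvalues with multiplicity: each real \<open>\<gamma>\<close> occurs as often as
  the dimension of its eigenspace (hence never, if \<open>\<gamma>\<close> is not an eigenvalue). This determines
  \<open>\<Gamma>\<close> on the positive indices; \<open>\<Gamma> 0\<close> is irrelevant.
\<close>

definition eigenvalue_sequence :: "real \<Rightarrow> (real ^ 'n) set \<Rightarrow> (nat \<Rightarrow> real) \<Rightarrow> bool" where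
  "eigenvalue_sequence a \<Omega> \<Gamma> \<longleftrightarrow>
     mono_on {1..} \<Gamma> \<and> filterlim \<Gamma> at_top sequentially \<and>
     (\<forall>\<gamma>. has_dim_ae (lebesgue_on \<Omega>) (eigenspace a \<Omega> \<gamma>) (card {j. 1 \<le> j \<and> \<Gamma> j = \<gamma>}))"

end

theory Submission
  imports Defs "HOL-Probability.Characteristic_Functions" "HOL-Computational_Algebra.Polynomial"
begin

text \<open>
  Let \<open>u\<^sub>1, \<dots>, u\<^sub>k\<close> be orthonormal eigenfunctions and \<open>F = \<Sum>\<^sub>j |\<F> u\<^sub>j|\<^sup>2\<close>, where \<open>\<F>\<close> is the
  unnormalized Fourier transform. By Plancherel, \<open>F\<close> has total mass \<open>(2 \<pi>)\<^sup>n k\<close>, and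
  \<open>(2 \<pi>)\<^sup>n (\<Gamma>\<^sub>1 + \<dots> + \<Gamma>\<^sub>k)\<close> dominates the integral of \<open>(|\<xi>|\<^sup>4 + a |\<xi>|\<^sup>2) F(\<xi>)\<close>. Since \<open>F(\<xi>)\<close> and
  \<open>V - F(\<xi>)\<close> are the squared norms of two complementary projections of a plane wave, both
  \<open>\<surd>F\<close> and \<open>\<surd>(V - F)\<close> have the Lipschitz constant \<open>\<surd>I\<close>.

  Let \<open>R\<close> be the radius of the ball on which the density \<open>V\<close> has the total mass of \<open>F\<close>. The moment
  of \<open>F\<close> exceeds that of the ball by the integral of \<open>||\<xi>|\<^sup>p - R\<^sup>p|\<close> times \<open>F\<close> outside and \<open>V - F\<close>
  inside the ball. On each ray the value of \<open>F\<close> at distance \<open>R\<close> and the two Lipschitz bounds force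
  this excess to be at least a constant times \<open>(V / I) R\<^sup>p\<^sup>-\<^sup>2\<close> relative to the mass; no rearrangement is needed.
  Because the square roots are Lipschitz, and not only \<open>F\<close>, the constant is large enough to cover the
  corresponding terms of the bound for every \<open>k\<close>, so that \<open>\<epsilon> = 0\<close> works: the third-order term with \<open>n (n\<^sup>2 - 4)\<close> is not positive.
\<close>

section \<open>Smooth functions and cutoffs\<close>

text \<open>The length scale is h = \<surd>V / (2 \<surd>I): relative to V, the square root of the
  density needs the length 2 h to run through [0, 1]. The bound demands an excess of h^2 / 24 on
  each ray, up to the factor p R^(n+p-2). A Lipschitz bound on F alone, with constant 2 \<surd>(V
  I), has linear profiles worth h^2 (c^3 + (1 - c)^3) / 6, where c is the relative density at
  distance R. The minimum is exactly h^2 / 24, so nothing could be lost to the weight r^(n-1), which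
  decreases towards the centre. Quadratic profiles are worth h^2 (c^2 + A (1 - c)^2) / 3, where A is
  the loss inside, and A \<ge> 1/7 is enough. This follows from k \<ge> 1 alone: if \<rho> is the
  radius of the ball of volume V, then R \<rho> \<ge> (n + 2) / e, and h / R is at most of order 1 /
  n.

  Membership in H_0^2 enters twice. It allows testing with plane waves, which lack compact support,
  without boundary terms; and approximation by test functions gives the lower half of Plancherel,
  needed for the exact mass of F. The energy estimate needs only the upper half, which holds on all
  of L2.\<close>

lemma partial_eqI: "(f has_derivative f') (at x) \<Longrightarrow> partial i f x = f' (axis i 1)"
  unfolding partial_def using frechet_derivative_at by metis

lemma C_k_continuous: "C_k k f \<Longrightarrow> continuous_on UNIV f"
  by (cases k) (auto simp: continuous_on_eq_continuous_within differentiable_imp_continuous_within)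

lemma C_k_SucD: "C_k (Suc k) f \<Longrightarrow> C_k k f"
proof (induction k arbitrary: f)
  case 0
  then show ?case using C_k_continuous by (metis C_k.simps(1))
next
  case (Suc k)
  then show ?case by (metis C_k.simps(2))
qed

lemma partial_const: "partial i (\<lambda>x. c) = (\<lambda>x. 0)"
  by (rule ext, rule partial_eqI) (auto intro!: derivative_eq_intros)

lemma C_k_const: "C_k k (\<lambda>x. c)"
  by (induction k arbitrary: c) (auto simp: partial_const)

lemma partial_add:
  assumes "\<And>x. f differentiable (at x)" "\<And>x. g differentiable (at x)"
  shows "partial i (\<lambda>x. f x + g x) = (\<lambda>x. partial i f x + partial i g x)"
proof
  fix x
  from assms[of x] obtain f' g' where fg: "(f has_derivative f') (at x)" "(g has_derivative g') (at x)"
    by (auto simp: differentiable_def)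
  have "((\<lambda>x. f x + g x) has_derivative (\<lambda>h. f' h + g' h)) (at x)"
    by (intro derivative_intros fg)
  from partial_eqI[OF this, of i] partial_eqI[OF fg(1), of i] partial_eqI[OF fg(2), of i]
  show "partial i (\<lambda>x. f x + g x) x = partial i f x + partial i g x" by simp
qed

lemma partial_mult:
  assumes "\<And>x. f differentiable (at x)" "\<And>x. g differentiable (at x)"
  shows "partial i (\<lambda>x. f x * g x) = (\<lambda>x. f x * partial i g x + partial i f x * g x)"
proof
  fix x
  from assms[of x] obtain f' g' where fg: "(f has_derivative f') (at x)" "(g has_derivative g') (at x)"
    by (auto simp: differentiable_def)
  have "((\<lambda>x. f x * g x) has_derivative (\<lambda>h. f x * g' h + f' h * g x)) (at x)"
    by (intro derivative_intros fg)
  from partial_eqI[OF this, of i] partial_eqI[OF fg(1), of i] partial_eqI[OF fg(2), of i]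
  show "partial i (\<lambda>x. f x * g x) x = f x * partial i g x + partial i f x * g x" by simp
qed

lemma C_k_add: "C_k k f \<Longrightarrow> C_k k g \<Longrightarrow> C_k k (\<lambda>x. f x + g x)"
  by (induction k arbitrary: f g) (auto simp: partial_add intro!: continuous_on_add)

lemma C_k_mult: "C_k k f \<Longrightarrow> C_k k g \<Longrightarrow> C_k k (\<lambda>x. f x * g x)"
proof (induction k arbitrary: f g)
  case 0
  then show ?case by (auto intro!: continuous_on_mult)
next
  case (Suc k)
  have "C_k k f" "C_k k g" using Suc.prems C_k_SucD by blast+
  then show ?case using Suc by (auto simp: partial_mult intro!: C_k_add)
qed

lemma C_k_minus: "C_k k f \<Longrightarrow> C_k k (\<lambda>x. - f x)"
  using C_k_mult[OF C_k_const[of k "-1"], of f] by simp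

lemma C_k_diff: "C_k k f \<Longrightarrow> C_k k g \<Longrightarrow> C_k k (\<lambda>x. f x - g x)"
  using C_k_add[of k f "\<lambda>x. - g x"] C_k_minus by fastforce

lemma C_k_sum: "finite A \<Longrightarrow> (\<And>a. a \<in> A \<Longrightarrow> C_k k (f a)) \<Longrightarrow> C_k k (\<lambda>x. \<Sum>a\<in>A. f a x)"
  by (induction A rule: finite_induct) (auto intro: C_k_const C_k_add)

lemma C_k_prod: "finite A \<Longrightarrow> (\<And>a. a \<in> A \<Longrightarrow> C_k k (f a)) \<Longrightarrow> C_k k (\<lambda>x. \<Prod>a\<in>A. f a x)"
  by (induction A rule: finite_induct) (auto intro: C_k_const C_k_mult)

lemma C_k_power: "C_k k f \<Longrightarrow> C_k k (\<lambda>x. f x ^ m)"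
  by (induction m) (auto intro: C_k_const C_k_mult)

lemma C_k_component: "C_k k (\<lambda>x. x $ j)"
proof (cases k)
  case 0
  then show ?thesis by (auto intro!: continuous_intros)
next
  case (Suc m)
  have d: "((\<lambda>x. x $ j) has_derivative (\<lambda>h. h $ j)) (at x)" for x :: "real ^ 'a"
    by (intro bounded_linear_imp_has_derivative bounded_linear_vec_nth)
  have "partial i (\<lambda>x. x $ j) = (\<lambda>x. axis i 1 $ j)" for i :: 'a
    using partial_eqI[OF d] by blast
  with d Suc show ?thesis by (auto simp: differentiable_def intro: C_k_const)
qed

text \<open>\<open>C_k\<close> recurses on partial derivatives, so the induction must meet the
  derivative of the outer function in the same form as the function itself. Hence a set
  \<open>S\<close> closed under differentiation takes the place of a single
  \<open>\<beta>\<close>.\<close>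

lemma C_k_compose:
  assumes S: "\<And>\<beta>. \<beta> \<in> S \<Longrightarrow> \<exists>\<beta>'\<in>S. \<forall>t::real. (\<beta> has_real_derivative \<beta>' t) (at t)"
    and q: "\<And>k. C_k k q" and "\<beta> \<in> S"
  shows "C_k k (\<lambda>x. \<beta> (q x))"
  using \<open>\<beta> \<in> S\<close>
proof (induction k arbitrary: \<beta>)
  case 0
  obtain \<beta>' where "\<forall>t. (\<beta> has_real_derivative \<beta>' t) (at t)" using S[OF 0] by blast
  hence "continuous_on UNIV \<beta>"
    by (meson DERIV_isCont continuous_at_imp_continuous_on)
  thus ?case using q[of 0] by (auto intro: continuous_on_compose2)
next
  case (Suc k)
  obtain \<beta>' where \<beta>': "\<beta>' \<in> S" "\<And>t. (\<beta> has_real_derivative \<beta>' t) (at t)" using S[OF Suc.prems] by blast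
  have d: "((\<lambda>x. \<beta> (q x)) has_derivative (\<lambda>h. frechet_derivative q (at x) h * \<beta>' (q x))) (at x)" for x
  proof -
    have "(q has_derivative frechet_derivative q (at x)) (at x)"
      using q[of 1] by (simp add: frechet_derivative_works)
    from DERIV_compose_FDERIV[OF \<beta>'(2) this] show ?thesis .
  qed
  have "partial i (\<lambda>x. \<beta> (q x)) = (\<lambda>x. partial i q x * \<beta>' (q x))" for i
    using partial_eqI[OF d] by (auto simp: partial_def)
  moreover have "C_k k (partial i q)" for i using q[of "Suc k"] by simp
  ultimately show ?case
    using d Suc.IH[OF \<beta>'(1)] by (auto simp: differentiable_def intro!: C_k_mult)
qed

text \<open>The functions p(1/t) e^(-1/t), continued by 0 to t \<le> 0. The family contains the
  classical flat function (p = 1) and is closed under differentiation, as \<open>C_k_compose\<close>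
  requires.\<close>

definition exp_flat :: "real poly \<Rightarrow> real \<Rightarrow> real" where
  "exp_flat p t = (if t > 0 then poly p (inverse t) * exp (- inverse t) else 0)"

lemma poly_times_exp_tendsto_0: "((\<lambda>y. poly p y * exp (- y)) \<longlongrightarrow> 0) (at_top :: real filter)"
proof -
  have "((\<lambda>y. \<Sum>i\<le>degree p. coeff p i * (y ^ i / exp y)) \<longlongrightarrow> (\<Sum>i\<le>degree p. coeff p i * 0)) (at_top :: real filter)"
    by (intro tendsto_intros tendsto_power_div_exp_0)
  thus ?thesis by (simp add: poly_altdef exp_minus sum_divide_distrib field_simps)
qed

lemma exp_flat_tendsto_0: "(exp_flat p \<longlongrightarrow> 0) (at_right 0)"
proof -
  have "((\<lambda>t. poly p (inverse t) * exp (- inverse t)) \<longlongrightarrow> 0) (at_right 0)"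
    using filterlim_compose[OF poly_times_exp_tendsto_0 filterlim_inverse_at_top_right] .
  thus ?thesis
    by (rule Lim_transform_eventually) (auto simp: exp_flat_def eventually_at_filter)
qed

text \<open>For t > 0 the polynomial X^2 (p - p') comes from the chain rule: both p(1/t) and
  e^(-1/t) contribute a factor 1/t^2. At 0 exponential decay beats every power of 1/t.\<close>

lemma exp_flat_derivative:
  "(exp_flat p has_real_derivative exp_flat ([:0,0,1:] * (p - pderiv p)) t) (at t)"
proof -
  consider "t > 0" | "t < 0" | "t = 0" by linarith
  then show ?thesis
  proof cases
    case 1
    have "((\<lambda>t. poly p (inverse t) * exp (- inverse t)) has_real_derivative
           exp_flat ([:0,0,1:] * (p - pderiv p)) t) (at t)"
      using 1 by (auto intro!: derivative_eq_intros DERIV_chain2[OF poly_DERIV] simp: exp_flat_def field_simps power2_eq_square)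
    thus ?thesis
      by (rule has_field_derivative_transform_within_open[of _ _ _ "{0<..}"]) (use 1 in \<open>auto simp: exp_flat_def\<close>)
  next
    case 2
    have "((\<lambda>t. 0) has_real_derivative exp_flat ([:0,0,1:] * (p - pderiv p)) t) (at t)"
      using 2 by (auto simp: exp_flat_def)
    thus ?thesis
      by (rule has_field_derivative_transform_within_open[of _ _ _ "{..<0}"]) (use 2 in \<open>auto simp: exp_flat_def\<close>)
  next
    case 3
    have "((\<lambda>h. (exp_flat p (0 + h) - exp_flat p 0) / h) \<longlongrightarrow> 0) (at 0)"
    proof (rule filterlim_split_at)
      show "((\<lambda>h. (exp_flat p (0 + h) - exp_flat p 0) / h) \<longlongrightarrow> 0) (at_left 0)"
        by (rule Lim_transform_eventually[OF tendsto_const]) (auto simp: exp_flat_def eventually_at_filter)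
      \<comment> \<open>Division by h multiplies the polynomial by X, so the difference quotient is
        again a member of the family.\<close>
      show "((\<lambda>h. (exp_flat p (0 + h) - exp_flat p 0) / h) \<longlongrightarrow> 0) (at_right 0)"
        by (rule Lim_transform_eventually[OF exp_flat_tendsto_0[of "[:0,1:] * p"]])
           (auto simp: exp_flat_def eventually_at_filter field_simps)
    qed
    thus ?thesis using 3 by (simp add: DERIV_def exp_flat_def)
  qed
qed

definition ball_bump :: "real ^ 'n \<Rightarrow> real \<Rightarrow> real ^ 'n \<Rightarrow> real" where
  "ball_bump c r x = exp_flat 1 (r\<^sup>2 - (\<Sum>i\<in>UNIV. (x $ i - c $ i)\<^sup>2))"

lemma C_k_ball_bump: "C_k k (ball_bump c r)"
proof -
  have q: "C_k k (\<lambda>x. r\<^sup>2 - (\<Sum>i\<in>UNIV. (x $ i - c $ i)\<^sup>2))" for k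
    by (intro C_k_diff C_k_const C_k_sum C_k_power C_k_component) auto
  have d: "\<exists>\<beta>'\<in>range exp_flat. \<forall>t::real. (\<beta> has_real_derivative \<beta>' t) (at t)" if b: "\<beta> \<in> range exp_flat" for \<beta>
  proof -
    obtain p where "\<beta> = exp_flat p" using b by auto
    thus ?thesis using exp_flat_derivative[of p] by blast
  qed
  have "C_k k (\<lambda>x. exp_flat 1 (r\<^sup>2 - (\<Sum>i\<in>UNIV. (x $ i - c $ i)\<^sup>2)))"
    by (rule C_k_compose[OF d q]) auto
  thus ?thesis unfolding ball_bump_def .
qed

lemma sum_component_squares: "(\<Sum>i\<in>UNIV. (x $ i - c $ i)\<^sup>2) = (dist c (x :: real ^ 'n))\<^sup>2"
  by (simp add: dist_vec_def L2_set_def sum_nonneg dist_real_def power2_commute)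

lemma ball_bump_bounds: "0 \<le> ball_bump c r x" "ball_bump c r x \<le> 1"
  by (auto simp: ball_bump_def exp_flat_def)

lemma ball_bump_pos: "x \<in> ball c r \<Longrightarrow> ball_bump c r x > 0"
  by (auto simp: ball_bump_def exp_flat_def sum_component_squares) (smt (verit) power_strict_mono zero_le_dist pos2)

lemma ball_bump_zero: "r \<ge> 0 \<Longrightarrow> x \<notin> cball c r \<Longrightarrow> ball_bump c r x = 0"
  by (auto simp: ball_bump_def exp_flat_def sum_component_squares) (smt (verit) power_mono zero_le_dist)

section \<open>Test functions and an exhausting sequence of cutoffs\<close>

lemma test_functionsI:
  "(\<And>k. C_k k \<phi>) \<Longrightarrow> compact K \<Longrightarrow> K \<subseteq> \<Omega> \<Longrightarrow> (\<And>x. x \<notin> K \<Longrightarrow> \<phi> x = 0) \<Longrightarrow> \<phi> \<in> test_functions \<Omega>"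
  unfolding test_functions_def by blast

lemma test_functions_C_k: "\<phi> \<in> test_functions \<Omega> \<Longrightarrow> C_k k \<phi>"
  by (auto simp: test_functions_def)

lemma test_functions_mult:
  assumes "\<phi> \<in> test_functions \<Omega>" "\<And>k. C_k k g"
  shows "(\<lambda>x. \<phi> x * g x) \<in> test_functions \<Omega>"
  using assms unfolding test_functions_def by (auto intro!: C_k_mult)

lemma test_functions_differentiable: "\<phi> \<in> test_functions \<Omega> \<Longrightarrow> \<phi> differentiable (at x)"
  using test_functions_C_k[of \<phi> \<Omega> 1] by simp

lemma test_functions_partial:
  assumes "\<phi> \<in> test_functions \<Omega>"
  shows "partial i \<phi> \<in> test_functions \<Omega>"
proof -
  obtain K where K: "compact K" "K \<subseteq> \<Omega>" "\<And>x. x \<notin> K \<Longrightarrow> \<phi> x = 0"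
    using assms unfolding test_functions_def by blast
  show ?thesis
  proof (rule test_functionsI[OF _ K(1,2)])
    show "C_k k (partial i \<phi>)" for k using test_functions_C_k[OF assms, of "Suc k"] by simp
    fix x assume x: "x \<notin> K"
    have "((\<lambda>x. 0) has_derivative (\<lambda>h. 0)) (at x)" by simp
    hence "(\<phi> has_derivative (\<lambda>h. 0)) (at x)"
      by (rule has_derivative_transform_within_open[of _ _ _ _ "- K"])
         (use K x in \<open>auto simp: compact_imp_closed\<close>)
    thus "partial i \<phi> x = 0" by (simp add: partial_eqI)
  qed
qed

lemma test_functions_outside: "\<phi> \<in> test_functions \<Omega> \<Longrightarrow> x \<notin> \<Omega> \<Longrightarrow> \<phi> x = 0"
  by (auto simp: test_functions_def)

text \<open>Countably many balls whose closed balls lie in \<Omega> cover \<Omega>. The function 1 -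
  \<Prod> (1 - \<psi>_i)^m over the first m bumps is supported in the first m closed balls. At each
  point of \<Omega> some \<psi>_i is positive, so the growing exponent drives the product to
  0.\<close>

lemma cutoff_sequence:
  fixes \<Omega> :: "(real ^ 'n) set"
  assumes "open \<Omega>"
  obtains \<zeta> :: "nat \<Rightarrow> real ^ 'n \<Rightarrow> real" where "\<And>m. \<zeta> m \<in> test_functions \<Omega>" "\<And>m x. 0 \<le> \<zeta> m x \<and> \<zeta> m x \<le> 1"
    "\<And>x. x \<in> \<Omega> \<Longrightarrow> (\<lambda>m. \<zeta> m x) \<longlonglongrightarrow> 1"
proof -
  define F where "F = {(c::real^'n, r::real). r > 0 \<and> cball c r \<subseteq> \<Omega>}"
  have "\<And>S. S \<in> (\<lambda>(c,r). ball c r) ` F \<Longrightarrow> open S" by auto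
  from Lindelof[OF this] obtain \<U> where
    U: "\<U> \<subseteq> (\<lambda>(c,r). ball c r) ` F" "countable \<U>" "\<Union>\<U> = \<Union>((\<lambda>(c,r). ball c r) ` F)" by blast
  have "\<exists>G. countable G \<and> G \<subseteq> F \<and> \<U> = (\<lambda>(c,r). ball c r) ` G"
    using countable_subset_image[of \<U> "\<lambda>(c,r). ball c r" F] U(1,2) by simp
  then obtain G where G: "countable G" "G \<subseteq> F" "\<U> = (\<lambda>(c,r). ball c r) ` G" by blast
  have cov: "\<exists>cr\<in>G. x \<in> ball (fst cr) (snd cr)" if "x \<in> \<Omega>" for x
  proof -
    obtain e where "e > 0" "cball x e \<subseteq> \<Omega>" using assms \<open>x \<in> \<Omega>\<close> open_contains_cball by blast
    hence "(x, e) \<in> F" "x \<in> ball x e" by (simp_all add: F_def)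
    hence "x \<in> \<Union>((\<lambda>(c,r). ball c r) ` F)" by blast
    hence "x \<in> \<Union>((\<lambda>(c,r). ball c r) ` G)" using U(3) G(3) by simp
    thus ?thesis by (auto simp: split_beta)
  qed
  show thesis
  proof (cases "G = {}")
    case True
    hence "\<Omega> = {}" using cov by blast
    show thesis
      by (rule that[of "\<lambda>m x. 0"]) (use \<open>\<Omega> = {}\<close> in \<open>auto intro!: test_functionsI[of _ "{}"] C_k_const\<close>)
  next
    case False
    \<comment> \<open>If \<open>G\<close> is finite, the enumeration repeats its members; this only
      adds factors between 0 and 1 to the product.\<close>
    define g where "g = from_nat_into G"
    have gF: "g i \<in> F" for i using G(2) False from_nat_into[of G i] by (auto simp: g_def)
    define \<psi> where "\<psi> i = ball_bump (fst (g i)) (snd (g i))" for i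
    define \<zeta> where "\<zeta> m x = 1 - (\<Prod>i<m. (1 - \<psi> i x) ^ m)" for m x
    have pr: "0 \<le> (\<Prod>i<m. (1 - \<psi> i x) ^ m)" "(\<Prod>i<m. (1 - \<psi> i x) ^ m) \<le> 1" for m x
      by (auto intro!: prod_nonneg prod_le_1 power_le_one simp: \<psi>_def ball_bump_bounds)
    show thesis
    proof (rule that[of \<zeta>])
      fix m
      show "\<zeta> m \<in> test_functions \<Omega>"
      proof (rule test_functionsI)
        show "C_k k (\<zeta> m)" for k unfolding \<zeta>_def \<psi>_def
          by (intro C_k_diff C_k_const C_k_prod C_k_power C_k_ball_bump) auto
        show "compact (\<Union>i<m. cball (fst (g i)) (snd (g i)))" by (intro compact_UN) auto
        show "(\<Union>i<m. cball (fst (g i)) (snd (g i))) \<subseteq> \<Omega>" using gF by (fastforce simp: F_def split_beta)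
        fix x assume "x \<notin> (\<Union>i<m. cball (fst (g i)) (snd (g i)))"
        hence "\<psi> i x = 0" if "i < m" for i unfolding \<psi>_def using that gF[of i]
          by (intro ball_bump_zero) (auto simp: F_def)
        thus "\<zeta> m x = 0" by (simp add: \<zeta>_def)
      qed
    next
      show "0 \<le> \<zeta> m x \<and> \<zeta> m x \<le> 1" for m x using pr[where m=m and x=x] by (auto simp: \<zeta>_def)
    next
      fix x assume "x \<in> \<Omega>"
      then obtain cr where cr: "cr \<in> G" "x \<in> ball (fst cr) (snd cr)" using cov by blast
      obtain i where i: "g i = cr" using from_nat_into_surj[OF G(1) cr(1)] by (auto simp: g_def)
      have p: "\<psi> i x > 0" using cr i by (simp add: \<psi>_def ball_bump_pos)
      have le1: "\<psi> j x \<le> 1" "0 \<le> \<psi> j x" for j by (auto simp: \<psi>_def ball_bump_bounds)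
      have up: "(\<Prod>i<m. (1 - \<psi> i x) ^ m) \<le> (1 - \<psi> i x) ^ m" if "m > i" for m
      proof -
        have "(\<Prod>j<m. (1 - \<psi> j x) ^ m) = (1 - \<psi> i x) ^ m * (\<Prod>j\<in>{..<m}-{i}. (1 - \<psi> j x) ^ m)"
          using that by (intro prod.remove) auto
        also have "\<dots> \<le> (1 - \<psi> i x) ^ m * 1"
          by (intro mult_left_mono prod_le_1) (auto simp: le1 power_le_one)
        finally show ?thesis by simp
      qed
      have "(\<lambda>m. (\<Prod>i<m. (1 - \<psi> i x) ^ m)) \<longlonglongrightarrow> 0"
      proof (rule real_tendsto_sandwich)
        show "\<forall>\<^sub>F m in sequentially. 0 \<le> (\<Prod>i<m. (1 - \<psi> i x) ^ m)" using pr by simp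
        show "\<forall>\<^sub>F m in sequentially. (\<Prod>i<m. (1 - \<psi> i x) ^ m) \<le> (1 - \<psi> i x) ^ m"
          using eventually_gt_at_top[of i] by eventually_elim (rule up)
        show "(\<lambda>m. (1 - \<psi> i x) ^ m) \<longlonglongrightarrow> 0" using p le1[of i] by (intro LIMSEQ_realpow_zero) auto
      qed auto
      from tendsto_diff[OF tendsto_const this, of 1] show "(\<lambda>m. \<zeta> m x) \<longlonglongrightarrow> 1" by (simp add: \<zeta>_def)
    qed
  qed
qed

section \<open>Square-integrable functions\<close>

lemma L2_measurable: "u \<in> L2 \<Omega> \<Longrightarrow> u \<in> borel_measurable (lebesgue_on \<Omega>)"
  by (simp add: L2_def)

lemma L2_square_integrable: "u \<in> L2 \<Omega> \<Longrightarrow> integrable (lebesgue_on \<Omega>) (\<lambda>x. (u x)\<^sup>2)"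
  by (simp add: L2_def)

lemma L2_mult_integrable:
  assumes "u \<in> L2 \<Omega>" "v \<in> L2 \<Omega>"
  shows "integrable (lebesgue_on \<Omega>) (\<lambda>x. u x * v x)"
proof (rule Bochner_Integration.integrable_bound)
  show "integrable (lebesgue_on \<Omega>) (\<lambda>x. (u x)\<^sup>2 + (v x)\<^sup>2)"
    using assms by (intro Bochner_Integration.integrable_add L2_square_integrable)
  show "(\<lambda>x. u x * v x) \<in> borel_measurable (lebesgue_on \<Omega>)"
    using assms by (intro borel_measurable_times L2_measurable)
  have "\<bar>u x * v x\<bar> \<le> (u x)\<^sup>2 + (v x)\<^sup>2" for x
  proof -
    have "0 \<le> (u x + v x)\<^sup>2" "0 \<le> (u x - v x)\<^sup>2" "0 \<le> (u x)\<^sup>2" "0 \<le> (v x)\<^sup>2" by simp_all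
    thus ?thesis unfolding power2_sum power2_diff abs_le_iff by linarith
  qed
  thus "AE x in lebesgue_on \<Omega>. norm (u x * v x) \<le> norm ((u x)\<^sup>2 + (v x)\<^sup>2)" by simp
qed

lemma L2_add:
  assumes "u \<in> L2 \<Omega>" "v \<in> L2 \<Omega>"
  shows "(\<lambda>x. u x + v x) \<in> L2 \<Omega>"
proof -
  have "integrable (lebesgue_on \<Omega>) (\<lambda>x. (u x)\<^sup>2 + (v x)\<^sup>2 + 2 * (u x * v x))"
    using assms by (intro Bochner_Integration.integrable_add L2_square_integrable
        Bochner_Integration.integrable_mult_right L2_mult_integrable)
  hence "integrable (lebesgue_on \<Omega>) (\<lambda>x. (u x + v x)\<^sup>2)" by (simp add: power2_sum algebra_simps)
  moreover have "(\<lambda>x. u x + v x) \<in> borel_measurable (lebesgue_on \<Omega>)"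
    using assms by (intro borel_measurable_add L2_measurable)
  ultimately show ?thesis by (simp add: L2_def)
qed

lemma L2_scale: "u \<in> L2 \<Omega> \<Longrightarrow> (\<lambda>x. c * u x) \<in> L2 \<Omega>"
  by (auto simp: L2_def power_mult_distrib)

lemma L2_diff: "u \<in> L2 \<Omega> \<Longrightarrow> v \<in> L2 \<Omega> \<Longrightarrow> (\<lambda>x. u x - v x) \<in> L2 \<Omega>"
  using L2_add[of u \<Omega> "\<lambda>x. -1 * v x"] L2_scale[of v \<Omega> "-1"] by simp

lemma L2_zero: "(\<lambda>x. 0) \<in> L2 \<Omega>"
  by (simp add: L2_def)

lemma L2_sum: "finite A \<Longrightarrow> (\<And>a. a \<in> A \<Longrightarrow> f a \<in> L2 \<Omega>) \<Longrightarrow> (\<lambda>x. \<Sum>a\<in>A. f a x) \<in> L2 \<Omega>"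
  by (induction A rule: finite_induct) (auto intro: L2_zero L2_add)

lemma L2_bounded:
  fixes \<Omega> :: "(real ^ 'n) set"
  assumes "bounded \<Omega>" "open \<Omega>" "g \<in> borel_measurable (lebesgue_on \<Omega>)"
    "\<And>x. x \<in> \<Omega> \<Longrightarrow> \<bar>g x\<bar> \<le> C"
  shows "g \<in> L2 \<Omega>"
proof -
  interpret finite_measure "lebesgue_on \<Omega>"
    using assms by (intro finite_measure_lebesgue_on lmeasurable_open)
  have m: "(\<lambda>x. (g x)\<^sup>2) \<in> borel_measurable (lebesgue_on \<Omega>)"
    using assms(3) by (intro borel_measurable_power)
  have "integrable (lebesgue_on \<Omega>) (\<lambda>x. (g x)\<^sup>2)"
    using assms(3,4) by (intro integrable_const_bound[where B="C\<^sup>2"])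
      (auto simp: m AE_restrict_space_iff assms lmeasurable_open intro!: AE_I2 abs_le_square_iff[THEN iffD1] order_trans[OF assms(4)])
  thus ?thesis using assms by (simp add: L2_def)
qed

lemma L2_continuous:
  fixes \<Omega> :: "(real ^ 'n) set"
  assumes "bounded \<Omega>" "open \<Omega>" "continuous_on UNIV g"
  shows "g \<in> L2 \<Omega>"
proof -
  have "compact (closure \<Omega>)" using assms(1) by simp
  hence "compact (g ` closure \<Omega>)" using assms(3) continuous_on_subset compact_continuous_image by blast
  then obtain C where "\<forall>y\<in>g ` closure \<Omega>. norm y \<le> C" using compact_imp_bounded bounded_iff by blast
  hence "\<bar>g x\<bar> \<le> C" if "x \<in> \<Omega>" for x using that closure_subset by force
  moreover have "g \<in> borel_measurable (lebesgue_on \<Omega>)"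
    using assms by (meson continuous_imp_measurable_on_sets_lebesgue continuous_on_subset lmeasurable_open fmeasurableD subset_UNIV)
  ultimately show ?thesis using L2_bounded assms by blast
qed

text \<open>The choice s = C, t = -B settles C \<noteq> 0. For C = 0 the form at s = 1 is affine in
  t, which forces B = 0. The form is only semidefinite because the projections to which this is
  applied have kernels.\<close>

lemma psd_form_cauchy_schwarz:
  fixes A B C :: real
  assumes "\<And>s t. 0 \<le> s\<^sup>2 * A + 2 * s * t * B + t\<^sup>2 * C"
  shows "B\<^sup>2 \<le> A * C"
proof -
  have "0 \<le> A" "0 \<le> C" using assms[of 1 0] assms[of 0 1] by simp_all
  show ?thesis
  proof (cases "C = 0")
    case True
    have "B = 0"
    proof (rule ccontr)
      assume "B \<noteq> 0"
      \<comment> \<open>At this point the form equals A - (A + 1) = -1.\<close>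
      with assms[of 1 "- (A + 1) / (2 * B)"] True show False by (simp add: field_simps)
    qed
    thus ?thesis using True by simp
  next
    case False
    have "0 \<le> C\<^sup>2 * A + 2 * C * (- B) * B + (- B)\<^sup>2 * C" by (rule assms)
    also have "\<dots> = C * (A * C - B\<^sup>2)" by (simp add: power2_eq_square algebra_simps)
    finally show ?thesis using False \<open>0 \<le> C\<close> by (simp add: zero_le_mult_iff)
  qed
qed

lemma L2_cauchy_schwarz:
  assumes "u \<in> L2 \<Omega>" "v \<in> L2 \<Omega>"
  shows "(LINT x|lebesgue_on \<Omega>. u x * v x)\<^sup>2 \<le>
    (LINT x|lebesgue_on \<Omega>. (u x)\<^sup>2) * (LINT x|lebesgue_on \<Omega>. (v x)\<^sup>2)"
proof (rule psd_form_cauchy_schwarz)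
  fix s t :: real
  have "0 \<le> (LINT x|lebesgue_on \<Omega>. (s * u x + t * v x)\<^sup>2)" by simp
  also have "\<dots> = (LINT x|lebesgue_on \<Omega>. s\<^sup>2 * (u x)\<^sup>2 + 2 * s * t * (u x * v x) + t\<^sup>2 * (v x)\<^sup>2)"
    by (intro Bochner_Integration.integral_cong) (auto simp: power2_eq_square algebra_simps)
  also have "\<dots> = s\<^sup>2 * (LINT x|lebesgue_on \<Omega>. (u x)\<^sup>2) + 2 * s * t * (LINT x|lebesgue_on \<Omega>. u x * v x)
      + t\<^sup>2 * (LINT x|lebesgue_on \<Omega>. (v x)\<^sup>2)"
    using assms L2_mult_integrable[OF assms] by (simp add: L2_square_integrable)
  finally show "0 \<le> s\<^sup>2 * (LINT x|lebesgue_on \<Omega>. (u x)\<^sup>2) + 2 * s * t * (LINT x|lebesgue_on \<Omega>. u x * v x)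
      + t\<^sup>2 * (LINT x|lebesgue_on \<Omega>. (v x)\<^sup>2)" .
qed

section \<open>Weak derivatives tested against smooth functions without compact support\<close>

lemma test_functions_L2:
  assumes "bounded \<Omega>" "open \<Omega>" "\<phi> \<in> test_functions \<Omega>"
  shows "\<phi> \<in> L2 \<Omega>"
  using assms test_functions_C_k[OF assms(3)] C_k_continuous by (intro L2_continuous) blast+

lemma test_functions_lebesgue:
  assumes "open \<Omega>" "\<phi> \<in> test_functions \<Omega>"
  shows "integrable lborel \<phi>" "(LINT x|lebesgue_on \<Omega>. \<phi> x) = (LINT x|lborel. \<phi> x)"
proof -
  have c: "continuous_on UNIV \<phi>" using test_functions_C_k[OF assms(2)] C_k_continuous by blast
  obtain K where K: "compact K" "\<And>x. x \<notin> K \<Longrightarrow> \<phi> x = 0" using assms(2) by (auto simp: test_functions_def)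
  have "integrable lborel (\<lambda>x. indicator K x *\<^sub>R \<phi> x)"
    using c K(1) by (intro borel_integrable_compact) (auto intro: continuous_on_subset)
  moreover have "(\<lambda>x. indicator K x *\<^sub>R \<phi> x) = \<phi>"
  proof
    fix x show "indicator K x *\<^sub>R \<phi> x = \<phi> x" using K(2)[of x] by (cases "x \<in> K") auto
  qed
  ultimately show "integrable lborel \<phi>" by simp
  have "(LINT x|lebesgue_on \<Omega>. \<phi> x) = (LINT x|lebesgue. indicator \<Omega> x *\<^sub>R \<phi> x)"
    using assms by (simp add: integral_restrict_space)
  also have "\<dots> = (LINT x|lebesgue. \<phi> x)"
    using test_functions_outside[OF assms(2)] by (intro Bochner_Integration.integral_cong) (auto simp: indicator_def)
  also have "\<dots> = (LINT x|lborel. \<phi> x)"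
    using c by (intro integral_completion) (auto intro: borel_measurable_continuous_onI)
  finally show "(LINT x|lebesgue_on \<Omega>. \<phi> x) = (LINT x|lborel. \<phi> x)" .
qed

lemma test_functions_bounded: "\<phi> \<in> test_functions \<Omega> \<Longrightarrow> \<exists>C\<ge>0. \<forall>x. \<bar>\<phi> x\<bar> \<le> C"
proof -
  assume a: "\<phi> \<in> test_functions \<Omega>"
  have c: "continuous_on UNIV \<phi>" using test_functions_C_k[OF a] C_k_continuous by blast
  obtain K where K: "compact K" "\<And>x. x \<notin> K \<Longrightarrow> \<phi> x = 0" using a by (auto simp: test_functions_def)
  have "compact (\<phi> ` K)" using c K(1) continuous_on_subset compact_continuous_image by blast
  then obtain C where C: "\<forall>y\<in>\<phi> ` K. norm y \<le> C" using compact_imp_bounded bounded_iff by blast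
  have "\<bar>\<phi> x\<bar> \<le> max C 0" for x using C K(2)[of x] by (cases "x \<in> K") (auto simp: max_def)
  thus ?thesis by (intro exI[of _ "max C 0"]) auto
qed

text \<open>The difference quotients in direction i have integral 0 by translation invariance of
  \<open>lborel\<close>. They are bounded by the supremum of the derivative and supported in one
  ball, so dominated convergence carries this over to the derivative.\<close>

lemma integral_partial_test_function:
  assumes "open \<Omega>" and \<phi>: "\<phi> \<in> test_functions \<Omega>"
  shows "(LINT x|lebesgue_on \<Omega>. partial i \<phi> x) = 0"
proof -
  let ?e = "axis i (1::real)"
  obtain K where K: "compact K" "\<And>x. x \<notin> K \<Longrightarrow> \<phi> x = 0" using \<phi> by (auto simp: test_functions_def)
  obtain C where C: "C \<ge> 0" "\<And>x. \<bar>partial i \<phi> x\<bar> \<le> C"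
    using test_functions_bounded[OF test_functions_partial[OF \<phi>]] by blast
  obtain r where r: "r > 0" "K \<subseteq> ball 0 r" using compact_imp_bounded[OF K(1)] bounded_subset_ballD by blast
  \<comment> \<open>The shifts have length at most 1, so this ball contains the supports of all
    difference quotients.\<close>
  define B where "B = cball (0::real^'a) (r + 1)"
  have meas: "\<phi> \<in> borel_measurable borel" "partial i \<phi> \<in> borel_measurable borel"
    using test_functions_C_k[OF \<phi>] test_functions_C_k[OF test_functions_partial[OF \<phi>, of i]] C_k_continuous
    by (blast intro: borel_measurable_continuous_onI)+
  have line: "((\<lambda>t. \<phi> (x + t *\<^sub>R ?e)) has_real_derivative partial i \<phi> (x + t *\<^sub>R ?e)) (at t)" for x t
  proof -
    have f: "(\<phi> has_derivative frechet_derivative \<phi> (at (x + t *\<^sub>R ?e))) (at (x + t *\<^sub>R ?e))"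
      using test_functions_differentiable[OF \<phi>] by (simp add: frechet_derivative_works)
    have "((\<lambda>t. x + t *\<^sub>R ?e) has_derivative (\<lambda>h. h *\<^sub>R ?e)) (at t)"
      by (auto intro!: derivative_eq_intros)
    from diff_chain_at[OF this f]
    have "((\<lambda>t. \<phi> (x + t *\<^sub>R ?e)) has_derivative (\<lambda>h. frechet_derivative \<phi> (at (x + t *\<^sub>R ?e)) (h *\<^sub>R ?e))) (at t)"
      by (simp add: o_def)
    moreover have "frechet_derivative \<phi> (at y) (h *\<^sub>R ?e) = partial i \<phi> y * h" for y h
      using linear_frechet_derivative[OF test_functions_differentiable[OF \<phi>, of y]]
      by (simp add: linear_cmul partial_def)
    ultimately show ?thesis by (simp add: has_field_derivative_def)
  qed
  define D where "D m x = (\<phi> (x + (1 / real (Suc m)) *\<^sub>R ?e) - \<phi> x) * real (Suc m)" for m x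
  have Dbound: "\<bar>D m x\<bar> \<le> C" for m x
  proof -
    obtain z where "\<phi> (x + (1 / real (Suc m)) *\<^sub>R ?e) - \<phi> (x + 0 *\<^sub>R ?e)
        = (1 / real (Suc m) - 0) * partial i \<phi> (x + z *\<^sub>R ?e)"
      using MVT2[of 0 "1 / real (Suc m)" "\<lambda>t. \<phi> (x + t *\<^sub>R ?e)", OF _ line] by auto
    thus ?thesis using C(2) by (simp add: D_def)
  qed
  have Dzero: "D m x = 0" if "x \<notin> B" for m x
  proof -
    have nx: "norm x > r + 1" using that by (simp add: B_def)
    have "norm ((1 / real (Suc m)) *\<^sub>R ?e) \<le> 1" by simp
    hence "norm (x + (1 / real (Suc m)) *\<^sub>R ?e) > r"
      using nx norm_diff_ineq[of x "(1 / real (Suc m)) *\<^sub>R ?e"] by linarith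
    hence "x + (1 / real (Suc m)) *\<^sub>R ?e \<notin> K" using r(2) by (auto simp: subset_iff)
    moreover have "x \<notin> K" using r(2) nx by (auto simp: subset_iff)
    ultimately show ?thesis using K(2) by (simp add: D_def)
  qed
  have "(\<lambda>m. LINT x|lborel. D m x) \<longlonglongrightarrow> (LINT x|lborel. partial i \<phi> x)"
  proof (rule integral_dominated_convergence)
    show "integrable lborel (\<lambda>x. indicator B x *\<^sub>R C)"
      by (intro borel_integrable_compact) (auto simp: B_def)
    show "AE x in lborel. (\<lambda>m. D m x) \<longlonglongrightarrow> partial i \<phi> x"
    proof (intro AE_I2)
      fix x
      have "((\<lambda>h. (\<phi> (x + h *\<^sub>R ?e) - \<phi> x) / h) \<longlongrightarrow> partial i \<phi> x) (at 0)"
        using line[of x 0] by (simp add: DERIV_def)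
      moreover have "filterlim (\<lambda>m. 1 / real (Suc m)) (at 0) sequentially"
        unfolding filterlim_at using LIMSEQ_inverse_real_of_nat by (auto simp: inverse_eq_divide)
      ultimately have "(\<lambda>m. (\<phi> (x + (1 / real (Suc m)) *\<^sub>R ?e) - \<phi> x) / (1 / real (Suc m))) \<longlonglongrightarrow> partial i \<phi> x"
        by (rule filterlim_compose)
      thus "(\<lambda>m. D m x) \<longlonglongrightarrow> partial i \<phi> x" by (simp add: D_def)
    qed
    show "AE x in lborel. norm (D m x) \<le> indicator B x *\<^sub>R C" for m
      using Dbound Dzero by (intro AE_I2) (auto simp: indicator_def)
    show "D m \<in> borel_measurable lborel" for m
      unfolding D_def using meas by measurable
  qed (use meas in auto)
  moreover have "(LINT x|lborel. D m x) = 0" for m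
  proof -
    note int = test_functions_lebesgue(1)[OF assms]
    have "(LINT x|distr lborel borel ((+) y). \<phi> x) = (LINT x|lborel. \<phi> (y + x))" for y
      using meas by (intro integral_distr) auto
    moreover have "integrable (distr lborel borel ((+) y)) \<phi> \<longleftrightarrow> integrable lborel (\<lambda>x. \<phi> (y + x))" for y
      using meas by (intro integrable_distr_eq) auto
    ultimately show ?thesis
      using int by (simp add: D_def add.commute[of _ "(_::real) *\<^sub>R _"] lborel_distr_plus)
  qed
  ultimately have "(LINT x|lborel. partial i \<phi> x) = 0"
    by (simp add: LIMSEQ_const_iff)
  thus ?thesis using test_functions_lebesgue(2)[OF assms(1) test_functions_partial[OF \<phi>]] by simp
qed

lemma integration_by_parts_test_function:
  fixes \<Omega> :: "(real ^ 'n) set"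
  assumes "bounded \<Omega>" "open \<Omega>" and \<phi>: "\<phi> \<in> test_functions \<Omega>" and g: "\<And>k. C_k k g"
  shows "(LINT x|lebesgue_on \<Omega>. partial i \<phi> x * g x) = - (LINT x|lebesgue_on \<Omega>. \<phi> x * partial i g x)"
proof -
  have g': "C_k k (partial i g)" for k using g[of "Suc k"] by simp
  have gd: "g differentiable (at x)" for x using g[of 1] by simp
  have L: "partial i \<phi> \<in> L2 \<Omega>" "\<phi> \<in> L2 \<Omega>" "g \<in> L2 \<Omega>" "partial i g \<in> L2 \<Omega>"
    using assms(1,2) test_functions_L2[OF assms(1,2)] \<phi> test_functions_partial[OF \<phi>]
      C_k_continuous[OF g] C_k_continuous[OF g'] by (auto intro!: L2_continuous)
  have "(LINT x|lebesgue_on \<Omega>. partial i (\<lambda>x. \<phi> x * g x) x) = 0"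
    using assms by (intro integral_partial_test_function test_functions_mult)
  hence "(LINT x|lebesgue_on \<Omega>. \<phi> x * partial i g x + partial i \<phi> x * g x) = 0"
    using partial_mult[of \<phi> g i] test_functions_differentiable[OF \<phi>] gd by simp
  thus ?thesis using L by (simp add: L2_mult_integrable)
qed

text \<open>The cutoffs turn \<open>g\<close> into test functions, and |d g| is an integrable
  majorant. This leads from test functions to plane waves directly, without first deducing that
  \<open>d\<close> vanishes almost everywhere.\<close>

lemma annihilates_smooth:
  fixes \<Omega> :: "(real ^ 'n) set"
  assumes \<Omega>: "bounded \<Omega>" "open \<Omega>" and d: "d \<in> L2 \<Omega>" and g: "\<And>k. C_k k g"
    and "\<And>\<phi>. \<phi> \<in> test_functions \<Omega> \<Longrightarrow> (LINT x|lebesgue_on \<Omega>. d x * \<phi> x) = 0"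
  shows "(LINT x|lebesgue_on \<Omega>. d x * g x) = 0"
proof -
  obtain \<zeta> where \<zeta>: "\<And>m::nat. \<zeta> m \<in> test_functions \<Omega>" "\<And>m x. 0 \<le> \<zeta> m x \<and> \<zeta> m x \<le> 1"
    "\<And>x. x \<in> \<Omega> \<Longrightarrow> (\<lambda>m. \<zeta> m x) \<longlonglongrightarrow> 1"
    using cutoff_sequence[OF \<Omega>(2)] by blast
  have gL: "g \<in> L2 \<Omega>" using g C_k_continuous L2_continuous \<Omega> by blast
  have "(\<lambda>m. LINT x|lebesgue_on \<Omega>. d x * (\<zeta> m x * g x)) \<longlonglongrightarrow> (LINT x|lebesgue_on \<Omega>. d x * g x)"
  proof (rule integral_dominated_convergence)
    show "integrable (lebesgue_on \<Omega>) (\<lambda>x. \<bar>d x * g x\<bar>)"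
      using L2_mult_integrable[OF d gL] by simp
    show "(\<lambda>x. d x * g x) \<in> borel_measurable (lebesgue_on \<Omega>)"
      using L2_mult_integrable[OF d gL] by auto
    show "(\<lambda>x. d x * (\<zeta> m x * g x)) \<in> borel_measurable (lebesgue_on \<Omega>)" for m
      using d gL test_functions_L2[OF \<Omega> \<zeta>(1)[of m]] L2_measurable by (intro borel_measurable_times) blast+
    show "AE x in lebesgue_on \<Omega>. (\<lambda>m. d x * (\<zeta> m x * g x)) \<longlonglongrightarrow> d x * g x"
    proof (intro AE_I2)
      fix x assume "x \<in> space (lebesgue_on \<Omega>)"
      hence "x \<in> \<Omega>" by simp
      from tendsto_mult[OF tendsto_const[of "d x"] tendsto_mult[OF \<zeta>(3)[OF this] tendsto_const[of "g x"]]]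
      show "(\<lambda>m. d x * (\<zeta> m x * g x)) \<longlonglongrightarrow> d x * g x" by simp
    qed
    show "AE x in lebesgue_on \<Omega>. norm (d x * (\<zeta> m x * g x)) \<le> \<bar>d x * g x\<bar>" for m
    proof (intro AE_I2)
      fix x
      have "\<bar>d x * g x\<bar> * \<bar>\<zeta> m x\<bar> \<le> \<bar>d x * g x\<bar> * 1" using \<zeta>(2)[of m x] by (intro mult_left_mono) auto
      thus "norm (d x * (\<zeta> m x * g x)) \<le> \<bar>d x * g x\<bar>" by (simp add: abs_mult mult_ac)
    qed
  qed
  moreover have "(LINT x|lebesgue_on \<Omega>. d x * (\<zeta> m x * g x)) = 0" for m
    using assms(5) test_functions_mult[OF \<zeta>(1) g] by blast
  ultimately show ?thesis by (simp add: LIMSEQ_const_iff)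
qed

section \<open>Weak partial derivatives and their representatives\<close>

lemma is_weak_partial_L2: "is_weak_partial \<Omega> i u g \<Longrightarrow> u \<in> L2 \<Omega>" "is_weak_partial \<Omega> i u g \<Longrightarrow> g \<in> L2 \<Omega>"
  by (auto simp: is_weak_partial_def)

lemma is_weak_partial_eq:
  "is_weak_partial \<Omega> i u g \<Longrightarrow> \<phi> \<in> test_functions \<Omega> \<Longrightarrow>
    (LINT x|lebesgue_on \<Omega>. u x * partial i \<phi> x) = - (LINT x|lebesgue_on \<Omega>. g x * \<phi> x)"
  by (auto simp: is_weak_partial_def)

lemma weak_partial_is_weak_partial:
  "is_weak_partial \<Omega> i u g \<Longrightarrow> is_weak_partial \<Omega> i u (weak_partial \<Omega> i u)"
  unfolding weak_partial_def by (rule someI[where P="is_weak_partial \<Omega> i u"])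

lemma H2_weak_partial:
  assumes "u \<in> H2 \<Omega>"
  shows "is_weak_partial \<Omega> i u (weak_partial \<Omega> i u)"
    "is_weak_partial \<Omega> j (weak_partial \<Omega> i u) (weak_partial \<Omega> j (weak_partial \<Omega> i u))"
  using assms weak_partial_is_weak_partial unfolding H2_def by blast+

lemma H2_norm_bounds:
  fixes w :: "real ^ 'n \<Rightarrow> real"
  assumes "H2_norm \<Omega> w < e"
  shows "(LINT x|lebesgue_on \<Omega>. (w x)\<^sup>2) \<le> e\<^sup>2"
    "(LINT x|lebesgue_on \<Omega>. (weak_partial \<Omega> i w x)\<^sup>2) \<le> e\<^sup>2"
    "(LINT x|lebesgue_on \<Omega>. (weak_partial \<Omega> j (weak_partial \<Omega> i w) x)\<^sup>2) \<le> e\<^sup>2"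
proof -
  define a where "a = (LINT x|lebesgue_on \<Omega>. (w x)\<^sup>2)"
  define b where "b i = (LINT x|lebesgue_on \<Omega>. (weak_partial \<Omega> i w x)\<^sup>2)" for i
  define c where "c i j = (LINT x|lebesgue_on \<Omega>. (weak_partial \<Omega> j (weak_partial \<Omega> i w) x)\<^sup>2)" for i j
  have pos: "a \<ge> 0" "b i \<ge> 0" "c i j \<ge> 0" for i j by (simp_all add: a_def b_def c_def)
  have "sqrt (a + (\<Sum>i\<in>UNIV. b i) + (\<Sum>i\<in>UNIV. \<Sum>j\<in>UNIV. c i j)) < e"
    using assms by (simp add: H2_norm_def a_def b_def c_def)
  hence "a + (\<Sum>i\<in>UNIV. b i) + (\<Sum>i\<in>UNIV. \<Sum>j\<in>UNIV. c i j) \<le> e\<^sup>2"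
    by (metis less_imp_le sqrt_le_D)
  moreover have "b i \<le> (\<Sum>i\<in>UNIV. b i)" by (intro member_le_sum) (auto simp: pos)
  moreover have "c i j \<le> (\<Sum>j\<in>UNIV. c i j)" by (intro member_le_sum) (auto simp: pos)
  moreover have "(\<Sum>j\<in>UNIV. c i j) \<le> (\<Sum>i\<in>UNIV. \<Sum>j\<in>UNIV. c i j)"
    by (intro member_le_sum[where f="\<lambda>i. \<Sum>j\<in>UNIV. c i j"]) (auto simp: pos sum_nonneg)
  moreover have "0 \<le> (\<Sum>i\<in>UNIV. b i)" "0 \<le> (\<Sum>i\<in>UNIV. \<Sum>j\<in>UNIV. c i j)"
    by (auto intro!: sum_nonneg simp: pos)
  ultimately have "a \<le> e\<^sup>2" "b i \<le> e\<^sup>2" "c i j \<le> e\<^sup>2" using pos(1) by linarith+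
  thus "(LINT x|lebesgue_on \<Omega>. (w x)\<^sup>2) \<le> e\<^sup>2"
    "(LINT x|lebesgue_on \<Omega>. (weak_partial \<Omega> i w x)\<^sup>2) \<le> e\<^sup>2"
    "(LINT x|lebesgue_on \<Omega>. (weak_partial \<Omega> j (weak_partial \<Omega> i w) x)\<^sup>2) \<le> e\<^sup>2"
    by (simp_all add: a_def b_def c_def)
qed

lemma L2_integral_bound:
  assumes "u \<in> L2 \<Omega>" "v \<in> L2 \<Omega>" "(LINT x|lebesgue_on \<Omega>. (u x)\<^sup>2) \<le> e\<^sup>2" "e \<ge> 0"
  shows "\<bar>LINT x|lebesgue_on \<Omega>. u x * v x\<bar> \<le> e * sqrt (LINT x|lebesgue_on \<Omega>. (v x)\<^sup>2)"
proof -
  have "(LINT x|lebesgue_on \<Omega>. u x * v x)\<^sup>2 \<le> e\<^sup>2 * (LINT x|lebesgue_on \<Omega>. (v x)\<^sup>2)"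
    by (rule order_trans[OF L2_cauchy_schwarz[OF assms(1,2)]]) (intro mult_right_mono assms, simp)
  hence "sqrt ((LINT x|lebesgue_on \<Omega>. u x * v x)\<^sup>2) \<le> sqrt (e\<^sup>2 * (LINT x|lebesgue_on \<Omega>. (v x)\<^sup>2))"
    by (rule real_sqrt_le_mono)
  thus ?thesis using assms(4) by (simp add: real_sqrt_mult)
qed

context
  fixes \<Omega> :: "(real ^ 'n) set"
  assumes \<Omega>: "bounded \<Omega>" "open \<Omega>"
begin

text \<open>The second claim concerns the representative that \<open>weak_partial\<close> picks for
  the difference, not the difference of the representatives. Both are weak derivatives of
  \<open>w\<close>, hence agree when integrated against \<open>partial j \<psi>\<close>, and the
  defining identity uses nothing else.\<close>

lemma weak_partial_difference:
  assumes "u \<in> H2 \<Omega>" and \<phi>: "\<phi> \<in> test_functions \<Omega>"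
  defines "w \<equiv> \<lambda>x. u x - \<phi> x"
  shows "is_weak_partial \<Omega> i w (\<lambda>x. weak_partial \<Omega> i u x - partial i \<phi> x)"
    and "is_weak_partial \<Omega> j (weak_partial \<Omega> i w)
          (\<lambda>x. weak_partial \<Omega> j (weak_partial \<Omega> i u) x - partial j (partial i \<phi>) x)"
proof -
  note wp = H2_weak_partial[OF assms(1)]
  note p\<phi> = test_functions_partial[OF \<phi>, of i] test_functions_partial[OF test_functions_partial[OF \<phi>, of i], of j]
  note L = is_weak_partial_L2[OF wp(1)[of i]] is_weak_partial_L2(2)[OF wp(2)[where i=i and j=j]]
    test_functions_L2[OF \<Omega> \<phi>] test_functions_L2[OF \<Omega> p\<phi>(1)] test_functions_L2[OF \<Omega> p\<phi>(2)]
  have w: "w \<in> L2 \<Omega>" unfolding w_def using L by (intro L2_diff)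
  have *: "(LINT x|lebesgue_on \<Omega>. w x * partial i \<psi> x)
        = - (LINT x|lebesgue_on \<Omega>. (weak_partial \<Omega> i u x - partial i \<phi> x) * \<psi> x)"
    if \<psi>: "\<psi> \<in> test_functions \<Omega>" for \<psi>
  proof -
    note L' = test_functions_L2[OF \<Omega> \<psi>] test_functions_L2[OF \<Omega> test_functions_partial[OF \<psi>, of i]]
    have "(LINT x|lebesgue_on \<Omega>. w x * partial i \<psi> x)
        = (LINT x|lebesgue_on \<Omega>. u x * partial i \<psi> x) - (LINT x|lebesgue_on \<Omega>. \<phi> x * partial i \<psi> x)"
      unfolding w_def left_diff_distrib using L L' by (intro Bochner_Integration.integral_diff L2_mult_integrable)
    also have "\<dots> = - ((LINT x|lebesgue_on \<Omega>. weak_partial \<Omega> i u x * \<psi> x) - (LINT x|lebesgue_on \<Omega>. partial i \<phi> x * \<psi> x))"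
      using is_weak_partial_eq[OF wp(1) \<psi>, of i]
        integration_by_parts_test_function[OF \<Omega> \<phi> test_functions_C_k[OF \<psi>], of i] by simp
    also have "\<dots> = - (LINT x|lebesgue_on \<Omega>. (weak_partial \<Omega> i u x - partial i \<phi> x) * \<psi> x)"
      unfolding left_diff_distrib using L L' by (subst Bochner_Integration.integral_diff) (auto intro!: L2_mult_integrable)
    finally show ?thesis .
  qed
  show 1: "is_weak_partial \<Omega> i w (\<lambda>x. weak_partial \<Omega> i u x - partial i \<phi> x)"
    unfolding is_weak_partial_def using w L * by (auto intro!: L2_diff)
  note wpw = weak_partial_is_weak_partial[OF 1]
  have "(LINT x|lebesgue_on \<Omega>. weak_partial \<Omega> i w x * partial j \<psi> x)
        = - (LINT x|lebesgue_on \<Omega>. (weak_partial \<Omega> j (weak_partial \<Omega> i u) x - partial j (partial i \<phi>) x) * \<psi> x)"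
    if \<psi>: "\<psi> \<in> test_functions \<Omega>" for \<psi>
  proof -
    note p\<psi> = test_functions_partial[OF \<psi>, of j]
    note L' = test_functions_L2[OF \<Omega> \<psi>] test_functions_L2[OF \<Omega> p\<psi>]
    have "(LINT x|lebesgue_on \<Omega>. weak_partial \<Omega> i w x * partial j \<psi> x)
        = (LINT x|lebesgue_on \<Omega>. (weak_partial \<Omega> i u x - partial i \<phi> x) * partial j \<psi> x)"
      using is_weak_partial_eq[OF 1 p\<psi>] is_weak_partial_eq[OF wpw p\<psi>] by simp
    also have "\<dots> = (LINT x|lebesgue_on \<Omega>. weak_partial \<Omega> i u x * partial j \<psi> x)
         - (LINT x|lebesgue_on \<Omega>. partial i \<phi> x * partial j \<psi> x)"
      unfolding left_diff_distrib using L L' by (intro Bochner_Integration.integral_diff L2_mult_integrable)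
    also have "\<dots> = - ((LINT x|lebesgue_on \<Omega>. weak_partial \<Omega> j (weak_partial \<Omega> i u) x * \<psi> x)
         - (LINT x|lebesgue_on \<Omega>. partial j (partial i \<phi>) x * \<psi> x))"
      using is_weak_partial_eq[OF wp(2)[where i=i and j=j] \<psi>]
        integration_by_parts_test_function[OF \<Omega> p\<phi>(1) test_functions_C_k[OF \<psi>], of j] by simp
    also have "\<dots> = - (LINT x|lebesgue_on \<Omega>. (weak_partial \<Omega> j (weak_partial \<Omega> i u) x - partial j (partial i \<phi>) x) * \<psi> x)"
      unfolding left_diff_distrib using L L' by (subst Bochner_Integration.integral_diff) (auto intro!: L2_mult_integrable)
    finally show ?thesis .
  qed
  thus "is_weak_partial \<Omega> j (weak_partial \<Omega> i w)
          (\<lambda>x. weak_partial \<Omega> j (weak_partial \<Omega> i u) x - partial j (partial i \<phi>) x)"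
    unfolding is_weak_partial_def using is_weak_partial_L2[OF wpw] L by (auto intro!: L2_diff)
qed

text \<open>
  This replaces the uniqueness of weak derivatives: the representative chosen by \<open>weak_partial\<close> is
  irrelevant when it is integrated against a smooth function.
\<close>

lemma is_weak_partial_smooth_eq:
  assumes "is_weak_partial \<Omega> i w p" "is_weak_partial \<Omega> i w q" and g: "\<And>k. C_k k g"
  shows "(LINT x|lebesgue_on \<Omega>. p x * g x) = (LINT x|lebesgue_on \<Omega>. q x * g x)"
proof -
  note L = is_weak_partial_L2(2)[OF assms(1)] is_weak_partial_L2(2)[OF assms(2)]
  have gL: "g \<in> L2 \<Omega>" using C_k_continuous[OF g] L2_continuous \<Omega> by simp
  have "(LINT x|lebesgue_on \<Omega>. (p x - q x) * \<phi> x) = 0" if \<phi>: "\<phi> \<in> test_functions \<Omega>" for \<phi>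
    using is_weak_partial_eq[OF assms(1) \<phi>] is_weak_partial_eq[OF assms(2) \<phi>] L test_functions_L2[OF \<Omega> \<phi>]
    unfolding left_diff_distrib by (subst Bochner_Integration.integral_diff) (auto intro!: L2_mult_integrable)
  hence "(LINT x|lebesgue_on \<Omega>. (p x - q x) * g x) = 0"
    by (intro annihilates_smooth[OF \<Omega> _ g] L2_diff L)
  thus ?thesis using L gL
    unfolding left_diff_distrib by (subst (asm) Bochner_Integration.integral_diff) (auto intro!: L2_mult_integrable)
qed

text \<open>For a test function in place of u these are integrations by parts without boundary term,
  whatever the support of g. Approximation of u in the norm of H2 preserves them. With g a plane
  wave they give the Fourier transforms of the weak derivatives.\<close>

lemma H2_0_weak_partial_smooth:
  assumes "u \<in> H2_0 \<Omega>" and g: "\<And>k. C_k k g"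
  shows "(LINT x|lebesgue_on \<Omega>. weak_partial \<Omega> i u x * g x) = - (LINT x|lebesgue_on \<Omega>. u x * partial i g x)"
    and "(LINT x|lebesgue_on \<Omega>. weak_partial \<Omega> j (weak_partial \<Omega> i u) x * g x)
          = (LINT x|lebesgue_on \<Omega>. u x * partial i (partial j g) x)"
proof -
  have u: "u \<in> H2 \<Omega>" using assms(1) by (simp add: H2_0_def)
  note wp = H2_weak_partial[OF u]
  have g': "C_k k (partial j g)" for k using g[of "Suc k"] by simp
  have g'': "C_k k (partial i g)" for k i using g[of "Suc k"] by simp
  have g2: "C_k k (partial i (partial j g))" for k using g'[of "Suc k"] by simp
  have gL: "g \<in> L2 \<Omega>" "partial i g \<in> L2 \<Omega>" "partial i (partial j g) \<in> L2 \<Omega>"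
    using C_k_continuous[OF g] C_k_continuous[OF g''[of _ i]] C_k_continuous[OF g2] L2_continuous \<Omega> by simp_all
  let ?N = "\<lambda>f. sqrt (LINT x|lebesgue_on \<Omega>. (f x)\<^sup>2)"
  \<comment> \<open>The defects for u equal those for w = u - \<phi>, because \<phi> has none.
    Cauchy-Schwarz bounds the latter by e times a constant that depends only on g.\<close>
  have main: "\<bar>(LINT x|lebesgue_on \<Omega>. weak_partial \<Omega> i u x * g x) + (LINT x|lebesgue_on \<Omega>. u x * partial i g x)\<bar>
        \<le> e * (?N g + ?N (partial i g)) \<and>
      \<bar>(LINT x|lebesgue_on \<Omega>. weak_partial \<Omega> j (weak_partial \<Omega> i u) x * g x)
          - (LINT x|lebesgue_on \<Omega>. u x * partial i (partial j g) x)\<bar>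
        \<le> e * (?N g + ?N (partial i (partial j g)))" if "e > 0" for e
  proof -
    obtain \<phi> where \<phi>: "\<phi> \<in> test_functions \<Omega>" "H2_norm \<Omega> (\<lambda>x. u x - \<phi> x) < e"
      using assms(1) \<open>e > 0\<close> unfolding H2_0_def by blast
    define w where "w = (\<lambda>x. u x - \<phi> x)"
    note wd = weak_partial_difference[OF u \<phi>(1), folded w_def]
    note ww = weak_partial_is_weak_partial[OF wd(1)[of i]] weak_partial_is_weak_partial[OF wd(2)[where i=i and j=j]]
    note p\<phi> = test_functions_partial[OF \<phi>(1), of i] test_functions_partial[OF test_functions_partial[OF \<phi>(1), of i], of j]
    note L = is_weak_partial_L2[OF wp(1)[of i]] is_weak_partial_L2(2)[OF wp(2)[where i=i and j=j]]
      test_functions_L2[OF \<Omega> \<phi>(1)] test_functions_L2[OF \<Omega> p\<phi>(1)] test_functions_L2[OF \<Omega> p\<phi>(2)] gL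
      is_weak_partial_L2[OF ww(1)] is_weak_partial_L2(2)[OF ww(2)]
    have nw: "H2_norm \<Omega> w < e" using \<phi>(2) by (simp add: w_def)
    note nb = H2_norm_bounds[OF nw]
    have e0: "e \<ge> 0" using that by simp
    have b1: "\<bar>LINT x|lebesgue_on \<Omega>. weak_partial \<Omega> i w x * g x\<bar> \<le> e * ?N g"
      by (rule L2_integral_bound[OF _ _ nb(2) e0]) (use L in auto)
    have b2: "\<bar>LINT x|lebesgue_on \<Omega>. w x * partial i g x\<bar> \<le> e * ?N (partial i g)"
      by (rule L2_integral_bound[OF _ _ nb(1) e0]) (use L in auto)
    have b3: "\<bar>LINT x|lebesgue_on \<Omega>. weak_partial \<Omega> j (weak_partial \<Omega> i w) x * g x\<bar> \<le> e * ?N g"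
      by (rule L2_integral_bound[OF _ _ nb(3) e0]) (use L in auto)
    have b4: "\<bar>LINT x|lebesgue_on \<Omega>. w x * partial i (partial j g) x\<bar> \<le> e * ?N (partial i (partial j g))"
      by (rule L2_integral_bound[OF _ _ nb(1) e0]) (use L in auto)
    have "(LINT x|lebesgue_on \<Omega>. weak_partial \<Omega> i w x * g x)
        = (LINT x|lebesgue_on \<Omega>. weak_partial \<Omega> i u x * g x) - (LINT x|lebesgue_on \<Omega>. partial i \<phi> x * g x)"
      unfolding is_weak_partial_smooth_eq[OF ww(1) wd(1) g] left_diff_distrib
      using L by (intro Bochner_Integration.integral_diff L2_mult_integrable)
    moreover have "(LINT x|lebesgue_on \<Omega>. w x * partial i g x)
        = (LINT x|lebesgue_on \<Omega>. u x * partial i g x) - (LINT x|lebesgue_on \<Omega>. \<phi> x * partial i g x)"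
      unfolding w_def left_diff_distrib
      using L by (intro Bochner_Integration.integral_diff L2_mult_integrable)
    moreover have "(LINT x|lebesgue_on \<Omega>. weak_partial \<Omega> j (weak_partial \<Omega> i w) x * g x)
        = (LINT x|lebesgue_on \<Omega>. weak_partial \<Omega> j (weak_partial \<Omega> i u) x * g x)
          - (LINT x|lebesgue_on \<Omega>. partial j (partial i \<phi>) x * g x)"
      unfolding is_weak_partial_smooth_eq[OF ww(2) wd(2) g] left_diff_distrib
      using L by (intro Bochner_Integration.integral_diff L2_mult_integrable)
    moreover have "(LINT x|lebesgue_on \<Omega>. w x * partial i (partial j g) x)
        = (LINT x|lebesgue_on \<Omega>. u x * partial i (partial j g) x) - (LINT x|lebesgue_on \<Omega>. \<phi> x * partial i (partial j g) x)"
      unfolding w_def left_diff_distrib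
      using L by (intro Bochner_Integration.integral_diff L2_mult_integrable)
    moreover have "(LINT x|lebesgue_on \<Omega>. partial i \<phi> x * g x) = - (LINT x|lebesgue_on \<Omega>. \<phi> x * partial i g x)"
      by (rule integration_by_parts_test_function[OF \<Omega> \<phi>(1) g])
    \<comment> \<open>The outer derivative j is moved first and the inner derivative i second; this
      fixes the order in \<open>partial i (partial j g)\<close>.\<close>
    moreover have "(LINT x|lebesgue_on \<Omega>. partial j (partial i \<phi>) x * g x) = - (LINT x|lebesgue_on \<Omega>. partial i \<phi> x * partial j g x)"
      by (rule integration_by_parts_test_function[OF \<Omega> p\<phi>(1) g])
    moreover have "(LINT x|lebesgue_on \<Omega>. partial i \<phi> x * partial j g x) = - (LINT x|lebesgue_on \<Omega>. \<phi> x * partial i (partial j g) x)"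
      by (rule integration_by_parts_test_function[OF \<Omega> \<phi>(1) g'])
    ultimately show ?thesis using b1 b2 b3 b4 unfolding distrib_left by linarith
  qed
  have zero: "x = 0" if "\<And>e. e > 0 \<Longrightarrow> \<bar>x\<bar> \<le> e * C" "C \<ge> 0" for x C :: real
  proof (rule ccontr)
    assume "x \<noteq> 0"
    hence "\<bar>x\<bar> \<le> \<bar>x\<bar> / (2 * (C + 1)) * C" using that by (intro that(1)) auto
    also have "\<dots> < \<bar>x\<bar>" using \<open>x \<noteq> 0\<close> that(2) by (simp add: field_simps add_strict_increasing2)
    finally show False by simp
  qed
  show "(LINT x|lebesgue_on \<Omega>. weak_partial \<Omega> i u x * g x) = - (LINT x|lebesgue_on \<Omega>. u x * partial i g x)"
    using zero[OF main[THEN conjunct1]] by simp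
  show "(LINT x|lebesgue_on \<Omega>. weak_partial \<Omega> j (weak_partial \<Omega> i u) x * g x)
          = (LINT x|lebesgue_on \<Omega>. u x * partial i (partial j g) x)"
    using zero[OF main[THEN conjunct2]] by simp
qed

end

section \<open>Trigonometric test functions\<close>

lemma trig_derivative_closed:
  "\<beta> \<in> {sin, cos, \<lambda>t. - sin t, \<lambda>t. - cos t} \<Longrightarrow>
    \<exists>\<beta>'\<in>{sin, cos, \<lambda>t. - sin t, \<lambda>t. - cos t}. \<forall>t::real. (\<beta> has_real_derivative \<beta>' t) (at t)"
  by (auto intro!: derivative_eq_intros)

lemma C_k_inner: "C_k k (\<lambda>x. \<xi> \<bullet> x)"
  unfolding inner_vec_def by (auto intro!: C_k_sum C_k_mult C_k_const C_k_component)

lemma C_k_trig: "C_k k (\<lambda>x. cos (\<xi> \<bullet> x))" "C_k k (\<lambda>x. sin (\<xi> \<bullet> x))"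
  by (rule C_k_compose[OF trig_derivative_closed C_k_inner], simp_all)+

lemma partial_trig:
  "partial i (\<lambda>x. cos (\<xi> \<bullet> x)) = (\<lambda>x. - (\<xi> $ i) * sin (\<xi> \<bullet> x))"
  "partial i (\<lambda>x. sin (\<xi> \<bullet> x)) = (\<lambda>x. \<xi> $ i * cos (\<xi> \<bullet> x))"
proof -
  have "((\<lambda>x. cos (\<xi> \<bullet> x)) has_derivative (\<lambda>h. - (\<xi> \<bullet> h) * sin (\<xi> \<bullet> x))) (at x)" for x
    by (auto intro!: derivative_eq_intros)
  from partial_eqI[OF this] show "partial i (\<lambda>x. cos (\<xi> \<bullet> x)) = (\<lambda>x. - (\<xi> $ i) * sin (\<xi> \<bullet> x))"
    by (auto simp: inner_axis)
  have "((\<lambda>x. sin (\<xi> \<bullet> x)) has_derivative (\<lambda>h. (\<xi> \<bullet> h) * cos (\<xi> \<bullet> x))) (at x)" for x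
    by (auto intro!: derivative_eq_intros)
  from partial_eqI[OF this] show "partial i (\<lambda>x. sin (\<xi> \<bullet> x)) = (\<lambda>x. \<xi> $ i * cos (\<xi> \<bullet> x))"
    by (auto simp: inner_axis)
qed

lemma partial_scale:
  assumes "\<And>x. g differentiable (at x)"
  shows "partial i (\<lambda>x. c * g x) = (\<lambda>x. c * partial i g x)"
  using partial_mult[of "\<lambda>x. c" g i] assms by (simp add: partial_const)

text \<open>With \<open>fsin\<close> below, fcos - i fsin is the unnormalized Fourier transform.
  Separate real parts keep all function spaces and inner products real.\<close>

definition fcos :: "(real ^ 'n) set \<Rightarrow> (real ^ 'n \<Rightarrow> real) \<Rightarrow> real ^ 'n \<Rightarrow> real" where
  "fcos \<Omega> u \<xi> = (LINT x|lebesgue_on \<Omega>. u x * cos (\<xi> \<bullet> x))"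

definition fsin :: "(real ^ 'n) set \<Rightarrow> (real ^ 'n \<Rightarrow> real) \<Rightarrow> real ^ 'n \<Rightarrow> real" where
  "fsin \<Omega> u \<xi> = (LINT x|lebesgue_on \<Omega>. u x * sin (\<xi> \<bullet> x))"

text \<open>Differentiation multiplies the transform by i \<xi>_i, which in real terms interchanges
  the cosine and sine parts. Squaring and adding then gives \<xi>_i^2 times the power
  spectrum.\<close>

lemma fourier_weak_partial:
  assumes "bounded \<Omega>" "open \<Omega>" "u \<in> H2_0 \<Omega>"
  shows "fcos \<Omega> (weak_partial \<Omega> i u) \<xi> = \<xi> $ i * fsin \<Omega> u \<xi>"
    "fsin \<Omega> (weak_partial \<Omega> i u) \<xi> = - \<xi> $ i * fcos \<Omega> u \<xi>"
  unfolding fcos_def fsin_def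
  by (simp_all only: H2_0_weak_partial_smooth[OF assms C_k_trig(1)] H2_0_weak_partial_smooth[OF assms C_k_trig(2)] partial_trig)
     (simp_all add: mult.left_commute mult.commute[of "u _"] mult.assoc)

lemma H2_0_L2:
  assumes "u \<in> H2_0 \<Omega>"
  shows "u \<in> L2 \<Omega>" "weak_partial \<Omega> i u \<in> L2 \<Omega>" "weak_partial \<Omega> j (weak_partial \<Omega> i u) \<in> L2 \<Omega>"
    "weak_laplacian \<Omega> u \<in> L2 \<Omega>"
proof -
  have u: "u \<in> H2 \<Omega>" using assms by (simp add: H2_0_def)
  show *: "u \<in> L2 \<Omega>" "weak_partial \<Omega> i u \<in> L2 \<Omega>" "weak_partial \<Omega> j (weak_partial \<Omega> i u) \<in> L2 \<Omega>" for i j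
    using is_weak_partial_L2 H2_weak_partial[OF u] by blast+
  show "weak_laplacian \<Omega> u \<in> L2 \<Omega>"
    unfolding weak_laplacian_def using *(3) by (intro L2_sum) auto
qed

lemma trig_L2:
  fixes \<Omega> :: "(real ^ 'n) set"
  assumes "bounded \<Omega>" "open \<Omega>"
  shows "(\<lambda>x. cos (\<xi> \<bullet> x)) \<in> L2 \<Omega>" "(\<lambda>x. sin (\<xi> \<bullet> x)) \<in> L2 \<Omega>"
  using assms by (auto intro!: L2_continuous continuous_intros)

lemma fourier_sum:
  fixes \<Omega> :: "(real ^ 'n) set"
  assumes "bounded \<Omega>" "open \<Omega>" "finite A" "\<And>a. a \<in> A \<Longrightarrow> f a \<in> L2 \<Omega>"
  shows "fcos \<Omega> (\<lambda>x. \<Sum>a\<in>A. f a x) \<xi> = (\<Sum>a\<in>A. fcos \<Omega> (f a) \<xi>)"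
    "fsin \<Omega> (\<lambda>x. \<Sum>a\<in>A. f a x) \<xi> = (\<Sum>a\<in>A. fsin \<Omega> (f a) \<xi>)"
  unfolding fcos_def fsin_def sum_distrib_right
  using assms trig_L2[OF assms(1,2)] by (auto intro!: Bochner_Integration.integral_sum L2_mult_integrable)

lemma fourier_scale: "fcos \<Omega> (\<lambda>x. c * f x) \<xi> = c * fcos \<Omega> f \<xi>" "fsin \<Omega> (\<lambda>x. c * f x) \<xi> = c * fsin \<Omega> f \<xi>"
  by (simp_all add: fcos_def fsin_def mult.assoc)

lemma fourier_weak_laplacian:
  fixes \<xi> :: "real ^ 'n"
  assumes "bounded \<Omega>" "open \<Omega>" "u \<in> H2_0 \<Omega>"
  shows "fcos \<Omega> (weak_laplacian \<Omega> u) \<xi> = - (norm \<xi>)\<^sup>2 * fcos \<Omega> u \<xi>"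
    "fsin \<Omega> (weak_laplacian \<Omega> u) \<xi> = - (norm \<xi>)\<^sup>2 * fsin \<Omega> u \<xi>"
proof -
  have d: "(\<lambda>x. cos (\<xi> \<bullet> x)) differentiable (at x)" "(\<lambda>x. sin (\<xi> \<bullet> x)) differentiable (at x)" for x
    using C_k_trig[of 1 \<xi>] by simp_all
  have c: "fcos \<Omega> (weak_partial \<Omega> i (weak_partial \<Omega> i u)) \<xi> = - (\<xi> $ i)\<^sup>2 * fcos \<Omega> u \<xi>" for i
  proof -
    have "fcos \<Omega> (weak_partial \<Omega> i (weak_partial \<Omega> i u)) \<xi> = (LINT x|lebesgue_on \<Omega>. u x * (- (\<xi> $ i) * (\<xi> $ i * cos (\<xi> \<bullet> x))))"
      unfolding fcos_def H2_0_weak_partial_smooth(2)[OF assms C_k_trig(1)] partial_trig(1) partial_scale[OF d(2)] partial_trig(2) ..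
    also have "\<dots> = - (\<xi> $ i)\<^sup>2 * fcos \<Omega> u \<xi>"
      unfolding fcos_def integral_mult_right_zero[symmetric] by (simp add: power2_eq_square mult_ac)
    finally show ?thesis .
  qed
  have s: "fsin \<Omega> (weak_partial \<Omega> i (weak_partial \<Omega> i u)) \<xi> = - (\<xi> $ i)\<^sup>2 * fsin \<Omega> u \<xi>" for i
  proof -
    have "fsin \<Omega> (weak_partial \<Omega> i (weak_partial \<Omega> i u)) \<xi> = (LINT x|lebesgue_on \<Omega>. u x * (\<xi> $ i * (- (\<xi> $ i) * sin (\<xi> \<bullet> x))))"
      unfolding fsin_def H2_0_weak_partial_smooth(2)[OF assms C_k_trig(2)] partial_trig(2) partial_scale[OF d(1)] partial_trig(1) ..
    also have "\<dots> = - (\<xi> $ i)\<^sup>2 * fsin \<Omega> u \<xi>"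
      unfolding fsin_def integral_mult_right_zero[symmetric] by (simp add: power2_eq_square mult_ac)
    finally show ?thesis .
  qed
  have n: "(norm \<xi>)\<^sup>2 = (\<Sum>i\<in>UNIV. (\<xi> $ i)\<^sup>2)"
    by (simp add: norm_vec_def L2_set_def sum_nonneg)
  show "fcos \<Omega> (weak_laplacian \<Omega> u) \<xi> = - (norm \<xi>)\<^sup>2 * fcos \<Omega> u \<xi>"
    unfolding weak_laplacian_def n using assms
    by (subst fourier_sum) (auto simp: c H2_0_L2 sum_distrib_right sum_negf)
  show "fsin \<Omega> (weak_laplacian \<Omega> u) \<xi> = - (norm \<xi>)\<^sup>2 * fsin \<Omega> u \<xi>"
    unfolding weak_laplacian_def n using assms
    by (subst fourier_sum) (auto simp: s H2_0_L2 sum_distrib_right sum_negf)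
qed

section \<open>The Plancherel identity\<close>

text \<open>\<open>lborel\<close> is the image of the product measure under the map from coordinates
  to vectors, so products of functions of one coordinate integrate factor by factor. The values are
  complex because exp (i \<xi> \<bullet> z) factors over the coordinates, whereas its real part does
  not.\<close>

lemma integral_lborel_prod_Basis:
  fixes f :: "'a::euclidean_space \<Rightarrow> real \<Rightarrow> complex"
  assumes "\<And>b. b \<in> Basis \<Longrightarrow> integrable lborel (f b)"
  shows "integrable lborel (\<lambda>\<xi>::'a. \<Prod>b\<in>Basis. f b (\<xi> \<bullet> b))"
    "(LINT \<xi>|lborel. (\<Prod>b\<in>Basis. f b ((\<xi>::'a) \<bullet> b))) = (\<Prod>b\<in>Basis. LINT t|lborel. f b t)"
proof -
  interpret product_sigma_finite "\<lambda>_. lborel :: real measure" ..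
  let ?T = "\<lambda>g::'a \<Rightarrow> real. \<Sum>b\<in>Basis. g b *\<^sub>R b"
  have T: "?T \<in> measurable (\<Pi>\<^sub>M b\<in>Basis. (lborel :: real measure)) (borel :: 'a measure)"
    by measurable
  have comp: "(\<Prod>b\<in>Basis. f b (?T g \<bullet> b)) = (\<Prod>b\<in>Basis. f b (g b))" for g
    by (intro prod.cong) (auto simp: inner_sum_left inner_Basis if_distrib cong: if_cong)
  have meas: "(\<lambda>\<xi>::'a. \<Prod>b\<in>Basis. f b (\<xi> \<bullet> b)) \<in> borel_measurable borel"
  proof (intro borel_measurable_prod)
    fix b :: 'a assume "b \<in> Basis"
    from borel_measurable_integrable[OF assms[OF this]] have "f b \<in> borel_measurable borel" by simp
    thus "(\<lambda>\<xi>. f b (\<xi> \<bullet> b)) \<in> borel_measurable borel" by measurable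
  qed
  have i: "integrable (\<Pi>\<^sub>M b\<in>Basis. lborel) (\<lambda>g. \<Prod>b\<in>Basis. f b (g b))"
    using assms by (intro product_integrable_prod) auto
  show "integrable lborel (\<lambda>\<xi>::'a. \<Prod>b\<in>Basis. f b (\<xi> \<bullet> b))"
    unfolding lborel_eq[where 'a='a] using i by (subst integrable_distr_eq[OF T meas]) (simp add: comp)
  have "(LINT \<xi>|lborel. (\<Prod>b\<in>Basis. f b ((\<xi>::'a) \<bullet> b)))
      = (LINT g|Pi\<^sub>M (Basis::'a set) (\<lambda>_. lborel). (\<Prod>b\<in>Basis. f b (g b)))"
    unfolding lborel_eq[where 'a='a] by (subst integral_distr[OF T meas]) (simp add: comp)
  also have "\<dots> = (\<Prod>b\<in>Basis. LINT t|lborel. f b t)"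
    using assms by (intro product_integral_prod) auto
  finally show "(LINT \<xi>|lborel. (\<Prod>b\<in>Basis. f b ((\<xi>::'a) \<bullet> b))) = (\<Prod>b\<in>Basis. LINT t|lborel. f b t)" .
qed

text \<open>After the substitution x = \<delta> t this is the characteristic function of the
  standard normal distribution at z / \<delta>.\<close>

lemma gauss_fourier_real:
  assumes "\<delta> > 0"
  shows "integrable lborel (\<lambda>t. complex_of_real (exp (- (\<delta>\<^sup>2 * t\<^sup>2 / 2))) * iexp (t * z))"
    "(LINT t|lborel. complex_of_real (exp (- (\<delta>\<^sup>2 * t\<^sup>2 / 2))) * iexp (t * z)) = complex_of_real (sqrt (2 * pi) / \<delta> * exp (- (z\<^sup>2 / (2 * \<delta>\<^sup>2))))"
proof -
  let ?f = "\<lambda>x. std_normal_density x *\<^sub>R iexp (z / \<delta> * x)"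
  have i: "integrable lborel ?f"
    by (rule Bochner_Integration.integrable_bound[OF integrable_normal_density[of 1 0]]) auto
  have c: "(LINT x|lborel. ?f x) = complex_of_real (exp (- ((z / \<delta>)\<^sup>2 / 2)))"
  proof -
    have "(LINT x|lborel. ?f x) = char std_normal_distribution (z / \<delta>)"
      unfolding char_def by (rule integral_density[symmetric]) auto
    thus ?thesis by (simp add: char_std_normal_distribution)
  qed
  have eq: "?f (0 + \<delta> * t) = complex_of_real (1 / sqrt (2 * pi)) * (complex_of_real (exp (- (\<delta>\<^sup>2 * t\<^sup>2 / 2))) * iexp (t * z))" for t
    using assms by (simp add: std_normal_density_def power_mult_distrib scaleR_conv_of_real mult_ac)
  have i2: "integrable lborel (\<lambda>t. ?f (0 + \<delta> * t))"
    using lborel_integrable_real_affine[OF i, of \<delta> 0] assms by simp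
  show int: "integrable lborel (\<lambda>t. complex_of_real (exp (- (\<delta>\<^sup>2 * t\<^sup>2 / 2))) * iexp (t * z))"
  proof -
    have "complex_of_real (exp (- (\<delta>\<^sup>2 * t\<^sup>2 / 2))) * iexp (t * z) = complex_of_real (sqrt (2 * pi)) * ?f (0 + \<delta> * t)" for t
      unfolding eq mult.assoc[symmetric] of_real_mult[symmetric] by simp
    thus ?thesis using Bochner_Integration.integrable_mult_right[OF i2, of "complex_of_real (sqrt (2 * pi))"] by presburger
  qed
  have "(LINT x|lborel. ?f x) = \<delta> *\<^sub>R (LINT t|lborel. ?f (0 + \<delta> * t))"
    using lborel_integral_real_affine[of \<delta> ?f 0] assms by simp
  also have "\<dots> = complex_of_real (\<delta> / sqrt (2 * pi)) * (LINT t|lborel. complex_of_real (exp (- (\<delta>\<^sup>2 * t\<^sup>2 / 2))) * iexp (t * z))"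
    unfolding eq by (simp add: scaleR_conv_of_real)
  finally have "complex_of_real (\<delta> / sqrt (2 * pi)) * (LINT t|lborel. complex_of_real (exp (- (\<delta>\<^sup>2 * t\<^sup>2 / 2))) * iexp (t * z))
     = complex_of_real (exp (- (z\<^sup>2 / (2 * \<delta>\<^sup>2))))"
    using c by (simp add: power_divide mult.commute)
  hence "complex_of_real (sqrt (2 * pi) / \<delta>) * (complex_of_real (\<delta> / sqrt (2 * pi)) * (LINT t|lborel. complex_of_real (exp (- (\<delta>\<^sup>2 * t\<^sup>2 / 2))) * iexp (t * z)))
     = complex_of_real (sqrt (2 * pi) / \<delta>) * complex_of_real (exp (- (z\<^sup>2 / (2 * \<delta>\<^sup>2))))" by simp
  moreover have "complex_of_real (sqrt (2 * pi) / \<delta>) * complex_of_real (\<delta> / sqrt (2 * pi)) = 1"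
    using assms by (simp flip: of_real_mult)
  ultimately show "(LINT t|lborel. complex_of_real (exp (- (\<delta>\<^sup>2 * t\<^sup>2 / 2))) * iexp (t * z)) = complex_of_real (sqrt (2 * pi) / \<delta> * exp (- (z\<^sup>2 / (2 * \<delta>\<^sup>2))))"
    by (metis (no_types, lifting) mult.assoc mult_1 of_real_mult)
qed

definition gauss :: "real \<Rightarrow> 'a::euclidean_space \<Rightarrow> real" where
  "gauss \<delta> \<xi> = exp (- (\<delta>\<^sup>2 * (norm \<xi>)\<^sup>2 / 2))"

lemma gauss_fourier:
  fixes z :: "'a::euclidean_space"
  assumes "\<delta> > 0"
  shows "integrable lborel (\<lambda>\<xi>::'a. gauss \<delta> \<xi> * cos (\<xi> \<bullet> z))"
    "(LINT \<xi>|lborel. gauss \<delta> \<xi> * cos (\<xi> \<bullet> z)) = (sqrt (2 * pi) / \<delta>) ^ DIM('a) * gauss (1 / \<delta>) z"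
proof -
  let ?f = "\<lambda>b t. complex_of_real (exp (- (\<delta>\<^sup>2 * t\<^sup>2 / 2))) * iexp (t * (z \<bullet> b))"
  have nrm: "(norm \<xi>)\<^sup>2 = (\<Sum>b\<in>Basis. (\<xi> \<bullet> b)\<^sup>2)" for \<xi> :: 'a
    unfolding power2_norm_eq_inner by (simp add: euclidean_inner[of \<xi> \<xi>] power2_eq_square)
  have "(\<Prod>b\<in>Basis. ?f b (\<xi> \<bullet> b)) = complex_of_real (gauss \<delta> \<xi>) * iexp (\<xi> \<bullet> z)" for \<xi>
  proof -
    have "(\<Prod>b\<in>Basis. ?f b (\<xi> \<bullet> b)) = (\<Prod>b\<in>Basis. exp (complex_of_real (- (\<delta>\<^sup>2 * (\<xi> \<bullet> b)\<^sup>2 / 2)) + \<i> * complex_of_real ((\<xi> \<bullet> b) * (z \<bullet> b))))"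
      by (intro prod.cong refl) (simp only: exp_add exp_of_real)
    also have "\<dots> = exp (\<Sum>b\<in>Basis. complex_of_real (- (\<delta>\<^sup>2 * (\<xi> \<bullet> b)\<^sup>2 / 2)) + \<i> * complex_of_real ((\<xi> \<bullet> b) * (z \<bullet> b)))"
      by (simp add: exp_sum)
    also have "(\<Sum>b\<in>Basis. complex_of_real (- (\<delta>\<^sup>2 * (\<xi> \<bullet> b)\<^sup>2 / 2)) + \<i> * complex_of_real ((\<xi> \<bullet> b) * (z \<bullet> b)))
       = complex_of_real (- (\<delta>\<^sup>2 * (norm \<xi>)\<^sup>2 / 2)) + \<i> * complex_of_real (\<xi> \<bullet> z)"
      unfolding nrm euclidean_inner[of \<xi> z]
      by (simp add: sum.distrib sum_subtractf sum_distrib_left sum_negf sum_divide_distrib)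
    finally show ?thesis unfolding gauss_def exp_add exp_of_real .
  qed
  note p = integral_lborel_prod_Basis[of ?f, OF gauss_fourier_real(1)[OF assms], unfolded this gauss_fourier_real(2)[OF assms]]
  have re: "Re (complex_of_real (gauss \<delta> \<xi>) * iexp (\<xi> \<bullet> z)) = gauss \<delta> \<xi> * cos (\<xi> \<bullet> z)" for \<xi> :: 'a
    by (simp add: Re_exp)
  show "integrable lborel (\<lambda>\<xi>::'a. gauss \<delta> \<xi> * cos (\<xi> \<bullet> z))"
    using integrable_Re[OF p(1)] unfolding re .
  have "(LINT \<xi>|lborel. gauss \<delta> \<xi> * cos (\<xi> \<bullet> z)) = Re (\<Prod>b\<in>(Basis::'a set). complex_of_real (sqrt (2 * pi) / \<delta> * exp (- ((z \<bullet> b)\<^sup>2 / (2 * \<delta>\<^sup>2)))))"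
    unfolding p(2)[symmetric] integral_Re[OF p(1), symmetric] re ..
  also have "\<dots> = (\<Prod>b\<in>(Basis::'a set). sqrt (2 * pi) / \<delta> * exp (- ((z \<bullet> b)\<^sup>2 / (2 * \<delta>\<^sup>2))))"
    unfolding of_real_prod[symmetric] by (rule Re_complex_of_real)
  also have "\<dots> = (sqrt (2 * pi) / \<delta>) ^ DIM('a) * exp (- (\<Sum>b\<in>(Basis::'a set). (z \<bullet> b)\<^sup>2 / (2 * \<delta>\<^sup>2)))"
    unfolding prod.distrib prod_constant sum_negf[symmetric] exp_sum[OF finite_Basis] ..
  also have "(\<Sum>b\<in>(Basis::'a set). (z \<bullet> b)\<^sup>2 / (2 * \<delta>\<^sup>2)) = (1 / \<delta>)\<^sup>2 * (norm z)\<^sup>2 / 2"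
    unfolding nrm sum_distrib_left sum_divide_distrib by (intro sum.cong) (simp_all add: power_divide)
  finally show "(LINT \<xi>|lborel. gauss \<delta> \<xi> * cos (\<xi> \<bullet> z)) = (sqrt (2 * pi) / \<delta>) ^ DIM('a) * gauss (1 / \<delta>) z"
    by (simp add: gauss_def)
qed

lemma gauss_integral:
  assumes "\<delta> > 0"
  shows "integrable lborel (gauss \<delta> :: 'a::euclidean_space \<Rightarrow> real)"
    "(LINT \<xi>|lborel. gauss \<delta> (\<xi>::'a)) = (sqrt (2 * pi) / \<delta>) ^ DIM('a)"
  using gauss_fourier[OF assms, of "0::'a"] by (simp_all add: gauss_def[abs_def])

lemma lborel_translate:
  fixes f :: "'a::euclidean_space \<Rightarrow> real"
  assumes [measurable]: "f \<in> borel_measurable borel"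
  shows "(LINT x|lborel. f (y + x)) = (LINT x|lborel. f x)"
    "integrable lborel (\<lambda>x. f (y + x)) \<longleftrightarrow> integrable lborel f"
proof -
  have "(LINT x|distr lborel borel ((+) y). f x) = (LINT x|lborel. f (y + x))"
    by (intro integral_distr) auto
  moreover have "integrable (distr lborel borel ((+) y)) f \<longleftrightarrow> integrable lborel (\<lambda>x. f (y + x))"
    by (intro integrable_distr_eq) auto
  ultimately show "(LINT x|lborel. f (y + x)) = (LINT x|lborel. f x)"
    "integrable lborel (\<lambda>x. f (y + x)) \<longleftrightarrow> integrable lborel f" by (simp_all add: lborel_distr_plus)
qed

lemma lborel_scale_integral:
  fixes f :: "'a::euclidean_space \<Rightarrow> real"
  assumes [measurable]: "f \<in> borel_measurable borel" and c: "c > 0"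
  shows "(LINT x|lborel. f (c *\<^sub>R x)) * c ^ DIM('a) = (LINT x|lborel. f x)"
proof -
  have m: "(\<lambda>x::'a. 0 + c *\<^sub>R x) \<in> measurable lborel borel" by measurable
  have "(LINT x|lborel. f x) = (LINT x|density (distr lborel borel (\<lambda>x. 0 + c *\<^sub>R x)) (\<lambda>_. ennreal (\<bar>c\<bar> ^ DIM('a))). f x)"
    using lborel_affine[of c "0::'a"] c by simp
  also have "\<dots> = (LINT x|distr lborel borel (\<lambda>x. 0 + c *\<^sub>R x). c ^ DIM('a) * f x)"
    using c by (subst integral_density) auto
  also have "\<dots> = (LINT x|lborel. c ^ DIM('a) * f (0 + c *\<^sub>R x))"
    by (rule integral_distr[OF m]) measurable
  finally show ?thesis by simp
qed

lemma integrable_pair_mult: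
  fixes f g :: "'a::euclidean_space \<Rightarrow> real"
  assumes f: "integrable lborel f" and g: "integrable lborel g"
  shows "integrable (lborel \<Otimes>\<^sub>M lborel) (\<lambda>(x, y). f x * g y)"
proof (rule lborel_pair.Fubini_integrable)
  have [measurable]: "f \<in> borel_measurable borel" "g \<in> borel_measurable borel"
    using borel_measurable_integrable[OF f] borel_measurable_integrable[OF g] by simp_all
  show "(\<lambda>(x, y). f x * g y) \<in> borel_measurable (lborel \<Otimes>\<^sub>M lborel)" by measurable
  show "integrable lborel (\<lambda>x. LINT y|lborel. norm (case (x, y) of (x, y) \<Rightarrow> f x * g y))"
    using f by (simp add: abs_mult)
  show "AE x in lborel. integrable lborel (\<lambda>y. case (x, y) of (x, y) \<Rightarrow> f x * g y)"
    using g by simp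
qed

lemma integrable_mult_bounded:
  fixes f k :: "'a \<Rightarrow> real"
  assumes "integrable M f" "k \<in> borel_measurable M" "\<And>x. \<bar>k x\<bar> \<le> 1"
  shows "integrable M (\<lambda>x. f x * k x)"
proof (rule Bochner_Integration.integrable_bound[OF assms(1)])
  show "(\<lambda>x. f x * k x) \<in> borel_measurable M" using assms by measurable
  have "\<bar>f x\<bar> * \<bar>k x\<bar> \<le> \<bar>f x\<bar> * 1" for x by (intro mult_left_mono assms) auto
  thus "AE x in M. norm (f x * k x) \<le> norm (f x)" by (simp add: abs_mult)
qed

section \<open>Plancherel by autocorrelation and Gaussian summation\<close>

locale plancherel =
  fixes u :: "'a::euclidean_space \<Rightarrow> real"
  assumes u_int: "integrable lborel u" and u_sq: "integrable lborel (\<lambda>x. (u x)\<^sup>2)"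
begin

lemma u_meas[measurable]: "u \<in> borel_measurable borel"
  using borel_measurable_integrable[OF u_int] by simp

definition "tc \<xi> = (LINT x|lborel. u x * cos (\<xi> \<bullet> x))"
definition "ts \<xi> = (LINT x|lborel. u x * sin (\<xi> \<bullet> x))"
text \<open>Its Fourier transform is the power spectrum and its value at 0 is the squared norm, so
  Plancherel becomes Fourier inversion at the single point 0.\<close>

definition "autocorr w = (LINT x|lborel. u x * u (x + w))"

lemma tc_meas[measurable]: "tc \<in> borel_measurable borel" "ts \<in> borel_measurable borel"
  unfolding tc_def ts_def by measurable

lemma autocorr_meas[measurable]: "autocorr \<in> borel_measurable borel"
  unfolding autocorr_def by measurable

lemma trig_int: "integrable lborel (\<lambda>x. u x * cos (\<xi> \<bullet> x))" "integrable lborel (\<lambda>x. u x * sin (\<xi> \<bullet> x))"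
  by (auto intro!: integrable_mult_bounded u_int)

lemma u_translate: "integrable lborel (\<lambda>w. u (x + w))" "integrable lborel (\<lambda>w. (u (x + w))\<^sup>2)"
  "(LINT w|lborel. (u (x + w))\<^sup>2) = (LINT w|lborel. (u w)\<^sup>2)"
  using u_int u_sq lborel_translate[of u x] lborel_translate[of "\<lambda>x. (u x)\<^sup>2" x] by simp_all

lemma pair_int: "integrable (lborel \<Otimes>\<^sub>M lborel) (\<lambda>(x, w). u x * u (x + w))"
proof (rule lborel_pair.Fubini_integrable)
  show "(\<lambda>(x, w). u x * u (x + w)) \<in> borel_measurable (lborel \<Otimes>\<^sub>M lborel)" by measurable
  have "(LINT w|lborel. norm (u x * u (x + w))) = \<bar>u x\<bar> * (LINT w|lborel. \<bar>u w\<bar>)" for x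
    using lborel_translate(1)[of "\<lambda>x. \<bar>u x\<bar>" x] by (simp add: abs_mult)
  thus "integrable lborel (\<lambda>x. LINT w|lborel. norm (case (x, w) of (x, w) \<Rightarrow> u x * u (x + w)))"
    using u_int by simp
  show "AE x in lborel. integrable lborel (\<lambda>w. case (x, w) of (x, w) \<Rightarrow> u x * u (x + w))"
    using u_translate by simp
qed

lemma autocorr_int: "integrable lborel autocorr"
  using lborel_pair.integrable_snd[OF pair_int] unfolding autocorr_def[abs_def] by simp

lemma autocorr_bound: "\<bar>autocorr w\<bar> \<le> (LINT x|lborel. (u x)\<^sup>2)"
proof -
  have i: "integrable lborel (\<lambda>x. ((u x)\<^sup>2 + (u (w + x))\<^sup>2) / 2)"
    using u_sq u_translate(2)[of w] by simp
  have le: "\<bar>u x * u (x + w)\<bar> \<le> ((u x)\<^sup>2 + (u (w + x))\<^sup>2) / 2" for x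
  proof -
    have "0 \<le> (u x + u (w + x))\<^sup>2" "0 \<le> (u x - u (w + x))\<^sup>2" by simp_all
    thus ?thesis by (simp add: power2_sum power2_diff abs_le_iff add.commute[of x w] field_simps)
  qed
  have "\<bar>autocorr w\<bar> \<le> (LINT x|lborel. ((u x)\<^sup>2 + (u (w + x))\<^sup>2) / 2)"
    unfolding autocorr_def real_norm_def[symmetric]
    by (rule Bochner_Integration.integral_norm_bound_integral[OF _ i])
       (use le in \<open>auto intro!: Bochner_Integration.integrable_bound[OF i]\<close>)
  also have "\<dots> = (LINT x|lborel. (u x)\<^sup>2)"
    using u_sq u_translate(2,3)[of w] by simp
  finally show ?thesis .
qed

text \<open>The substitution y = x + w and the expansion of cos (\<xi> \<bullet> y - \<xi> \<bullet>
  x) split the inner integral into the cosine and sine transforms; Fubini exchanges the two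
  integrations.\<close>

lemma transform_autocorr: "(tc \<xi>)\<^sup>2 + (ts \<xi>)\<^sup>2 = (LINT w|lborel. autocorr w * cos (\<xi> \<bullet> w))"
proof -
  have i: "integrable (lborel \<Otimes>\<^sub>M lborel) (\<lambda>(x, w). u x * u (x + w) * cos (\<xi> \<bullet> w))"
    using integrable_mult_bounded[OF pair_int, of "\<lambda>(x, w). cos (\<xi> \<bullet> w)"] by (simp add: split_beta')
  have "(LINT w|lborel. u (x + w) * cos (\<xi> \<bullet> w)) = cos (\<xi> \<bullet> x) * tc \<xi> + sin (\<xi> \<bullet> x) * ts \<xi>" for x
  proof -
    have "(LINT w|lborel. u (x + w) * cos (\<xi> \<bullet> w)) = (LINT w|lborel. u (x + w) * cos (\<xi> \<bullet> (x + w) - \<xi> \<bullet> x))"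
      by (simp add: inner_add_right)
    also have "\<dots> = (LINT y|lborel. u y * cos (\<xi> \<bullet> y - \<xi> \<bullet> x))"
      using lborel_translate(1)[of "\<lambda>y. u y * cos (\<xi> \<bullet> y - \<xi> \<bullet> x)" x] by simp
    also have "\<dots> = (LINT y|lborel. cos (\<xi> \<bullet> x) * (u y * cos (\<xi> \<bullet> y)) + sin (\<xi> \<bullet> x) * (u y * sin (\<xi> \<bullet> y)))"
      by (simp add: cos_diff algebra_simps)
    also have "\<dots> = cos (\<xi> \<bullet> x) * tc \<xi> + sin (\<xi> \<bullet> x) * ts \<xi>"
      using trig_int[of \<xi>] by (simp add: tc_def ts_def)
    finally show ?thesis .
  qed
  note inner = this
  have "(tc \<xi>)\<^sup>2 + (ts \<xi>)\<^sup>2 = (LINT x|lborel. (u x * cos (\<xi> \<bullet> x)) * tc \<xi> + (u x * sin (\<xi> \<bullet> x)) * ts \<xi>)"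
    using trig_int[of \<xi>] by (simp add: power2_eq_square tc_def[symmetric] ts_def[symmetric])
  also have "\<dots> = (LINT x|lborel. LINT w|lborel. u x * u (x + w) * cos (\<xi> \<bullet> w))"
    by (simp add: mult.assoc inner distrib_left)
  also have "\<dots> = (LINT w|lborel. LINT x|lborel. u x * u (x + w) * cos (\<xi> \<bullet> w))"
    using lborel_pair.Fubini_integral[OF i] by simp
  also have "\<dots> = (LINT w|lborel. autocorr w * cos (\<xi> \<bullet> w))"
    by (simp add: autocorr_def)
  finally show ?thesis .
qed

text \<open>The Gaussian factor makes the double integral over \<xi> and w absolutely convergent, so
  Fubini applies. As \<delta> tends to 0, \<open>gauss (1 / \<delta>)\<close> concentrates at w = 0,
  where the autocorrelation is the squared norm.\<close>

lemma gauss_transform: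
  assumes "\<delta> > 0"
  shows "integrable lborel (\<lambda>\<xi>. gauss \<delta> \<xi> * ((tc \<xi>)\<^sup>2 + (ts \<xi>)\<^sup>2))"
    "(LINT \<xi>|lborel. gauss \<delta> \<xi> * ((tc \<xi>)\<^sup>2 + (ts \<xi>)\<^sup>2)) = (sqrt (2 * pi) / \<delta>) ^ DIM('a) * (LINT w|lborel. autocorr w * gauss (1 / \<delta>) w)"
proof -
  have i: "integrable (lborel \<Otimes>\<^sub>M lborel) (\<lambda>(\<xi>, w). gauss \<delta> \<xi> * autocorr w * cos (\<xi> \<bullet> w))"
    using integrable_mult_bounded[OF integrable_pair_mult[OF gauss_integral(1)[OF assms] autocorr_int], of "\<lambda>(x, w). cos (x \<bullet> w)"]
    by (simp add: split_beta')
  have eq: "gauss \<delta> \<xi> * ((tc \<xi>)\<^sup>2 + (ts \<xi>)\<^sup>2) = (LINT w|lborel. gauss \<delta> \<xi> * autocorr w * cos (\<xi> \<bullet> w))" for \<xi>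
    by (simp add: transform_autocorr mult.assoc)
  show "integrable lborel (\<lambda>\<xi>. gauss \<delta> \<xi> * ((tc \<xi>)\<^sup>2 + (ts \<xi>)\<^sup>2))"
    unfolding eq using lborel_pair.integrable_fst'[OF i] by simp
  have "(LINT \<xi>|lborel. gauss \<delta> \<xi> * ((tc \<xi>)\<^sup>2 + (ts \<xi>)\<^sup>2)) = (LINT w|lborel. LINT \<xi>|lborel. autocorr w * (gauss \<delta> \<xi> * cos (\<xi> \<bullet> w)))"
    unfolding eq using lborel_pair.Fubini_integral[OF i] by (simp add: mult_ac)
  also have "\<dots> = (LINT w|lborel. (sqrt (2 * pi) / \<delta>) ^ DIM('a) * (autocorr w * gauss (1 / \<delta>) w))"
    by (intro Bochner_Integration.integral_cong refl)
       (subst integral_mult_right_zero, subst gauss_fourier(2)[OF assms], simp only: mult_ac)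
  also have "\<dots> = (sqrt (2 * pi) / \<delta>) ^ DIM('a) * (LINT w|lborel. autocorr w * gauss (1 / \<delta>) w)"
    by (rule integral_mult_right_zero)
  finally show "(LINT \<xi>|lborel. gauss \<delta> \<xi> * ((tc \<xi>)\<^sup>2 + (ts \<xi>)\<^sup>2)) = (sqrt (2 * pi) / \<delta>) ^ DIM('a) * (LINT w|lborel. autocorr w * gauss (1 / \<delta>) w)" .
qed

lemma gauss_autocorr_int: "\<delta> > 0 \<Longrightarrow> integrable lborel (\<lambda>w. autocorr w * gauss \<delta> w)"
  by (rule integrable_mult_bounded[OF autocorr_int]) (auto simp: gauss_def)

lemma two_pi_power: "\<delta> > 0 \<Longrightarrow> (sqrt (2 * pi) / \<delta>) ^ DIM('a) * (sqrt (2 * pi) / (1 / \<delta>)) ^ DIM('a) = (2 * pi) ^ DIM('a)"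
  unfolding power_mult_distrib[symmetric] by simp

text \<open>The autocorrelation never exceeds the squared norm, and the total masses of the two
  Gaussians multiply to (2 \<pi>)^n for every \<delta>.\<close>

lemma gauss_transform_le:
  assumes "\<delta> > 0"
  shows "(LINT \<xi>|lborel. gauss \<delta> \<xi> * ((tc \<xi>)\<^sup>2 + (ts \<xi>)\<^sup>2)) \<le> (2 * pi) ^ DIM('a) * (LINT x|lborel. (u x)\<^sup>2)"
proof -
  have "(LINT w|lborel. autocorr w * gauss (1 / \<delta>) w) \<le> (LINT w|lborel. (LINT x|lborel. (u x)\<^sup>2) * gauss (1 / \<delta>) (w::'a))"
  proof (rule integral_mono)
    show "integrable lborel (\<lambda>w. autocorr w * gauss (1 / \<delta>) w)" using assms by (intro gauss_autocorr_int) simp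
    show "integrable lborel (\<lambda>w. (LINT x|lborel. (u x)\<^sup>2) * gauss (1 / \<delta>) (w::'a))"
      using gauss_integral(1)[of "1/\<delta>", where 'a='a] assms by simp
    show "autocorr w * gauss (1 / \<delta>) w \<le> (LINT x|lborel. (u x)\<^sup>2) * gauss (1 / \<delta>) w" for w
      using autocorr_bound[of w] by (intro mult_right_mono) (auto simp: gauss_def)
  qed
  also have "\<dots> = (LINT x|lborel. (u x)\<^sup>2) * (sqrt (2 * pi) / (1 / \<delta>)) ^ DIM('a)"
    using gauss_integral(2)[of "1/\<delta>", where 'a='a] assms by simp
  finally have "(sqrt (2 * pi) / \<delta>) ^ DIM('a) * (LINT w|lborel. autocorr w * gauss (1 / \<delta>) w)
    \<le> (sqrt (2 * pi) / \<delta>) ^ DIM('a) * ((LINT x|lborel. (u x)\<^sup>2) * (sqrt (2 * pi) / (1 / \<delta>)) ^ DIM('a))"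
    using assms by (intro mult_left_mono) auto
  also have "\<dots> = (2 * pi) ^ DIM('a) * (LINT x|lborel. (u x)\<^sup>2)"
    unfolding two_pi_power[OF assms, symmetric] by (simp only: mult_ac)
  finally show ?thesis using gauss_transform(2)[OF assms] by simp
qed

lemma nn_gauss_transform:
  assumes "\<delta> > 0"
  shows "(\<integral>\<^sup>+\<xi>. ennreal (gauss \<delta> \<xi> * ((tc \<xi>)\<^sup>2 + (ts \<xi>)\<^sup>2)) \<partial>lborel) = ennreal (LINT \<xi>|lborel. gauss \<delta> \<xi> * ((tc \<xi>)\<^sup>2 + (ts \<xi>)\<^sup>2))"
  by (intro nn_integral_eq_integral gauss_transform assms) (auto simp: gauss_def)

lemma gauss_tendsto_1: "(\<lambda>m. gauss (1 / real (Suc m)) (\<xi>::'a)) \<longlonglongrightarrow> 1"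
proof -
  have "(\<lambda>m. exp (- ((inverse (real (Suc m)))\<^sup>2 * (norm \<xi>)\<^sup>2 / 2))) \<longlonglongrightarrow> exp (- (0\<^sup>2 * (norm \<xi>)\<^sup>2 / 2))"
    by (intro tendsto_intros LIMSEQ_inverse_real_of_nat) simp
  thus ?thesis by (simp add: gauss_def inverse_eq_divide)
qed

text \<open>Fatou's lemma, as the Gaussian weight tends to 1, for every u that is integrable and
  square-integrable.\<close>

theorem plancherel_le:
  "(\<integral>\<^sup>+\<xi>. ennreal ((tc \<xi>)\<^sup>2 + (ts \<xi>)\<^sup>2) \<partial>lborel) \<le> ennreal ((2 * pi) ^ DIM('a) * (LINT x|lborel. (u x)\<^sup>2))"
proof -
  let ?g = "\<lambda>m \<xi>. ennreal (gauss (1 / real (Suc m)) \<xi> * ((tc \<xi>)\<^sup>2 + (ts \<xi>)\<^sup>2))"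
  have lim: "liminf (\<lambda>m. ?g m \<xi>) = ennreal ((tc \<xi>)\<^sup>2 + (ts \<xi>)\<^sup>2)" for \<xi>
  proof (rule lim_imp_Liminf)
    show "(\<lambda>m. ?g m \<xi>) \<longlonglongrightarrow> ennreal ((tc \<xi>)\<^sup>2 + (ts \<xi>)\<^sup>2)"
      using tendsto_mult[OF gauss_tendsto_1[of \<xi>] tendsto_const[of "(tc \<xi>)\<^sup>2 + (ts \<xi>)\<^sup>2"]]
      by (intro tendsto_ennrealI) simp
  qed simp
  have "(\<integral>\<^sup>+\<xi>. ennreal ((tc \<xi>)\<^sup>2 + (ts \<xi>)\<^sup>2) \<partial>lborel) = (\<integral>\<^sup>+\<xi>. liminf (\<lambda>m. ?g m \<xi>) \<partial>lborel)"
    by (simp only: lim)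
  also have "\<dots> \<le> liminf (\<lambda>m. \<integral>\<^sup>+\<xi>. ?g m \<xi> \<partial>lborel)"
    by (intro nn_integral_liminf) (auto simp: gauss_def)
  also have "\<dots> \<le> liminf (\<lambda>m. ennreal ((2 * pi) ^ DIM('a) * (LINT x|lborel. (u x)\<^sup>2)))"
    using nn_gauss_transform gauss_transform_le by (intro Liminf_mono always_eventually allI) (simp add: ennreal_leI)
  also have "\<dots> = ennreal ((2 * pi) ^ DIM('a) * (LINT x|lborel. (u x)\<^sup>2))"
    by (simp add: Liminf_const)
  finally show ?thesis .
qed

text \<open>Equality in the limit rests on continuity of the autocorrelation at 0, which for bounded
  continuous u is dominated convergence with majorant C |u|. Test functions are of this kind; other
  functions are reached later by approximation.\<close>

theorem plancherel_ge:
  assumes "continuous_on UNIV u" "\<And>x. \<bar>u x\<bar> \<le> C"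
  shows "ennreal ((2 * pi) ^ DIM('a) * (LINT x|lborel. (u x)\<^sup>2)) \<le> (\<integral>\<^sup>+\<xi>. ennreal ((tc \<xi>)\<^sup>2 + (ts \<xi>)\<^sup>2) \<partial>lborel)"
proof -
  let ?d = "\<lambda>m. 1 / real (Suc m)"
  let ?N = "LINT x|lborel. (u x)\<^sup>2"
  have d0: "?d \<longlonglongrightarrow> 0" using LIMSEQ_inverse_real_of_nat by (simp add: inverse_eq_divide)
  have A0: "(\<lambda>m. autocorr (?d m *\<^sub>R z)) \<longlonglongrightarrow> ?N" for z
    unfolding autocorr_def
  proof (rule integral_dominated_convergence[where w="\<lambda>x. C * \<bar>u x\<bar>"])
    show "integrable lborel (\<lambda>x. C * \<bar>u x\<bar>)" using u_int by simp
    show "AE x in lborel. (\<lambda>m. u x * u (x + ?d m *\<^sub>R z)) \<longlonglongrightarrow> (u x)\<^sup>2"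
    proof (intro AE_I2)
      fix x
      have "(\<lambda>m. x + ?d m *\<^sub>R z) \<longlonglongrightarrow> x + 0 *\<^sub>R z" by (intro tendsto_intros d0)
      moreover have "isCont u x" using assms(1) by (simp add: continuous_on_eq_continuous_at)
      ultimately have "(\<lambda>m. u (x + ?d m *\<^sub>R z)) \<longlonglongrightarrow> u x" using isCont_tendsto_compose by fastforce
      from tendsto_mult[OF tendsto_const[of "u x"] this]
      show "(\<lambda>m. u x * u (x + ?d m *\<^sub>R z)) \<longlonglongrightarrow> (u x)\<^sup>2" by (simp add: power2_eq_square)
    qed
    show "AE x in lborel. norm (u x * u (x + ?d m *\<^sub>R z)) \<le> C * \<bar>u x\<bar>" for m
    proof (intro AE_I2)
      fix x
      have "\<bar>u x\<bar> * \<bar>u (x + ?d m *\<^sub>R z)\<bar> \<le> \<bar>u x\<bar> * C" by (intro mult_left_mono assms) simp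
      thus "norm (u x * u (x + ?d m *\<^sub>R z)) \<le> C * \<bar>u x\<bar>" by (simp add: abs_mult mult.commute)
    qed
  qed measurable
  have "(\<lambda>m. LINT z|lborel. autocorr (?d m *\<^sub>R z) * gauss 1 z) \<longlonglongrightarrow> (LINT z|lborel. ?N * gauss 1 (z::'a))"
  proof (rule integral_dominated_convergence[where w="\<lambda>z. ?N * gauss 1 z"])
    show "integrable lborel (\<lambda>z::'a. ?N * gauss 1 z)" using gauss_integral(1)[of 1, where 'a='a] by simp
    show "AE z in lborel. (\<lambda>m. autocorr (?d m *\<^sub>R z) * gauss 1 z) \<longlonglongrightarrow> ?N * gauss 1 z"
      by (intro AE_I2 tendsto_mult A0 tendsto_const)
    show "AE z in lborel. norm (autocorr (?d m *\<^sub>R z) * gauss 1 z) \<le> ?N * gauss 1 z" for m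
      using autocorr_bound by (auto simp: abs_mult gauss_def)
    show "(\<lambda>z::'a. ?N * gauss 1 z) \<in> borel_measurable lborel" unfolding gauss_def by measurable
    show "(\<lambda>z::'a. autocorr (?d m *\<^sub>R z) * gauss 1 z) \<in> borel_measurable lborel" for m unfolding gauss_def by measurable
  qed
  hence lim1: "(\<lambda>m. LINT z|lborel. autocorr (?d m *\<^sub>R z) * gauss 1 z) \<longlonglongrightarrow> ?N * sqrt (2 * pi) ^ DIM('a)"
    using gauss_integral(2)[of 1, where 'a='a] by simp
  \<comment> \<open>The substitution w = \<delta> z with \<delta> = \<open>?d m\<close> moves
    \<delta> from the Gaussian into the argument of \<open>autocorr\<close>. The limit can then be
    taken against the fixed weight \<open>gauss 1\<close>.\<close>
  have "(LINT \<xi>|lborel. gauss (?d m) \<xi> * ((tc \<xi>)\<^sup>2 + (ts \<xi>)\<^sup>2)) = sqrt (2 * pi) ^ DIM('a) * (LINT z|lborel. autocorr (?d m *\<^sub>R z) * gauss 1 z)" for m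
  proof -
    have dm: "?d m > 0" by simp
    have [measurable]: "(gauss d :: 'a \<Rightarrow> real) \<in> borel_measurable borel" for d unfolding gauss_def by measurable
    have "(LINT w|lborel. autocorr w * gauss (1 / ?d m) w) = (LINT z|lborel. autocorr (?d m *\<^sub>R z) * gauss (1 / ?d m) (?d m *\<^sub>R z)) * ?d m ^ DIM('a)"
      by (rule lborel_scale_integral[symmetric, OF _ dm]) measurable
    also have "(\<lambda>z::'a. gauss (1 / ?d m) (?d m *\<^sub>R z)) = gauss 1"
      by (simp add: gauss_def power_mult_distrib power_divide fun_eq_iff)
    hence "(LINT z|lborel. autocorr (?d m *\<^sub>R z) * gauss (1 / ?d m) (?d m *\<^sub>R z)) = (LINT z|lborel. autocorr (?d m *\<^sub>R z) * gauss 1 z)"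
      by metis
    finally have "(LINT w|lborel. autocorr w * gauss (1 / ?d m) w) = (LINT z|lborel. autocorr (?d m *\<^sub>R z) * gauss 1 z) * ?d m ^ DIM('a)" .
    moreover have "(sqrt (2 * pi) / ?d m) ^ DIM('a) * (J * ?d m ^ DIM('a)) = sqrt (2 * pi) ^ DIM('a) * J" for J
      using dm by (simp add: power_divide power_mult_distrib)
    ultimately show ?thesis using gauss_transform(2)[OF dm] by simp
  qed
  hence "(\<lambda>m. LINT \<xi>|lborel. gauss (?d m) \<xi> * ((tc \<xi>)\<^sup>2 + (ts \<xi>)\<^sup>2)) \<longlonglongrightarrow> sqrt (2 * pi) ^ DIM('a) * (?N * sqrt (2 * pi) ^ DIM('a))"
    using tendsto_mult[OF tendsto_const[of "sqrt (2 * pi) ^ DIM('a)"] lim1] by simp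
  moreover have "sqrt (2 * pi) ^ DIM('a) * (?N * sqrt (2 * pi) ^ DIM('a)) = (2 * pi) ^ DIM('a) * ?N"
  proof -
    have "sqrt (2 * pi) ^ DIM('a) * sqrt (2 * pi) ^ DIM('a) = (2 * pi) ^ DIM('a)"
      unfolding power_mult_distrib[symmetric] by simp
    moreover have "sqrt (2 * pi) ^ DIM('a) * (?N * sqrt (2 * pi) ^ DIM('a)) = (sqrt (2 * pi) ^ DIM('a) * sqrt (2 * pi) ^ DIM('a)) * ?N"
      by (simp only: mult_ac)
    ultimately show ?thesis by simp
  qed
  ultimately have lim: "(\<lambda>m. ennreal (LINT \<xi>|lborel. gauss (?d m) \<xi> * ((tc \<xi>)\<^sup>2 + (ts \<xi>)\<^sup>2))) \<longlonglongrightarrow> ennreal ((2 * pi) ^ DIM('a) * ?N)"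
    by (intro tendsto_ennrealI) simp
  have le: "ennreal (LINT \<xi>|lborel. gauss (?d m) \<xi> * ((tc \<xi>)\<^sup>2 + (ts \<xi>)\<^sup>2)) \<le> (\<integral>\<^sup>+\<xi>. ennreal ((tc \<xi>)\<^sup>2 + (ts \<xi>)\<^sup>2) \<partial>lborel)" for m
  proof -
    have dm: "?d m > 0" by simp
    have "gauss (?d m) \<xi> * ((tc \<xi>)\<^sup>2 + (ts \<xi>)\<^sup>2) \<le> (tc \<xi>)\<^sup>2 + (ts \<xi>)\<^sup>2" for \<xi>
      using mult_right_mono[of "gauss (?d m) \<xi>" 1 "(tc \<xi>)\<^sup>2 + (ts \<xi>)\<^sup>2"] by (simp add: gauss_def)
    thus ?thesis unfolding nn_gauss_transform[OF dm, symmetric]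
      by (intro nn_integral_mono ennreal_leI)
  qed
  show ?thesis by (rule LIMSEQ_le_const2[OF lim]) (intro exI[of _ 0] allI impI le)
qed

end

section \<open>Polar coordinates\<close>

lemma nn_integral_lborel_scale:
  fixes f :: "'a::euclidean_space \<Rightarrow> ennreal"
  assumes [measurable]: "f \<in> borel_measurable borel" and c: "c > 0"
  shows "(\<integral>\<^sup>+x. f x \<partial>lborel) = ennreal (c ^ DIM('a)) * (\<integral>\<^sup>+x. f (c *\<^sub>R x) \<partial>lborel)"
proof -
  have m: "(\<lambda>x::'a. 0 + c *\<^sub>R x) \<in> measurable lborel borel" by measurable
  have "(\<integral>\<^sup>+x. f x \<partial>lborel) = (\<integral>\<^sup>+x. f x \<partial>density (distr lborel borel (\<lambda>x. 0 + c *\<^sub>R x)) (\<lambda>_. ennreal (\<bar>c\<bar> ^ DIM('a))))"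
    using lborel_affine[of c "0::'a"] c by simp
  also have "\<dots> = (\<integral>\<^sup>+x. ennreal (c ^ DIM('a)) * f x \<partial>distr lborel borel (\<lambda>x. 0 + c *\<^sub>R x))"
    using c by (subst nn_integral_density) auto
  also have "\<dots> = (\<integral>\<^sup>+x. ennreal (c ^ DIM('a)) * f (0 + c *\<^sub>R x) \<partial>lborel)"
    by (rule nn_integral_distr[OF m]) measurable
  also have "\<dots> = ennreal (c ^ DIM('a)) * (\<integral>\<^sup>+x. f (c *\<^sub>R x) \<partial>lborel)"
    by (subst nn_integral_cmult) auto
  finally show ?thesis .
qed

lemma nn_integral_lborel_translate:
  fixes f :: "'a::euclidean_space \<Rightarrow> ennreal"
  assumes [measurable]: "f \<in> borel_measurable borel"
  shows "(\<integral>\<^sup>+x. f (x - c) \<partial>lborel) = (\<integral>\<^sup>+x. f x \<partial>lborel)"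
proof -
  have "(\<integral>\<^sup>+x. f x \<partial>distr lborel borel ((+) (- c))) = (\<integral>\<^sup>+x. f (- c + x) \<partial>lborel)"
    by (rule nn_integral_distr) auto
  thus ?thesis by (simp add: lborel_distr_plus)
qed

lemma nn_integral_inverse_dyadic:
  assumes "t > 0"
  shows "(\<integral>\<^sup>+r. ennreal (inverse r) * indicator {t / 2..t} r \<partial>lborel) = ennreal (ln 2)"
proof -
  have "(\<integral>\<^sup>+r. ennreal (inverse r) * indicator {t / 2..t} r \<partial>lborel) = ennreal (ln t - ln (t / 2))"
    using assms by (intro nn_integral_FTC_Icc) (auto intro!: DERIV_ln)
  thus ?thesis using assms by (simp add: ln_div)
qed

text \<open>A substitute for the unit sphere: Lebesgue measure on the shell replaces surface
  measure. A point y \<noteq> 0 equals r x with x in the shell exactly for r in [|y| / 2, |y|], an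
  interval of measure ln 2 for dr / r.\<close>

definition dyadic_shell :: "'a::euclidean_space set" where
  "dyadic_shell = {x. 1 \<le> norm x \<and> norm x \<le> 2}"

lemma dyadic_shell_borel[measurable]: "dyadic_shell \<in> sets borel"
  unfolding dyadic_shell_def by measurable

definition radial_integral :: "('a::euclidean_space \<Rightarrow> ennreal) \<Rightarrow> 'a \<Rightarrow> ennreal" where
  "radial_integral G x = (\<integral>\<^sup>+r. ennreal (r ^ (DIM('a) - 1)) * indicator {0<..} r * G (r *\<^sub>R x) \<partial>lborel)"

lemma radial_integral_meas[measurable]:
  assumes [measurable]: "G \<in> borel_measurable borel"
  shows "radial_integral G \<in> borel_measurable borel"
  unfolding radial_integral_def by measurable

lemma radial_integral_scale:
  fixes G :: "'a::euclidean_space \<Rightarrow> ennreal"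
  assumes [measurable]: "G \<in> borel_measurable borel" and c: "c > 0"
  shows "radial_integral G x = ennreal (c ^ DIM('a)) * radial_integral G (c *\<^sub>R x)"
proof -
  have "radial_integral G x = ennreal (c ^ DIM(real)) *
     (\<integral>\<^sup>+r. ennreal ((c *\<^sub>R r) ^ (DIM('a) - 1)) * indicator {0<..} (c *\<^sub>R r) * G ((c *\<^sub>R r) *\<^sub>R x) \<partial>lborel)"
    unfolding radial_integral_def by (rule nn_integral_lborel_scale[OF _ c]) measurable
  also have "\<dots> = ennreal c * (\<integral>\<^sup>+r. ennreal (c ^ (DIM('a) - 1)) * (ennreal (r ^ (DIM('a) - 1)) * indicator {0<..} r * G (r *\<^sub>R c *\<^sub>R x)) \<partial>lborel)"
  proof -
    have "ennreal ((c *\<^sub>R r) ^ (DIM('a) - 1)) * indicator {0<..} (c *\<^sub>R r) * G ((c *\<^sub>R r) *\<^sub>R x)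
      = ennreal (c ^ (DIM('a) - 1)) * (ennreal (r ^ (DIM('a) - 1)) * indicator {0<..} r * G (r *\<^sub>R c *\<^sub>R x))" for r
      using c by (auto simp: indicator_def zero_less_mult_iff power_mult_distrib ennreal_mult mult_ac)
    thus ?thesis by simp
  qed
  also have "\<dots> = ennreal c * ennreal (c ^ (DIM('a) - 1)) * radial_integral G (c *\<^sub>R x)"
    unfolding radial_integral_def by (subst nn_integral_cmult) (auto simp: mult.assoc)
  also have "ennreal c * ennreal (c ^ (DIM('a) - 1)) = ennreal (c ^ DIM('a))"
    using c by (subst ennreal_mult[symmetric]) (auto simp flip: power_Suc)
  finally show ?thesis .
qed

text \<open>Fubini and the substitution y = r x, with dx = r^(-n) dy, turn the weight r^(n-1) into 1
  / r. For fixed y \<noteq> 0 the admissible r then contribute the factor ln 2.\<close>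

lemma polar_shell:
  fixes G :: "'a::euclidean_space \<Rightarrow> ennreal"
  assumes [measurable]: "G \<in> borel_measurable borel"
  shows "ennreal (ln 2) * (\<integral>\<^sup>+x. G x \<partial>lborel) = (\<integral>\<^sup>+x. indicator dyadic_shell x * radial_integral G x \<partial>lborel)"
proof -
  let ?n = "DIM('a)"
  have "(\<integral>\<^sup>+x. indicator dyadic_shell x * radial_integral G x \<partial>lborel)
     = (\<integral>\<^sup>+x. \<integral>\<^sup>+r. indicator dyadic_shell x * (ennreal (r ^ (?n - 1)) * indicator {0<..} r * G (r *\<^sub>R x)) \<partial>lborel \<partial>lborel)"
    unfolding radial_integral_def by (subst nn_integral_cmult) auto
  also have "\<dots> = (\<integral>\<^sup>+r. \<integral>\<^sup>+x. indicator dyadic_shell x * (ennreal (r ^ (?n - 1)) * indicator {0<..} r * G (r *\<^sub>R x)) \<partial>lborel \<partial>lborel)"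
    by (rule lborel_pair.Fubini') measurable
  also have "\<dots> = (\<integral>\<^sup>+r. \<integral>\<^sup>+y. indicator {0<..} r * ennreal (inverse r) * indicator dyadic_shell (inverse r *\<^sub>R y) * G y \<partial>lborel \<partial>lborel)"
  proof (rule nn_integral_cong)
    fix r :: real
    show "(\<integral>\<^sup>+x. indicator dyadic_shell x * (ennreal (r ^ (?n - 1)) * indicator {0<..} r * G (r *\<^sub>R x)) \<partial>lborel)
      = (\<integral>\<^sup>+y. indicator {0<..} r * ennreal (inverse r) * indicator dyadic_shell (inverse r *\<^sub>R y) * G y \<partial>lborel)"
    proof (cases "r > 0")
      case False
      then show ?thesis by simp
    next
      case True
      have "(\<integral>\<^sup>+y. indicator {0<..} r * ennreal (inverse r) * indicator dyadic_shell (inverse r *\<^sub>R y) * G y \<partial>lborel)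
        = ennreal (r ^ ?n) * (\<integral>\<^sup>+x. indicator {0<..} r * ennreal (inverse r) * indicator dyadic_shell (inverse r *\<^sub>R r *\<^sub>R x) * G (r *\<^sub>R x) \<partial>lborel)"
        by (rule nn_integral_lborel_scale[OF _ True]) measurable
      also have "\<dots> = (\<integral>\<^sup>+x. ennreal (r ^ ?n) * (ennreal (inverse r) * (indicator dyadic_shell x * G (r *\<^sub>R x))) \<partial>lborel)"
        using True by (subst nn_integral_cmult) (auto simp: mult.assoc)
      also have "\<dots> = (\<integral>\<^sup>+x. indicator dyadic_shell x * (ennreal (r ^ (?n - 1)) * indicator {0<..} r * G (r *\<^sub>R x)) \<partial>lborel)"
      proof -
        have "r ^ ?n * inverse r = r ^ (?n - 1)"
          using True DIM_positive[where 'a='a] by (simp add: power_diff field_simps)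
        hence "ennreal (r ^ ?n) * ennreal (inverse r) = ennreal (r ^ (?n - 1))"
          using True by (subst ennreal_mult[symmetric]) auto
        thus ?thesis using True by (intro nn_integral_cong) (simp add: mult.assoc[symmetric], simp only: mult.commute)
      qed
      finally show ?thesis ..
    qed
  qed
  also have "\<dots> = (\<integral>\<^sup>+y. \<integral>\<^sup>+r. indicator {0<..} r * ennreal (inverse r) * indicator dyadic_shell (inverse r *\<^sub>R y) * G y \<partial>lborel \<partial>lborel)"
    by (rule lborel_pair.Fubini') measurable
  also have "\<dots> = (\<integral>\<^sup>+y. ennreal (ln 2) * G y \<partial>lborel)"
  proof (rule nn_integral_cong_AE)
    have inner: "(\<integral>\<^sup>+r. indicator {0<..} r * ennreal (inverse r) * indicator dyadic_shell (inverse r *\<^sub>R y) * G y \<partial>lborel) = ennreal (ln 2) * G y"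
      if "y \<noteq> 0" for y :: 'a
    proof -
      have "indicator {0<..} r * ennreal (inverse r) * indicator dyadic_shell (inverse r *\<^sub>R y)
          = ennreal (inverse r) * indicator {norm y / 2..norm y} r" for r
        using that by (auto simp: indicator_def dyadic_shell_def field_simps)
      hence "(\<integral>\<^sup>+r. indicator {0<..} r * ennreal (inverse r) * indicator dyadic_shell (inverse r *\<^sub>R y) * G y \<partial>lborel)
         = (\<integral>\<^sup>+r. ennreal (inverse r) * indicator {norm y / 2..norm y} r * G y \<partial>lborel)" by simp
      also have "\<dots> = ennreal (ln 2) * G y"
        using that by (subst nn_integral_multc) (auto simp: nn_integral_inverse_dyadic)
      finally show ?thesis .
    qed
    show "AE y in lborel. (\<integral>\<^sup>+r. indicator {0<..} r * ennreal (inverse r) * indicator dyadic_shell (inverse r *\<^sub>R y) * G y \<partial>lborel) = ennreal (ln 2) * G y"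
      using AE_lborel_singleton[of "0::'a"] by eventually_elim (rule inner)
  qed
  also have "\<dots> = ennreal (ln 2) * (\<integral>\<^sup>+x. G x \<partial>lborel)"
    by (subst nn_integral_cmult) auto
  finally show ?thesis ..
qed

text \<open>This is ln 2 times the surface area of the unit sphere.\<close>

definition shell_const :: "'a::euclidean_space itself \<Rightarrow> ennreal" where
  "shell_const _ = (\<integral>\<^sup>+x. indicator dyadic_shell x * ennreal (inverse (norm (x::'a)) ^ DIM('a)) \<partial>lborel)"

lemma polar_unit:
  fixes G :: "'a::euclidean_space \<Rightarrow> ennreal"
  assumes [measurable]: "G \<in> borel_measurable borel"
  shows "ennreal (ln 2) * (\<integral>\<^sup>+x. G x \<partial>lborel)
    = (\<integral>\<^sup>+x. indicator dyadic_shell x * ennreal (inverse (norm x) ^ DIM('a)) * radial_integral G (inverse (norm x) *\<^sub>R x) \<partial>lborel)"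
  unfolding polar_shell[OF assms]
proof (intro nn_integral_cong)
  fix x :: 'a
  show "indicator dyadic_shell x * radial_integral G x
    = indicator dyadic_shell x * ennreal (inverse (norm x) ^ DIM('a)) * radial_integral G (inverse (norm x) *\<^sub>R x)"
  proof (cases "x \<in> dyadic_shell")
    case True
    hence "norm x > 0" by (auto simp: dyadic_shell_def)
    from radial_integral_scale[OF assms positive_imp_inverse_positive[OF this], of x] show ?thesis by (simp add: mult.assoc)
  qed simp
qed

lemma radial_integral_radial:
  assumes "norm x = 1"
  shows "radial_integral (\<lambda>y::'a::euclidean_space. g (norm y)) x = (\<integral>\<^sup>+r. ennreal (r ^ (DIM('a) - 1)) * indicator {0<..} r * g r \<partial>lborel)"
  unfolding radial_integral_def using assms by (intro nn_integral_cong) (auto simp: indicator_def)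

lemma nn_integral_radial_shell:
  fixes g :: "real \<Rightarrow> ennreal"
  assumes [measurable]: "g \<in> borel_measurable borel"
  shows "ennreal (ln 2) * (\<integral>\<^sup>+(x::'a::euclidean_space). g (norm x) \<partial>lborel)
    = shell_const TYPE('a) * (\<integral>\<^sup>+r. ennreal (r ^ (DIM('a) - 1)) * indicator {0<..} r * g r \<partial>lborel)"
proof -
  have "ennreal (ln 2) * (\<integral>\<^sup>+(x::'a). g (norm x) \<partial>lborel)
     = (\<integral>\<^sup>+(x::'a). indicator dyadic_shell x * ennreal (inverse (norm x) ^ DIM('a)) * radial_integral (\<lambda>x. g (norm x)) (inverse (norm x) *\<^sub>R x) \<partial>lborel)"
    by (rule polar_unit) measurable
  also have "\<dots> = (\<integral>\<^sup>+(x::'a). indicator dyadic_shell x * ennreal (inverse (norm x) ^ DIM('a)) * (\<integral>\<^sup>+r. ennreal (r ^ (DIM('a) - 1)) * indicator {0<..} r * g r \<partial>lborel) \<partial>lborel)"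
  proof (intro nn_integral_cong)
    fix x :: 'a
    show "indicator dyadic_shell x * ennreal (inverse (norm x) ^ DIM('a)) * radial_integral (\<lambda>x. g (norm x)) (inverse (norm x) *\<^sub>R x)
      = indicator dyadic_shell x * ennreal (inverse (norm x) ^ DIM('a)) * (\<integral>\<^sup>+r. ennreal (r ^ (DIM('a) - 1)) * indicator {0<..} r * g r \<partial>lborel)"
    proof (cases "x \<in> dyadic_shell")
      case True
      hence "norm x > 0" by (auto simp: dyadic_shell_def)
      hence "norm (inverse (norm x) *\<^sub>R x) = 1" by simp
      thus ?thesis by (subst radial_integral_radial) auto
    qed simp
  qed
  also have "\<dots> = shell_const TYPE('a) * (\<integral>\<^sup>+r. ennreal (r ^ (DIM('a) - 1)) * indicator {0<..} r * g r \<partial>lborel)"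
    unfolding shell_const_def by (subst nn_integral_multc) auto
  finally show ?thesis .
qed

lemma nn_integral_power:
  assumes "\<rho> > 0" "m > 0"
  shows "(\<integral>\<^sup>+r. ennreal (r ^ (m - 1)) * indicator {0<..} r * indicator {..<\<rho>} r \<partial>lborel) = ennreal (\<rho> ^ m / m)"
proof -
  have "(\<integral>\<^sup>+r. ennreal (r ^ (m - 1)) * indicator {0<..} r * indicator {..<\<rho>} r \<partial>lborel)
     = (\<integral>\<^sup>+r. ennreal (r ^ (m - 1)) * indicator {0..\<rho>} r \<partial>lborel)"
  proof (rule nn_integral_cong_AE)
    show "AE r in lborel. ennreal (r ^ (m - 1)) * indicator {0<..} r * indicator {..<\<rho>} r = ennreal (r ^ (m - 1)) * indicator {0..\<rho>} r"
      using AE_lborel_singleton[of "0::real"] AE_lborel_singleton[of \<rho>]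
      by eventually_elim (auto simp: indicator_def)
  qed
  also have "\<dots> = ennreal (\<rho> ^ m / m - 0 ^ m / m)"
    using assms by (intro nn_integral_FTC_Icc) (auto intro!: derivative_eq_intros)
  finally show ?thesis using assms by (simp add: zero_power)
qed

abbreviation ball_volume :: "'a::euclidean_space itself \<Rightarrow> real" where
  "ball_volume _ \<equiv> measure lborel (ball (0::'a) 1)"

text \<open>Testing the radial formula with the indicator of the unit ball determines the
  constant.\<close>

lemma shell_const_eq: "shell_const TYPE('a::euclidean_space) = ennreal (ln 2 * (DIM('a) * ball_volume TYPE('a)))"
proof -
  let ?n = "DIM('a)"
  have fin: "emeasure lborel (ball (0::'a) 1) = ennreal (ball_volume TYPE('a))"
    using emeasure_lborel_ball_finite[of "0::'a" 1] by (intro emeasure_eq_ennreal_measure) auto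
  have "(\<integral>\<^sup>+(x::'a). indicator {..<1} (norm x) \<partial>lborel) = (\<integral>\<^sup>+(x::'a). indicator (ball 0 1) x \<partial>lborel)"
    by (intro nn_integral_cong) (auto simp: indicator_def)
  also have "\<dots> = ennreal (ball_volume TYPE('a))" using fin by simp
  finally have 1: "(\<integral>\<^sup>+(x::'a). indicator {..<1} (norm x) \<partial>lborel) = ennreal (ball_volume TYPE('a))" .
  have "ennreal (ln 2) * ennreal (ball_volume TYPE('a)) = shell_const TYPE('a) * ennreal (1 / ?n)"
    using nn_integral_radial_shell[of "indicator {..<1}", where 'a='a] nn_integral_power[of 1 ?n] by (simp add: 1)
  hence "ennreal (ln 2) * ennreal (ball_volume TYPE('a)) * ennreal ?n = shell_const TYPE('a) * (ennreal (1 / ?n) * ennreal ?n)"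
    by (simp add: mult.assoc)
  also have "ennreal (1 / ?n) * ennreal ?n = 1" by (subst ennreal_mult[symmetric]) auto
  finally show ?thesis by (simp add: ennreal_mult mult_ac)
qed

lemma ennreal_ln2_mult: "ennreal (ln 2 * b) = ennreal (ln 2) * ennreal b"
  by (rule ennreal_mult') simp

lemma ennreal_ln2_cancel:
  "ennreal (ln 2) * a \<le> ennreal (ln 2) * b \<Longrightarrow> a \<le> b"
  "ennreal (ln 2) * a = ennreal (ln 2) * b \<Longrightarrow> a = b"
  by (simp_all add: ennreal_mult_le_mult_iff ennreal_mult_cancel_left)

theorem nn_integral_radial:
  fixes g :: "real \<Rightarrow> ennreal"
  assumes [measurable]: "g \<in> borel_measurable borel"
  shows "(\<integral>\<^sup>+(x::'a::euclidean_space). g (norm x) \<partial>lborel)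
    = ennreal (DIM('a) * ball_volume TYPE('a)) * (\<integral>\<^sup>+r. ennreal (r ^ (DIM('a) - 1)) * indicator {0<..} r * g r \<partial>lborel)"
  by (rule ennreal_ln2_cancel(2))
     (simp only: nn_integral_radial_shell[OF assms] shell_const_eq ennreal_ln2_mult mult.assoc)

text \<open>The passage from rays to space: a bound with the same L on every ray integrates to a
  bound on the whole space, although G need not be radial. The factor is the area of the unit
  sphere.\<close>

theorem nn_integral_ray_lower_bound:
  fixes G :: "'a::euclidean_space \<Rightarrow> ennreal"
  assumes [measurable]: "G \<in> borel_measurable borel"
    and L: "\<And>x. norm x = 1 \<Longrightarrow> L \<le> radial_integral G x"
  shows "ennreal (DIM('a) * ball_volume TYPE('a)) * L \<le> (\<integral>\<^sup>+x. G x \<partial>lborel)"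
proof (rule ennreal_ln2_cancel(1))
  have "ennreal (ln 2) * (ennreal (DIM('a) * ball_volume TYPE('a)) * L) = shell_const TYPE('a) * L"
    by (simp only: shell_const_eq ennreal_ln2_mult mult.assoc)
  also have "\<dots> = (\<integral>\<^sup>+(x::'a). indicator dyadic_shell x * ennreal (inverse (norm x) ^ DIM('a)) * L \<partial>lborel)"
    unfolding shell_const_def by (subst nn_integral_multc) auto
  also have "\<dots> \<le> (\<integral>\<^sup>+x. indicator dyadic_shell x * ennreal (inverse (norm x) ^ DIM('a)) * radial_integral G (inverse (norm x) *\<^sub>R x) \<partial>lborel)"
  proof (intro nn_integral_mono)
    fix x :: 'a
    show "indicator dyadic_shell x * ennreal (inverse (norm x) ^ DIM('a)) * L
      \<le> indicator dyadic_shell x * ennreal (inverse (norm x) ^ DIM('a)) * radial_integral G (inverse (norm x) *\<^sub>R x)"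
    proof (cases "x \<in> dyadic_shell")
      case True
      hence "norm x > 0" by (auto simp: dyadic_shell_def)
      hence "norm (inverse (norm x) *\<^sub>R x) = 1" by simp
      thus ?thesis by (intro mult_left_mono L) auto
    qed simp
  qed
  finally show "ennreal (ln 2) * (ennreal (DIM('a) * ball_volume TYPE('a)) * L) \<le> ennreal (ln 2) * (\<integral>\<^sup>+x. G x \<partial>lborel)"
    unfolding polar_unit[OF assms(1)] .
qed

text \<open>The gap between R^p and |x|^p on the comparison ball. It serves twice: for the moments
  of the spectral density, and with p = 2 for the moment of inertia.\<close>

lemma nn_integral_ball_deficit:
  fixes p :: nat
  assumes "\<rho> > 0" "p > 0"
  shows "(\<integral>\<^sup>+(x::'a::euclidean_space). ennreal (\<rho> ^ p - norm x ^ p) * indicator {..<\<rho>} (norm x) \<partial>lborel)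
    = ennreal (ball_volume TYPE('a) * \<rho> ^ (DIM('a) + p) * p / (DIM('a) + p))"
proof -
  let ?n = "DIM('a)"
  have n: "?n > 0" by simp
  have "(\<integral>\<^sup>+r. ennreal (r ^ (?n - 1)) * indicator {0<..} r * (ennreal (\<rho> ^ p - r ^ p) * indicator {..<\<rho>} r) \<partial>lborel)
    = (\<integral>\<^sup>+r. ennreal (r ^ (?n - 1) * (\<rho> ^ p - r ^ p)) * indicator {0..\<rho>} r \<partial>lborel)"
  proof (rule nn_integral_cong_AE)
    show "AE r in lborel. ennreal (r ^ (?n - 1)) * indicator {0<..} r * (ennreal (\<rho> ^ p - r ^ p) * indicator {..<\<rho>} r)
       = ennreal (r ^ (?n - 1) * (\<rho> ^ p - r ^ p)) * indicator {0..\<rho>} r"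
      using AE_lborel_singleton[of "0::real"] AE_lborel_singleton[of \<rho>]
    proof eventually_elim
      case (elim r)
      then show ?case
        using power_mono[of r \<rho> p] by (auto simp: indicator_def ennreal_mult)
    qed
  qed
  also have "\<dots> = ennreal ((\<rho> ^ p * \<rho> ^ ?n / ?n - \<rho> ^ (?n + p) / (?n + p)) - (\<rho> ^ p * 0 ^ ?n / ?n - 0 ^ (?n + p) / (?n + p)))"
  proof (intro nn_integral_FTC_Icc)
    fix x :: real assume x: "x \<in> {0..\<rho>}"
    have e: "x ^ (?n - 1) * x ^ p = x ^ (?n + p - 1)" using n by (simp flip: power_add)
    show "((\<lambda>x. \<rho> ^ p * x ^ ?n / ?n - x ^ (?n + p) / (?n + p)) has_real_derivative x ^ (?n - 1) * (\<rho> ^ p - x ^ p)) (at x)"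
      using n e by (auto intro!: derivative_eq_intros simp: algebra_simps simp del: of_nat_add)
    show "0 \<le> x ^ (?n - 1) * (\<rho> ^ p - x ^ p)" using x by (auto intro!: mult_nonneg_nonneg power_mono)
  qed (use assms in auto)
  also have "(\<rho> ^ p * \<rho> ^ ?n / ?n - \<rho> ^ (?n + p) / (?n + p)) - (\<rho> ^ p * 0 ^ ?n / ?n - 0 ^ (?n + p) / (?n + p))
      = \<rho> ^ (?n + p) * p / (?n * (?n + p))"
    using n assms by (simp add: power_add field_simps zero_power)
  finally have "(\<integral>\<^sup>+r. ennreal (r ^ (?n - 1)) * indicator {0<..} r * (ennreal (\<rho> ^ p - r ^ p) * indicator {..<\<rho>} r) \<partial>lborel)
    = ennreal (\<rho> ^ (?n + p) * p / (?n * (?n + p)))" .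
  hence "(\<integral>\<^sup>+(x::'a). ennreal (\<rho> ^ p - norm x ^ p) * indicator {..<\<rho>} (norm x) \<partial>lborel)
    = ennreal (?n * ball_volume TYPE('a)) * ennreal (\<rho> ^ (?n + p) * p / (?n * (?n + p)))"
    by (subst nn_integral_radial) auto
  also have "\<dots> = ennreal (ball_volume TYPE('a) * \<rho> ^ (DIM('a) + p) * p / (DIM('a) + p))"
  proof -
    have "a * b * (X / (a * m)) = b * X / m" if "a \<noteq> 0" for a b X m :: real using that by simp
    from this[of ?n] n assms show ?thesis by (subst ennreal_mult[symmetric]) (simp_all add: mult.assoc)
  qed
  finally show ?thesis .
qed

section \<open>The one-dimensional inequality along a ray\<close>

text \<open>Outside the sphere this is the tangent of r^p at R. Inside, the factor q^2 gives
  something away, but the bound becomes linear in p and combines with the weight q^(n-1) to the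
  single power q^(n+1). The remainders are factored explicitly for p = 2 and p = 4.\<close>

lemma power_difference_bounds:
  fixes r R :: real
  assumes "p = 2 \<or> p = (4::nat)" "R > 0"
  shows "r \<ge> R \<Longrightarrow> real p * R ^ (p - 1) * (r - R) \<le> r ^ p - R ^ p"
    and "0 \<le> q \<Longrightarrow> q \<le> 1 \<Longrightarrow> real p * (1 - q) * q\<^sup>2 \<le> 1 - q ^ p"
proof -
  assume r: "r \<ge> R"
  define t where "t = r - R"
  have t: "r = R + t" "t \<ge> 0" using r by (simp_all add: t_def)
  from assms(1) show "real p * R ^ (p - 1) * (r - R) \<le> r ^ p - R ^ p"
  proof
    assume "p = 2" thus ?thesis unfolding t(1) by (simp add: power2_eq_square algebra_simps)
  next
    assume "p = 4"
    moreover have "(R + t) ^ 4 - R ^ 4 - 4 * R ^ 3 * t = t\<^sup>2 * (6 * R\<^sup>2 + 4 * R * t + t\<^sup>2)"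
      by (simp add: power2_eq_square power3_eq_cube power4_eq_xxxx algebra_simps)
    moreover have "0 \<le> t\<^sup>2 * (6 * R\<^sup>2 + 4 * R * t + t\<^sup>2)" using t assms(2) by simp
    ultimately show ?thesis unfolding t(1) by simp
  qed
next
  assume q: "0 \<le> q" "q \<le> 1"
  from assms(1) show "real p * (1 - q) * q\<^sup>2 \<le> 1 - q ^ p"
  proof
    assume "p = 2"
    moreover have "1 - q\<^sup>2 - 2 * (1 - q) * q\<^sup>2 = (1 - q) * ((1 - q) * (1 + 2 * q))"
      by (simp add: power2_eq_square algebra_simps)
    moreover have "0 \<le> (1 - q) * ((1 - q) * (1 + 2 * q))" using q by simp
    ultimately show ?thesis by simp
  next
    assume "p = 4"
    moreover have "1 - q ^ 4 - 4 * (1 - q) * q\<^sup>2 = (1 - q) * ((1 - q) * (1 + q * (2 - q)))"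
      by (simp add: power2_eq_square power4_eq_xxxx algebra_simps)
    moreover have "0 \<le> (1 - q) * ((1 - q) * (1 + q * (2 - q)))" using q by simp
    ultimately show ?thesis by simp
  qed
qed

text \<open>Bernoulli's inequality at q / q0 - 1, which is at least -1.\<close>

lemma power_tangent:
  fixes q q0 :: real
  assumes "q \<ge> 0" "q0 > 0"
  shows "q0 ^ m * (1 + real m * (q / q0 - 1)) \<le> q ^ m"
proof -
  have "1 + real m * (q / q0 - 1) \<le> (1 + (q / q0 - 1)) ^ m"
    using assms by (intro Bernoulli_inequality) (simp add: field_simps)
  hence "q0 ^ m * (1 + real m * (q / q0 - 1)) \<le> q0 ^ m * (q / q0) ^ m"
    using assms by (intro mult_left_mono) auto
  also have "\<dots> = q ^ m" using assms by (simp flip: power_mult_distrib)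
  finally show ?thesis .
qed

text \<open>With t = r - R, the line s - t / L is the lowest course of a square root that has the
  value s at R and Lipschitz constant 1 / L. It reaches 0 at t = L s, where the integral
  stops.\<close>

lemma outer_profile_integral:
  fixes s L R :: real
  assumes "L > 0" "s \<ge> 0" "C \<ge> 0"
  shows "(\<integral>\<^sup>+r. ennreal (C * ((r - R) * (s - (r - R) / L)\<^sup>2)) * indicator {R..R + L * s} r \<partial>lborel)
    = ennreal (C * (L\<^sup>2 * s ^ 4 / 12))"
proof -
  define F where "F r = C * (s\<^sup>2 * (r - R)\<^sup>2 / 2 - 2 * s * (r - R) ^ 3 / (3 * L) + (r - R) ^ 4 / (4 * L\<^sup>2))" for r
  have "(\<integral>\<^sup>+r. ennreal (C * ((r - R) * (s - (r - R) / L)\<^sup>2)) * indicator {R..R + L * s} r \<partial>lborel) = ennreal (F (R + L * s) - F R)"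
  proof (intro nn_integral_FTC_Icc)
    fix x
    show "(F has_real_derivative C * ((x - R) * (s - (x - R) / L)\<^sup>2)) (at x)"
      unfolding F_def using assms
      by (auto intro!: derivative_eq_intros simp: field_simps power2_eq_square power3_eq_cube power4_eq_xxxx)
    assume "x \<in> {R..R + L * s}"
    thus "0 \<le> C * ((x - R) * (s - (x - R) / L)\<^sup>2)" using assms by simp
  qed (use assms in auto)
  also have "F (R + L * s) - F R = C * (L\<^sup>2 * s ^ 4 / 12)"
    using assms by (simp add: F_def field_simps power2_eq_square power3_eq_cube power4_eq_xxxx)
  finally show ?thesis .
qed

text \<open>
  The weight \<open>(r / R) ^ m\<close> is replaced by its tangent at the mean of \<open>r / R\<close> with respect to
  \<open>(R - r) (s - (R - r) / L)\<^sup>2\<close> for \<open>s = 1\<close>, which is \<open>1 - 2 L / (5 R)\<close>.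
\<close>

lemma inner_profile_integral:
  fixes s L R :: real
  assumes L: "L > 0" "L \<le> R" and s: "0 \<le> s" "s \<le> 1" and C: "C \<ge> 0"
  defines "q0 \<equiv> 1 - 2 * L / (5 * R)"
  shows "ennreal (C * (q0 ^ m * (L\<^sup>2 * s ^ 4 / 12)))
    \<le> (\<integral>\<^sup>+r. ennreal (C * ((r / R) ^ m * ((R - r) * (s - (R - r) / L)\<^sup>2))) * indicator {R - L * s..R} r \<partial>lborel)"
proof -
  let ?a = "R - L * s"
  have R: "R > 0" using L by linarith
  have q0: "q0 > 0" using L R by (simp add: q0_def field_simps)
  have Ls: "L * s \<le> L" using s L by (simp add: mult_left_le)
  have "0 \<le> L * s" using L s by simp
  hence a: "0 \<le> ?a" "?a \<le> R" using L Ls by linarith+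
  define w where "w r = (R - r) * (s - (R - r) / L)\<^sup>2" for r
  define A where "A = C * q0 ^ m"
  have A0: "A \<ge> 0" using C q0 by (simp add: A_def)
  \<comment> \<open>Antiderivatives in t = R - r of t and t^2 times the squared profile. The tangent
    of the weight is affine, so no other moments occur.\<close>
  define G1 where "G1 t = s\<^sup>2 * t\<^sup>2 / 2 - 2 * s * t ^ 3 / (3 * L) + t ^ 4 / (4 * L\<^sup>2)" for t
  define G2 where "G2 t = s\<^sup>2 * t ^ 3 / 3 - s * t ^ 4 / (2 * L) + t ^ 5 / (5 * L\<^sup>2)" for t
  have G1': "(G1 has_real_derivative t * (s - t / L)\<^sup>2) (at t)" for t
    unfolding G1_def using L by (auto intro!: derivative_eq_intros simp: field_simps power2_eq_square power3_eq_cube power4_eq_xxxx)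
  have G2': "(G2 has_real_derivative t * (t * (s - t / L)\<^sup>2)) (at t)" for t
    unfolding G2_def using L by (auto intro!: derivative_eq_intros simp: field_simps power2_eq_square power3_eq_cube power4_eq_xxxx)
  define F where "F r = - (A * ((1 + m * (1 / q0 - 1)) * G1 (R - r) - m / (q0 * R) * G2 (R - r)))" for r
  have F': "(F has_real_derivative A * (1 + m * ((r / R) / q0 - 1)) * w r) (at r)" for r
  proof -
    have d: "((\<lambda>r. R - r) has_real_derivative -1) (at r)" by (auto intro!: derivative_eq_intros)
    have e: "(1 + m * (1 / q0 - 1)) * ((R - r) * (s - (R - r) / L)\<^sup>2 * (- 1)) - m / (q0 * R) * ((R - r) * ((R - r) * (s - (R - r) / L)\<^sup>2) * (- 1))
       = - ((1 + m * ((r / R) / q0 - 1)) * w r)"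
    proof -
      have "(1 + m * (1 / q0 - 1)) * (W * (- 1)) - m / (q0 * R) * ((R - r) * W * (- 1)) = - ((1 + m * ((r / R) / q0 - 1)) * W)" for W
        using q0 R by (simp add: field_simps)
      from this[of "w r"] show ?thesis by (simp add: w_def)
    qed
    have "((\<lambda>r. (1 + m * (1 / q0 - 1)) * G1 (R - r) - m / (q0 * R) * G2 (R - r)) has_real_derivative
        - ((1 + m * ((r / R) / q0 - 1)) * w r)) (at r)"
      unfolding e[symmetric] by (intro DERIV_diff DERIV_cmult DERIV_chain2[OF G1' d] DERIV_chain2[OF G2' d])
    from DERIV_minus[OF DERIV_cmult[OF this, of A]] show ?thesis by (simp add: F_def[abs_def] mult.assoc)
  qed
  have hi: "((\<lambda>r. A * (1 + m * ((r / R) / q0 - 1)) * w r) has_integral (F R - F ?a)) {?a..R}"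
    using a F' by (intro fundamental_theorem_of_calculus) (auto simp: has_real_derivative_iff_has_vector_derivative[symmetric] intro: DERIV_subset)
  have cont: "continuous_on {?a..R} (\<lambda>r. C * ((r / R) ^ m * w r))"
    using R L unfolding w_def by (intro continuous_intros) auto
  then obtain J where J: "((\<lambda>r. C * ((r / R) ^ m * w r)) has_integral J) {?a..R}"
    using integrable_continuous_interval by blast
  have w0: "w r \<ge> 0" if "r \<le> R" for r using that by (simp add: w_def)
  have 1: "F R - F ?a \<le> J"
  proof (rule has_integral_le[OF hi J])
    fix r assume r: "r \<in> {?a..R}"
    have "q0 ^ m * (1 + m * ((r / R) / q0 - 1)) \<le> (r / R) ^ m"
      using r a R q0 by (intro power_tangent) auto
    hence "C * w r * (q0 ^ m * (1 + m * ((r / R) / q0 - 1))) \<le> C * w r * (r / R) ^ m"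
      using C w0 r by (intro mult_left_mono) auto
    thus "A * (1 + m * ((r / R) / q0 - 1)) * w r \<le> C * ((r / R) ^ m * w r)" by (simp add: A_def mult_ac)
  qed
  have 2: "F R - F ?a = A * ((1 + m * (1 / q0 - 1)) * (L\<^sup>2 * s ^ 4 / 12) - m / (q0 * R) * (L ^ 3 * s ^ 5 / 30))"
  proof -
    have g1: "G1 (L * s) = L\<^sup>2 * s ^ 4 / 12" using L
      by (simp add: G1_def field_simps power2_eq_square power3_eq_cube power4_eq_xxxx)
    have g2: "G2 (L * s) = L ^ 3 * s ^ 5 / 30" using L
      by (simp add: G2_def field_simps power2_eq_square power3_eq_cube power4_eq_xxxx eval_nat_numeral)
    have "G1 0 = 0" "G2 0 = 0" by (simp_all add: G1_def G2_def)
    hence "F R - F ?a = A * ((1 + m * (1 / q0 - 1)) * G1 (L * s) - m / (q0 * R) * G2 (L * s))" by (simp add: F_def)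
    thus ?thesis by (simp only: g1 g2)
  qed
  \<comment> \<open>Under the profile with parameter s the mean of R - r is 2 L s / 5. For s < 1
    this is nearer to the sphere than the point of tangency, and the tangent value exceeds
    \<open>q0 ^ m\<close> by a term proportional to 1 - s.\<close>
  have 3: "A * (L\<^sup>2 * s ^ 4 / 12) \<le> A * ((1 + m * (1 / q0 - 1)) * (L\<^sup>2 * s ^ 4 / 12) - m / (q0 * R) * (L ^ 3 * s ^ 5 / 30))"
  proof (rule mult_left_mono[OF _ A0])
    have "(1 + m * (1 / q0 - 1)) * (L\<^sup>2 * s ^ 4 / 12) - m / (q0 * R) * (L ^ 3 * s ^ 5 / 30) - L\<^sup>2 * s ^ 4 / 12
      = m / q0 * ((1 - q0) * (L\<^sup>2 * s ^ 4 / 12) - 1 / R * (L ^ 3 * s ^ 5 / 30))"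
      using q0 R by (simp add: field_simps)
    also have "1 - q0 = 2 * L / (5 * R)" by (simp add: q0_def)
    also have "2 * L / (5 * R) * (L\<^sup>2 * s ^ 4 / 12) - 1 / R * (L ^ 3 * s ^ 5 / 30) = L ^ 3 * s ^ 4 * (1 - s) / (30 * R)"
      using R by (simp add: field_simps power2_eq_square power3_eq_cube eval_nat_numeral)
    finally have "(1 + m * (1 / q0 - 1)) * (L\<^sup>2 * s ^ 4 / 12) - m / (q0 * R) * (L ^ 3 * s ^ 5 / 30) - L\<^sup>2 * s ^ 4 / 12
      = m / q0 * (L ^ 3 * s ^ 4 * (1 - s) / (30 * R))" .
    moreover have "0 \<le> m / q0 * (L ^ 3 * s ^ 4 * (1 - s) / (30 * R))" using q0 L R s by simp
    ultimately show "L\<^sup>2 * s ^ 4 / 12 \<le> (1 + m * (1 / q0 - 1)) * (L\<^sup>2 * s ^ 4 / 12) - m / (q0 * R) * (L ^ 3 * s ^ 5 / 30)" by linarith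
  qed
  have "A * (L\<^sup>2 * s ^ 4 / 12) \<le> J" using order_trans[OF 3[folded 2] 1] .
  hence le: "C * (q0 ^ m * (L\<^sup>2 * s ^ 4 / 12)) \<le> J" by (simp only: A_def mult.assoc)
  let ?g = "\<lambda>r. if r \<in> {?a..R} then C * ((r / R) ^ m * w r) else 0"
  have "(\<integral>\<^sup>+r. ennreal (C * ((r / R) ^ m * w r)) * indicator {?a..R} r \<partial>lborel) = (\<integral>\<^sup>+r. ennreal (?g r) \<partial>lborel)"
    by (intro nn_integral_cong) (auto simp: indicator_def)
  also have "\<dots> = ennreal J"
  proof (rule nn_integral_has_integral_lborel)
    show "?g \<in> borel_measurable borel" unfolding w_def by measurable
    show "0 \<le> ?g r" for r using C R a w0[of r] by auto
    show "(?g has_integral J) UNIV" using J by (simp only: has_integral_restrict_UNIV)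
  qed
  finally show ?thesis using le by (simp add: w_def ennreal_leI)
qed

text \<open>The minimum over c is A / (1 + A), which is 1/8 for A = 1/7 and is then attained at c =
  1/8; the proof completes the square there.\<close>

lemma convex_combination_bound:
  fixes c A :: real
  assumes "A \<ge> 1 / 7"
  shows "1 / 8 \<le> c\<^sup>2 + A * (1 - c)\<^sup>2"
proof -
  have "1 / 7 * (1 - c)\<^sup>2 \<le> A * (1 - c)\<^sup>2" using assms by (intro mult_right_mono) auto
  moreover have "c\<^sup>2 + 1 / 7 * (1 - c)\<^sup>2 - 1 / 8 = 8 / 7 * (c - 1 / 8)\<^sup>2"
    by (simp add: power2_eq_square field_simps)
  moreover have "0 \<le> 8 / 7 * (c - 1 / 8)\<^sup>2" by simp
  ultimately show ?thesis by linarith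
qed

text \<open>Here f is the density on a ray relative to V, and c = f(R) is unknown. Outside, \<surd>f
  stays above a line descending from \<surd>c; inside, \<surd>(1 - f) stays above one descending
  from \<surd>(1 - c). So f cannot be close to the indicator of [0, R] on both sides. The
  contributions are c^2 and A (1 - c)^2 times p R^(n+p-2) L^2 / 12 with L = 2 h, and the minimum 1/8
  over c gives the factor 1/24.\<close>

lemma ray_inequality:
  fixes f :: "real \<Rightarrow> real"
  assumes p: "p = 2 \<or> p = (4::nat)" and n: "n \<ge> 1"
    and h: "h > 0" "2 * h \<le> R" "(1 - 4 * h / (5 * R)) ^ (n + 1) \<ge> 1 / 7"
    and f: "\<And>r. 0 \<le> f r \<and> f r \<le> 1"
    and lip: "\<And>r. r \<ge> 0 \<Longrightarrow> \<bar>sqrt (f r) - sqrt (f R)\<bar> \<le> \<bar>r - R\<bar> / (2 * h)"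
    and lip': "\<And>r. r \<ge> 0 \<Longrightarrow> \<bar>sqrt (1 - f r) - sqrt (1 - f R)\<bar> \<le> \<bar>r - R\<bar> / (2 * h)"
  shows "ennreal (p * h\<^sup>2 * R ^ (n + p - 2) / 24) \<le>
    (\<integral>\<^sup>+r. ennreal (r ^ (n - 1)) * indicator {0<..} r *
       ennreal (if r < R then (R ^ p - r ^ p) * (1 - f r) else (r ^ p - R ^ p) * f r) \<partial>lborel)"
proof -
  define L where "L = 2 * h"
  define c where "c = f R"
  define so where "so = sqrt c"
  define si where "si = sqrt (1 - c)"
  define C where "C = p * R ^ (n + p - 2)"
  define A where "A = (1 - 2 * L / (5 * R)) ^ (n + 1)"
  have R: "R > 0" using h by linarith
  have L: "L > 0" "L \<le> R" using h by (simp_all add: L_def)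
  have C: "C \<ge> 0" using R by (simp add: C_def)
  have c: "0 \<le> c" "c \<le> 1" using f by (auto simp: c_def)
  have so: "0 \<le> so" "so ^ 4 = c\<^sup>2" using c by (simp_all add: so_def power4_eq_xxxx power2_eq_square)
  have si: "0 \<le> si" "si \<le> 1" "si ^ 4 = (1 - c)\<^sup>2"
    using c by (simp_all add: si_def power4_eq_xxxx power2_eq_square)
  have A: "A \<ge> 1 / 7" using h(3) by (simp add: A_def L_def)
  let ?H = "\<lambda>r. ennreal (r ^ (n - 1)) * indicator {0<..} r * ennreal (if r < R then (R ^ p - r ^ p) * (1 - f r) else (r ^ p - R ^ p) * f r)"
  let ?O = "\<lambda>r. ennreal (C * ((r - R) * (so - (r - R) / L)\<^sup>2)) * indicator {R..R + L * so} r"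
  let ?I = "\<lambda>r. ennreal (C * ((r / R) ^ (n + 1) * ((R - r) * (si - (R - r) / L)\<^sup>2))) * indicator {R - L * si..R} r"
  \<comment> \<open>Both profiles are scaled by R^(n-1) and the derivative p R^(p-1) of r^p at R.
    Inside, R - r is written as R (1 - q), hence the second form with one more factor R.\<close>
  have CR: "C = R ^ (n - 1) * (p * R ^ (p - 1))" "C * R = R ^ (n - 1) * (p * R ^ p)"
  proof -
    have e: "n + p - 2 = (n - 1) + (p - 1)" using n p by auto
    show 1: "C = R ^ (n - 1) * (p * R ^ (p - 1))" by (simp add: C_def e power_add)
    have "R ^ (p - 1) * R = R ^ p"
      using p by (auto simp: power2_eq_square power3_eq_cube power4_eq_xxxx)
    thus "C * R = R ^ (n - 1) * (p * R ^ p)" by (simp add: 1)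
  qed
  have "?I r + ?O r \<le> ?H r" for r
  proof -
    consider "r = R" | "r > R" "r \<le> R + L * so" | "r > R" "r > R + L * so" | "r < R" "r \<ge> R - L * si" | "r < R" "r < R - L * si"
      by linarith
    thus ?thesis
    proof cases
      case 1
      thus ?thesis by simp
    next
      case 2
      have t: "0 \<le> so - (r - R) / L" using 2 L by (simp add: field_simps)
      have "so - (r - R) / L \<le> sqrt (f r)"
        using lip[of r] 2 R by (simp add: L_def so_def c_def)
      hence fr: "(so - (r - R) / L)\<^sup>2 \<le> f r"
        using t f[of r] by (metis power_mono real_sqrt_pow2)
      have "C * ((r - R) * (so - (r - R) / L)\<^sup>2) = R ^ (n - 1) * ((p * R ^ (p - 1) * (r - R)) * (so - (r - R) / L)\<^sup>2)"
        by (simp add: CR(1) mult_ac)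
      also have "\<dots> \<le> r ^ (n - 1) * ((r ^ p - R ^ p) * f r)"
        using 2 R power_difference_bounds(1)[OF p R, of r] fr f[of r] power_mono[of R r p]
        by (intro mult_mono power_mono mult_nonneg_nonneg) auto
      finally show ?thesis using 2 R by (simp add: ennreal_mult'[symmetric] ennreal_leI)
    next
      case 3
      thus ?thesis by simp
    next
      case 4
      define q where "q = r / R"
      have "L * si \<le> R" using L si mult_left_le[of si L] by linarith
      hence r0: "r \<ge> 0" using 4 by linarith
      have q: "0 \<le> q" "q \<le> 1" "r = R * q" using r0 4 R by (simp_all add: q_def)
      have t: "0 \<le> si - (R - r) / L" using 4 L by (simp add: field_simps)
      have "si - (R - r) / L \<le> sqrt (1 - f r)"
        using lip'[of r] 4 r0 by (simp add: L_def si_def c_def)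
      hence fr: "(si - (R - r) / L)\<^sup>2 \<le> 1 - f r"
        using t f[of r] by (metis power_mono real_sqrt_pow2 diff_ge_0_iff_ge)
      have e: "R - r = R * (1 - q)" using q by (simp add: algebra_simps)
      have "C * (q ^ (n + 1) * ((R - r) * (si - (R - r) / L)\<^sup>2))
        = (C * R) * (q ^ (n + 1) * (1 - q)) * (si - (R - r) / L)\<^sup>2" by (simp add: e mult_ac)
      also have "\<dots> = R ^ (n - 1) * R ^ p * (q ^ (n - 1) * (p * (1 - q) * q\<^sup>2)) * (si - (R - r) / L)\<^sup>2"
      proof -
        \<comment> \<open>The exponent n + 1 consists of n - 1 from polar coordinates and 2 from the
          lower bound for 1 - q^p.\<close>
        have "q ^ (n + 1) = q ^ (n - 1) * q\<^sup>2" using n by (simp flip: power_add)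
        thus ?thesis by (simp only: CR(2) mult_ac)
      qed
      also have "\<dots> \<le> R ^ (n - 1) * R ^ p * (q ^ (n - 1) * (1 - q ^ p)) * (1 - f r)"
        using q R fr f[of r] power_difference_bounds(2)[OF p R q(1,2)] power_le_one[of q p]
        by (intro mult_mono mult_nonneg_nonneg) auto
      also have "\<dots> = r ^ (n - 1) * ((R ^ p - r ^ p) * (1 - f r))"
        by (simp add: q(3) power_mult_distrib algebra_simps)
      finally have le: "C * ((r / R) ^ (n + 1) * ((R - r) * (si - (R - r) / L)\<^sup>2)) \<le> r ^ (n - 1) * ((R ^ p - r ^ p) * (1 - f r))"
        by (simp add: q_def)
      show ?thesis
      \<comment> \<open>The indicator on the right excludes r = 0, but there the inner weight
        \<open>(r / R) ^ (n + 1)\<close> vanishes as well.\<close>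
      proof (cases "r = 0")
        case True
        thus ?thesis using R by (simp add: 4)
      next
        case False
        thus ?thesis using 4 r0 le by (simp add: ennreal_mult'[symmetric] ennreal_leI)
      qed
    next
      case 5
      thus ?thesis by simp
    qed
  qed
  hence 1: "(\<integral>\<^sup>+r. ?I r + ?O r \<partial>lborel) \<le> (\<integral>\<^sup>+r. ?H r \<partial>lborel)" by (intro nn_integral_mono)
  have 2: "(\<integral>\<^sup>+r. ?I r + ?O r \<partial>lborel) = (\<integral>\<^sup>+r. ?I r \<partial>lborel) + (\<integral>\<^sup>+r. ?O r \<partial>lborel)"
    by (intro nn_integral_add) measurable
  have 3: "ennreal (C * (A * (L\<^sup>2 * si ^ 4 / 12))) \<le> (\<integral>\<^sup>+r. ?I r \<partial>lborel)"
    unfolding A_def by (rule inner_profile_integral[OF L si(1,2) C])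
  have 4: "(\<integral>\<^sup>+r. ?O r \<partial>lborel) = ennreal (C * (L\<^sup>2 * so ^ 4 / 12))"
    by (rule outer_profile_integral[OF L(1) so(1) C])
  have 5: "ennreal (p * h\<^sup>2 * R ^ (n + p - 2) / 24) \<le> ennreal (C * (A * (L\<^sup>2 * si ^ 4 / 12))) + ennreal (C * (L\<^sup>2 * so ^ 4 / 12))"
  proof -
    have "C * L\<^sup>2 / 12 * (1 / 8) \<le> C * L\<^sup>2 / 12 * (c\<^sup>2 + A * (1 - c)\<^sup>2)"
      using convex_combination_bound[OF A, of c] C by (intro mult_left_mono) auto
    also have "\<dots> = C * (A * (L\<^sup>2 * si ^ 4 / 12)) + C * (L\<^sup>2 * so ^ 4 / 12)"
      by (simp add: si so field_simps)
    also have "C * L\<^sup>2 / 12 * (1 / 8) = p * h\<^sup>2 * R ^ (n + p - 2) / 24"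
      by (simp add: C_def L_def power_mult_distrib)
    finally have le: "p * h\<^sup>2 * R ^ (n + p - 2) / 24 \<le> C * (A * (L\<^sup>2 * si ^ 4 / 12)) + C * (L\<^sup>2 * so ^ 4 / 12)" .
    have "0 \<le> C * (A * (L\<^sup>2 * si ^ 4 / 12))" "0 \<le> C * (L\<^sup>2 * so ^ 4 / 12)" using A C by simp_all
    from ennreal_plus[OF this] le show ?thesis by (metis ennreal_leI)
  qed
  show ?thesis
    by (rule order_trans[OF order_trans[OF 5 add_right_mono[OF 3]] 1[unfolded 2 4]])
qed

section \<open>The size of the unit ball\<close>

lemma unit_ball_vol_rec: "unit_ball_vol (real (n + 2)) = unit_ball_vol (real n) * (2 * pi / real (n + 2))"
proof -
  have "Gamma (real n / 2 + 1 + 1) = (real n / 2 + 1) * Gamma (real n / 2 + 1)"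
    by (intro Gamma_plus1) (auto dest: nonpos_Ints_nonpos)
  moreover have "pi powr (real (n + 2) / 2) = pi powr (real n / 2) * pi"
    by (simp add: add_divide_distrib powr_add)
  moreover have "real (n + 2) / 2 + 1 = real n / 2 + 1 + 1" by simp
  ultimately have "unit_ball_vol (real (n + 2)) = pi powr (real n / 2) * pi / ((real n / 2 + 1) * Gamma (real n / 2 + 1))"
    by (simp only: unit_ball_vol_def)
  also have "X * pi / ((real n / 2 + 1) * G) = X / G * (2 * pi / real (n + 2))" for X G
    by (simp add: divide_simps)
  finally show ?thesis by (simp only: unit_ball_vol_def)
qed

text \<open>Induction in steps of two by \<open>unit_ball_vol_rec\<close>; the ratio of successive
  bounds is controlled by (1 + 2 / (n + 2))^(n + 2) \<le> e^2. The n-th power on the right is chosen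
  for later extraction of n-th roots, which gives R \<rho> \<ge> (n + 2) / e.\<close>

lemma unit_ball_vol_upper: "(unit_ball_vol (real n))\<^sup>2 \<le> (2 * pi * exp 1 / (n + 2)) ^ n"
proof (induction n rule: nat_induct2)
  case 0
  then show ?case by simp
next
  case 1
  have "6 * 2 \<le> (2 * pi) * exp 1" using pi_gt3 exp_ge_add_one_self[of 1] by (intro mult_mono) auto
  then show ?case by simp
next
  case (step n)
  have e: "((real n + 4) / (n + 2)) ^ (n + 2) \<le> exp 2"
  proof -
    have "(real n + 4) / (n + 2) = 1 + 2 / (n + 2)" by (simp add: field_simps)
    also have "\<dots> \<le> exp (2 / (n + 2))" by (rule exp_ge_add_one_self)
    finally have "((real n + 4) / (n + 2)) ^ (n + 2) \<le> exp (2 / (n + 2)) ^ (n + 2)"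
      by (intro power_mono) auto
    also have "\<dots> = exp (real (n + 2) * (2 / (n + 2)))" by (simp only: exp_of_nat_mult)
    also have "real (n + 2) * (2 / (n + 2)) = 2" by (simp add: divide_simps)
    finally show ?thesis .
  qed
  have "(unit_ball_vol (real (n + 2)))\<^sup>2 = (unit_ball_vol (real n))\<^sup>2 * (2 * pi / (n + 2))\<^sup>2"
    by (simp only: unit_ball_vol_rec power_mult_distrib)
  also have "\<dots> \<le> (2 * pi * exp 1 / (n + 2)) ^ n * (2 * pi / (n + 2))\<^sup>2"
    using step by (intro mult_right_mono) (auto simp: add.commute)
  also have "\<dots> = (2 * pi / (n + 2)) ^ (n + 2) * exp 1 ^ n"
    by (simp add: power_mult_distrib power_add power_divide power2_eq_square mult_ac)
  also have "\<dots> \<le> (2 * pi / (n + 2)) ^ (n + 2) * (exp 1 ^ (n + 2) / ((real n + 4) / (n + 2)) ^ (n + 2))"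
  proof (intro mult_left_mono)
    have "exp 1 ^ n * ((real n + 4) / (n + 2)) ^ (n + 2) \<le> exp 1 ^ n * exp 2"
      using e by (intro mult_left_mono) auto
    also have "\<dots> = exp 1 ^ (n + 2)" by (simp add: power_add power2_eq_square flip: exp_add)
    finally show "exp 1 ^ n \<le> exp 1 ^ (n + 2) / ((real n + 4) / (n + 2)) ^ (n + 2)"
      by (subst pos_le_divide_eq) auto
  qed auto
  also have "\<dots> = (2 * pi * exp 1 / (real (n + 2) + 2)) ^ (n + 2)"
    by (simp add: power_divide power_mult_distrib add.commute mult_ac)
  finally show ?case by simp
qed

text \<open>Here \<eta> stands for h / R. Since n (n + 2) \<ge> (n + 0.8)^2 for n \<ge> 2, and e / 2
  \<le> 1.36, \<eta> is at most 1.36 / (n + 0.8). The first claim keeps the inner profile from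
  passing the origin; the second limits the loss inside the ball.\<close>

lemma profile_constant:
  fixes \<eta> :: real
  assumes "n \<ge> (2::nat)" "\<eta> \<ge> 0" and \<eta>: "\<eta>\<^sup>2 \<le> (exp 1)\<^sup>2 / (4 * real n * (real n + 2))"
  shows "2 * \<eta> \<le> 1" "(1 - 4 * \<eta> / 5) ^ (n + 1) \<ge> 1 / 7"
proof -
  have n: "real n \<ge> 2" using assms(1) by simp
  have h: "\<eta> * (n + 0.8) \<le> 1.36"
  proof (rule power2_le_imp_le)
    have "(\<eta> * (n + 0.8))\<^sup>2 \<le> (exp 1)\<^sup>2 / (4 * real n * (real n + 2)) * (n + 0.8)\<^sup>2"
      unfolding power_mult_distrib by (rule mult_right_mono[OF \<eta>]) simp
    also have "\<dots> \<le> (exp 1)\<^sup>2 / (4 * real n * (real n + 2)) * (real n * (real n + 2))"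
      using n by (intro mult_left_mono) (auto simp: power2_eq_square algebra_simps)
    also have "\<dots> = (exp 1)\<^sup>2 / 4" using n by (simp add: divide_simps)
    also have "\<dots> \<le> (2.72)\<^sup>2 / 4"
      using e_less_272 by (intro divide_right_mono power_mono) auto
    finally show "(\<eta> * (n + 0.8))\<^sup>2 \<le> 1.36\<^sup>2" by (simp add: power2_eq_square)
  qed simp
  hence "\<eta> \<le> 1.36 / (n + 0.8)" using n by (simp add: field_simps)
  also have "\<dots> \<le> 1.36 / 2.8" using n by (intro divide_left_mono) auto
  finally show 2: "2 * \<eta> \<le> 1" by simp
  define y where "y = 4 * \<eta> / 5"
  have y: "0 \<le> y" "y * (n + 0.8) \<le> 1.088" using h assms(2) by (simp_all add: y_def)
  have y1: "y < 1" using 2 assms(2) by (simp add: y_def)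
  have "1 / (1 - y) = 1 + y / (1 - y)" using y1 by (simp add: field_simps)
  also have "\<dots> \<le> exp (y / (1 - y))" by (rule exp_ge_add_one_self)
  finally have "(1 / (1 - y)) ^ (n + 1) \<le> exp (y / (1 - y)) ^ (n + 1)"
    using y1 by (intro power_mono) auto
  also have "\<dots> = exp ((n + 1) * (y / (1 - y)))" by (simp only: exp_of_nat_mult)
  \<comment> \<open>1.91 is slightly below ln 7, and the requirement (n + 2.91) 1.088 \<le> 1.91 (n
    + 0.8) is nearly an equality at n = 2.\<close>
  also have "\<dots> \<le> exp 1.91"
  proof -
    have "(n + 1) * y \<le> 1.91 * (1 - y)"
    proof -
      note a = y(2)
      have "(n + 1 + 1.91) * y * (n + 0.8) \<le> (n + 2.91) * 1.088"
        using a n mult_left_mono[OF a, of "n + 2.91"] by (simp add: algebra_simps)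
      also have "\<dots> \<le> 1.91 * (n + 0.8)" using n by (simp add: algebra_simps)
      finally have "((n + 2.91) * y) * (n + 0.8) \<le> 1.91 * (n + 0.8)" by (simp add: add.commute)
      hence "(n + 2.91) * y \<le> 1.91" by (rule mult_right_le_imp_le) (use n in simp)
      thus ?thesis by (simp add: algebra_simps)
    qed
    thus ?thesis using y1 by (simp add: field_simps)
  qed
  also have "\<dots> \<le> 7"
  proof -
    have "exp 1.91 * 1.09 \<le> exp 1.91 * exp (0.09::real)" using exp_ge_add_one_self[of "0.09::real"] by (intro mult_left_mono) auto
    also have "\<dots> = exp 1 * exp (1::real)" by (simp flip: exp_add)
    also have "\<dots> \<le> 2.72 * 2.72" using e_less_272 by (intro mult_mono) auto
    finally show ?thesis by simp
  qed
  finally have "1 / (1 - y) ^ (n + 1) \<le> 7" by (simp add: power_divide)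
  moreover have "(1 - y) ^ (n + 1) > 0" using y1 by simp
  ultimately show "(1 - 4 * \<eta> / 5) ^ (n + 1) \<ge> 1 / 7" by (simp add: y_def field_simps)
qed

section \<open>Moments of a density with Lipschitz square roots\<close>

lemma ennreal_add_mult: "0 \<le> a \<Longrightarrow> 0 \<le> c \<Longrightarrow> 0 \<le> d \<Longrightarrow> ennreal (a + c * d) = ennreal a + ennreal c * ennreal d"
  by (simp add: ennreal_mult)

text \<open>With the nonnegative excess H, the identity |x|^p F + V (R^p - |x|^p)_+ = H + R^p F
  holds pointwise. After integration the second and the last term are explicit, and H is bounded
  from below on each ray. The identity stays additive because the integrals take values in
  \<open>ennreal\<close>.\<close>

lemma moment_lower_bound:
  fixes F :: "'a::euclidean_space \<Rightarrow> real"
  assumes p: "p = 2 \<or> p = (4::nat)"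
    and [measurable]: "F \<in> borel_measurable borel"
    and F: "\<And>x. 0 \<le> F x" "\<And>x. F x \<le> V" and V: "V > 0" and K: "K > 0"
    and lip: "\<And>x y. \<bar>sqrt (F x) - sqrt (F y)\<bar> \<le> K * norm (x - y)"
    and lip': "\<And>x y. \<bar>sqrt (V - F x) - sqrt (V - F y)\<bar> \<le> K * norm (x - y)"
    and h: "h = sqrt V / (2 * K)" "2 * h \<le> R" "(1 - 4 * h / (5 * R)) ^ (DIM('a) + 1) \<ge> 1 / 7"
    and total: "ennreal (V * ball_volume TYPE('a) * R ^ DIM('a)) = (\<integral>\<^sup>+x. ennreal (F x) \<partial>lborel)"
  shows "ennreal (V * ball_volume TYPE('a) * R ^ DIM('a) *
      (DIM('a) / (DIM('a) + p) * R ^ p + DIM('a) * p / 24 * h\<^sup>2 * R ^ (p - 2)))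
    \<le> (\<integral>\<^sup>+x. ennreal (norm x ^ p * F x) \<partial>lborel)"
proof -
  let ?n = "DIM('a)" and ?\<omega> = "ball_volume TYPE('a)"
  have h0: "h > 0" using h(1) V K by simp
  have R: "R > 0" using h0 h(2) by linarith
  define H where "H x = (if norm x < R then (R ^ p - norm x ^ p) * (V - F x) else (norm x ^ p - R ^ p) * F x)" for x
  have H_meas[measurable]: "H \<in> borel_measurable borel" unfolding H_def by measurable
  have H0: "H x \<ge> 0" for x
    using F[of x] R by (auto simp: H_def intro!: mult_nonneg_nonneg power_mono)
  have ray: "ennreal (V * (p * h\<^sup>2 * R ^ (?n + p - 2) / 24)) \<le> radial_integral (\<lambda>x. ennreal (H x)) \<theta>" if \<theta>: "norm \<theta> = 1" for \<theta> :: 'a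
  proof -
    \<comment> \<open>Division by V normalizes the range to [0, 1] and the Lipschitz constant of the
      square roots to K / \<surd>V = 1 / (2 h).\<close>
    define f where "f r = F (r *\<^sub>R \<theta>) / V" for r
    have f: "0 \<le> f r \<and> f r \<le> 1" for r using F V by (simp add: f_def)
    have nd: "norm (r *\<^sub>R \<theta> - R *\<^sub>R \<theta>) = \<bar>r - R\<bar>" for r
      using \<theta> by (simp flip: scaleR_left_diff_distrib)
    have div: "\<bar>sqrt (x / V) - sqrt (y / V)\<bar> \<le> \<bar>r - R\<bar> / (2 * h)" if "\<bar>sqrt x - sqrt y\<bar> \<le> K * \<bar>r - R\<bar>" for x y r
    proof -
      have "sqrt (x / V) - sqrt (y / V) = (sqrt x - sqrt y) / sqrt V" by (simp add: real_sqrt_divide diff_divide_distrib)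
      hence "\<bar>sqrt (x / V) - sqrt (y / V)\<bar> = \<bar>sqrt x - sqrt y\<bar> / sqrt V" using V by (simp add: abs_divide)
      also have "\<dots> \<le> (K * \<bar>r - R\<bar>) / sqrt V" using that V by (intro divide_right_mono) auto
      also have "\<dots> = \<bar>r - R\<bar> / (2 * h)" using K V by (simp add: h(1))
      finally show ?thesis .
    qed
    have l1: "\<bar>sqrt (f r) - sqrt (f R)\<bar> \<le> \<bar>r - R\<bar> / (2 * h)" for r
      unfolding f_def using lip[of "r *\<^sub>R \<theta>" "R *\<^sub>R \<theta>"] by (intro div) (simp only: nd)
    have l2: "\<bar>sqrt (1 - f r) - sqrt (1 - f R)\<bar> \<le> \<bar>r - R\<bar> / (2 * h)" for r
    proof -
      have e: "1 - f r = (V - F (r *\<^sub>R \<theta>)) / V" for r using V by (simp add: f_def field_simps)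
      show ?thesis unfolding e using lip'[of "r *\<^sub>R \<theta>" "R *\<^sub>R \<theta>"] by (intro div) (simp only: nd)
    qed
    let ?J = "\<lambda>r. ennreal (r ^ (?n - 1)) * indicator {0<..} r *
       ennreal (if r < R then (R ^ p - r ^ p) * (1 - f r) else (r ^ p - R ^ p) * f r)"
    have "ennreal V * ennreal (p * h\<^sup>2 * R ^ (?n + p - 2) / 24) \<le> ennreal V * (\<integral>\<^sup>+r. ?J r \<partial>lborel)"
      by (intro mult_left_mono ray_inequality[OF p _ h0 h(2,3) f l1 l2]) (auto simp: Suc_leI)
    also have "\<dots> = (\<integral>\<^sup>+r. ennreal V * ?J r \<partial>lborel)"
      unfolding f_def by (rule nn_integral_cmult[symmetric]) measurable
    also have "\<dots> = radial_integral (\<lambda>x. ennreal (H x)) \<theta>"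
      unfolding radial_integral_def
    proof (intro nn_integral_cong)
      fix r :: real
      have e: "V * (if r < R then (R ^ p - r ^ p) * (1 - f r) else (r ^ p - R ^ p) * f r) = H (r *\<^sub>R \<theta>)" if "r > 0"
        using that \<theta> V by (simp add: H_def f_def field_simps)
      show "ennreal V * ?J r = ennreal (r ^ (?n - 1)) * indicator {0<..} r * ennreal (H (r *\<^sub>R \<theta>))"
      proof (cases "r > 0")
        case True
        have "ennreal V * ennreal (if r < R then (R ^ p - r ^ p) * (1 - f r) else (r ^ p - R ^ p) * f r) = ennreal (H (r *\<^sub>R \<theta>))"
          unfolding e[OF True, symmetric] using V by (intro ennreal_mult'[symmetric]) simp
        thus ?thesis by (simp only: mult.left_commute[of "ennreal V"])
      qed simp
    qed
    finally show ?thesis unfolding ennreal_mult'[OF less_imp_le[OF V]] .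
  qed
  have 1: "ennreal (?n * ?\<omega>) * ennreal (V * (p * h\<^sup>2 * R ^ (?n + p - 2) / 24)) \<le> (\<integral>\<^sup>+x. ennreal (H x) \<partial>lborel)"
    by (rule nn_integral_ray_lower_bound[OF _ ray]) measurable
  let ?D = "\<lambda>x::'a. ennreal (R ^ p - norm x ^ p) * indicator {..<R} (norm x)"
  have p0: "p > 0" using p by auto
  have 2: "(\<integral>\<^sup>+x. ennreal V * ?D x \<partial>lborel) = ennreal V * ennreal (?\<omega> * R ^ (?n + p) * p / (?n + p))"
    using nn_integral_ball_deficit[OF R p0, where 'a='a] by (subst nn_integral_cmult) auto
  have 3: "ennreal (norm x ^ p * F x) + ennreal V * ?D x = ennreal (H x) + ennreal (R ^ p) * ennreal (F x)" for x
  proof (cases "norm x < R")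
    case True
    have "R ^ p - norm x ^ p \<ge> 0" using True by (simp add: power_mono)
    hence "ennreal (norm x ^ p * F x) + ennreal V * ?D x = ennreal (norm x ^ p * F x + V * (R ^ p - norm x ^ p))"
      using True F[of x] V by (simp add: ennreal_mult'[symmetric] ennreal_plus[symmetric] del: ennreal_plus)
    also have "norm x ^ p * F x + V * (R ^ p - norm x ^ p) = H x + R ^ p * F x"
      using True by (simp add: H_def algebra_simps)
    also have "ennreal \<dots> = ennreal (H x) + ennreal (R ^ p) * ennreal (F x)"
      using H0[of x] F[of x] R by (simp add: ennreal_mult' ennreal_plus)
    finally show ?thesis .
  next
    case False
    have "norm x ^ p * F x = H x + R ^ p * F x" using False by (simp add: H_def algebra_simps)
    thus ?thesis using False H0[of x] F[of x] R by (simp add: ennreal_mult' ennreal_plus)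
  qed
  have "(\<integral>\<^sup>+x. ennreal (norm x ^ p * F x) \<partial>lborel) + (\<integral>\<^sup>+x. ennreal V * ?D x \<partial>lborel)
     = (\<integral>\<^sup>+x. ennreal (norm x ^ p * F x) + ennreal V * ?D x \<partial>lborel)"
    by (rule nn_integral_add[symmetric]) measurable
  also have "\<dots> = (\<integral>\<^sup>+x. ennreal (H x) \<partial>lborel) + (\<integral>\<^sup>+x. ennreal (R ^ p) * ennreal (F x) \<partial>lborel)"
    unfolding 3 by (rule nn_integral_add) measurable
  also have "(\<integral>\<^sup>+x. ennreal (R ^ p) * ennreal (F x) \<partial>lborel) = ennreal (R ^ p) * ennreal (V * ?\<omega> * R ^ ?n)"
    unfolding total by (rule nn_integral_cmult) measurable
  finally have 4: "(\<integral>\<^sup>+x. ennreal (norm x ^ p * F x) \<partial>lborel) + ennreal V * ennreal (?\<omega> * R ^ (?n + p) * p / (?n + p))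
     = (\<integral>\<^sup>+x. ennreal (H x) \<partial>lborel) + ennreal (R ^ p) * ennreal (V * ?\<omega> * R ^ ?n)" unfolding 2 .
  show ?thesis
  \<comment> \<open>An infinite moment leaves nothing to prove; a finite one permits the passage to
    the reals, where the deficit can be subtracted.\<close>
  proof (cases "(\<integral>\<^sup>+x. ennreal (norm x ^ p * F x) \<partial>lborel)")
    case top
    thus ?thesis by simp
  next
    case (real X)
    have \<omega>0: "?\<omega> \<ge> 0" by simp
    have "ennreal (?n * ?\<omega> * (V * (p * h\<^sup>2 * R ^ (?n + p - 2) / 24)) + R ^ p * (V * ?\<omega> * R ^ ?n))
      = ennreal (?n * ?\<omega>) * ennreal (V * (p * h\<^sup>2 * R ^ (?n + p - 2) / 24)) + ennreal (R ^ p) * ennreal (V * ?\<omega> * R ^ ?n)"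
    proof -
      have z: "0 \<le> ?n * ?\<omega>" "0 \<le> V * (p * h\<^sup>2 * R ^ (?n + p - 2) / 24)" "0 \<le> R ^ p" "0 \<le> V * ?\<omega> * R ^ ?n"
        using V R by simp_all
      show ?thesis unfolding ennreal_add_mult[OF mult_nonneg_nonneg[OF z(1,2)] z(3,4)] ennreal_mult'[OF z(1)] ..
    qed
    also have "\<dots> \<le> ennreal X + ennreal V * ennreal (?\<omega> * R ^ (?n + p) * p / (?n + p))"
      using add_right_mono[OF 1] 4 real(2) by simp
    also have "\<dots> = ennreal (X + V * (?\<omega> * R ^ (?n + p) * p / (?n + p)))"
      using real(1) V R by (intro ennreal_add_mult[symmetric]) auto
    finally have le: "?n * ?\<omega> * (V * (p * h\<^sup>2 * R ^ (?n + p - 2) / 24)) + R ^ p * (V * ?\<omega> * R ^ ?n)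
       \<le> X + V * (?\<omega> * R ^ (?n + p) * p / (?n + p))"
      using real(1) V R \<omega>0 by (subst (asm) ennreal_le_iff) auto
    have e: "R ^ (?n + p - 2) = R ^ ?n * R ^ (p - 2)" using p by (auto simp flip: power_add)
    have q: "?n * ?\<omega> * (V * (p * h\<^sup>2 * R ^ (?n + p - 2) / 24)) + R ^ p * (V * ?\<omega> * R ^ ?n) - V * (?\<omega> * R ^ (?n + p) * p / (?n + p))
       = V * ?\<omega> * R ^ ?n * (?n / (?n + p) * R ^ p + ?n * p / 24 * h\<^sup>2 * R ^ (p - 2))"
    proof -
      define W where "W = V * ?\<omega> * R ^ ?n"
      have "R ^ p * W - W * R ^ p * p / (?n + p) = W * (?n / (?n + p) * R ^ p)"
        using p0 by (simp add: field_simps)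
      thus ?thesis unfolding e by (simp add: W_def power_add algebra_simps)
    qed
    show ?thesis unfolding real(2) using le q by (intro ennreal_leI) linarith
  qed
qed

section \<open>The moment of inertia\<close>

lemma nn_integral_lebesgue_on_open:
  fixes f :: "real ^ 'n \<Rightarrow> real"
  assumes "open \<Omega>" and [measurable]: "f \<in> borel_measurable borel"
  shows "(\<integral>\<^sup>+x. ennreal (f x) \<partial>lebesgue_on \<Omega>) = (\<integral>\<^sup>+x. indicator \<Omega> x * ennreal (f x) \<partial>lborel)"
proof -
  have \<Omega>: "\<Omega> \<in> sets borel" using assms(1) by simp
  have "(\<integral>\<^sup>+x. ennreal (f x) \<partial>lebesgue_on \<Omega>) = (\<integral>\<^sup>+x. ennreal (f x) * indicator \<Omega> x \<partial>lebesgue)"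
    using assms by (intro nn_integral_restrict_space) auto
  also have "\<dots> = (\<integral>\<^sup>+x. ennreal (f x) * indicator \<Omega> x \<partial>lborel)"
    by (rule nn_integral_completion)
  finally show ?thesis by (simp add: mult.commute)
qed

text \<open>A bathtub argument about an arbitrary centre c: on \<Omega>, \<rho>^2 is at most |x -
  c|^2 plus the positive part of \<rho>^2 - |x - c|^2. Over the whole space this positive part
  integrates to the deficit of a ball with the volume of \<Omega>.\<close>

lemma second_moment_lower_bound:
  fixes \<Omega> :: "(real ^ 'n) set"
  assumes \<Omega>: "bounded \<Omega>" "open \<Omega>" and \<rho>: "\<rho> > 0" "volume \<Omega> = ball_volume TYPE(real ^ 'n) * \<rho> ^ CARD('n)"
  shows "CARD('n) / (CARD('n) + 2) * volume \<Omega> * \<rho>\<^sup>2 \<le> (LINT x|lebesgue_on \<Omega>. (norm (x - c))\<^sup>2)"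
proof -
  let ?n = "CARD('n)" and ?\<omega> = "ball_volume TYPE(real ^ 'n)"
  let ?J = "LINT x|lebesgue_on \<Omega>. (norm (x - c))\<^sup>2"
  have [measurable]: "\<Omega> \<in> sets borel" using \<Omega> by simp
  have "integrable (lebesgue_on \<Omega>) (\<lambda>x. (norm (x - c))\<^sup>2)"
  proof -
    have "(\<lambda>x. norm (x - c)) \<in> L2 \<Omega>" by (intro L2_continuous \<Omega> continuous_intros)
    from L2_square_integrable[OF this] show ?thesis .
  qed
  hence "ennreal ?J = (\<integral>\<^sup>+x. ennreal ((norm (x - c))\<^sup>2) \<partial>lebesgue_on \<Omega>)"
    by (intro nn_integral_eq_integral[symmetric]) auto
  also have "\<dots> = (\<integral>\<^sup>+x. indicator \<Omega> x * ennreal ((norm (x - c))\<^sup>2) \<partial>lborel)"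
    using \<Omega> by (intro nn_integral_lebesgue_on_open) auto
  finally have J: "ennreal ?J = (\<integral>\<^sup>+x. indicator \<Omega> x * ennreal ((norm (x - c))\<^sup>2) \<partial>lborel)" .
  have vol: "emeasure lborel \<Omega> = ennreal (volume \<Omega>)"
    unfolding volume_def using emeasure_bounded_finite[OF \<Omega>(1)]
    by (subst measure_completion) (auto intro!: emeasure_eq_ennreal_measure)
  let ?D = "\<lambda>x::real ^ 'n. ennreal (\<rho>\<^sup>2 - (norm x)\<^sup>2) * indicator {..<\<rho>} (norm x)"
  have "ennreal (\<rho>\<^sup>2) * ennreal (volume \<Omega>) = (\<integral>\<^sup>+x. ennreal (\<rho>\<^sup>2) * indicator \<Omega> x \<partial>lborel)"
    by (simp add: nn_integral_cmult vol)
  also have "\<dots> \<le> (\<integral>\<^sup>+x. indicator \<Omega> x * ennreal ((norm (x - c))\<^sup>2) + ?D (x - c) \<partial>lborel)"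
  proof (intro nn_integral_mono)
    fix x
    show "ennreal (\<rho>\<^sup>2) * indicator \<Omega> x \<le> indicator \<Omega> x * ennreal ((norm (x - c))\<^sup>2) + ?D (x - c)"
    proof (cases "x \<in> \<Omega>")
      case True
      show ?thesis
      proof (cases "norm (x - c) < \<rho>")
        case t: True
        have "(norm (x - c))\<^sup>2 \<le> \<rho>\<^sup>2" using t by (intro power_mono) auto
        thus ?thesis using True t by (simp add: ennreal_plus[symmetric] del: ennreal_plus)
      next
        case False
        have "\<rho>\<^sup>2 \<le> (norm (x - c))\<^sup>2" using False \<rho> by (intro power_mono) auto
        thus ?thesis using True False by (simp add: ennreal_leI)
      qed
    qed simp
  qed
  also have "\<dots> = ennreal ?J + (\<integral>\<^sup>+x. ?D (x - c) \<partial>lborel)"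
    unfolding J by (rule nn_integral_add) measurable
  also have "(\<integral>\<^sup>+x. ?D (x - c) \<partial>lborel) = (\<integral>\<^sup>+x. ?D x \<partial>lborel)"
    by (rule nn_integral_lborel_translate) measurable
  also have "\<dots> = ennreal (?\<omega> * \<rho> ^ (?n + 2) * 2 / (?n + 2))"
    using nn_integral_ball_deficit[OF \<rho>(1), of 2, where 'a="real ^ 'n"] by simp
  finally have "ennreal (\<rho>\<^sup>2 * volume \<Omega>) \<le> ennreal (?J + ?\<omega> * \<rho> ^ (?n + 2) * 2 / (?n + 2))"
    using \<rho> by (simp add: ennreal_mult' ennreal_plus)
  hence "\<rho>\<^sup>2 * volume \<Omega> \<le> ?J + ?\<omega> * \<rho> ^ (?n + 2) * 2 / (?n + 2)"
    using \<rho> by (subst (asm) ennreal_le_iff) (auto intro!: add_nonneg_nonneg)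
  also have "?\<omega> * \<rho> ^ (?n + 2) * 2 / (?n + 2) = \<rho>\<^sup>2 * volume \<Omega> * (2 / (?n + 2))"
    by (simp add: \<rho>(2) power_add power2_eq_square)
  finally have "\<rho>\<^sup>2 * volume \<Omega> - \<rho>\<^sup>2 * volume \<Omega> * (2 / (?n + 2)) \<le> ?J" by linarith
  moreover have "\<rho>\<^sup>2 * volume \<Omega> - \<rho>\<^sup>2 * volume \<Omega> * (2 / (?n + 2)) = ?n / (?n + 2) * volume \<Omega> * \<rho>\<^sup>2"
    by (simp add: field_simps)
  ultimately show ?thesis by simp
qed

section \<open>Bessel inequality and Lipschitz bounds\<close>

abbreviation ip :: "(real ^ 'n) set \<Rightarrow> (real ^ 'n \<Rightarrow> real) \<Rightarrow> (real ^ 'n \<Rightarrow> real) \<Rightarrow> real" where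
  "ip \<Omega> u v \<equiv> LINT x|lebesgue_on \<Omega>. u x * v x"

lemma ip_commute: "ip \<Omega> u v = ip \<Omega> v u"
  by (simp add: mult.commute)

lemma ip_combination:
  assumes "u \<in> L2 \<Omega>" "f \<in> L2 \<Omega>" "g \<in> L2 \<Omega>"
  shows "ip \<Omega> u (\<lambda>x. s * f x + t * g x) = s * ip \<Omega> u f + t * ip \<Omega> u g"
proof -
  have "ip \<Omega> u (\<lambda>x. s * f x + t * g x) = (LINT x|lebesgue_on \<Omega>. s * (u x * f x) + t * (u x * g x))"
    by (simp add: algebra_simps)
  also have "\<dots> = s * ip \<Omega> u f + t * ip \<Omega> u g"
    using L2_mult_integrable[OF assms(1,2)] L2_mult_integrable[OF assms(1,3)] by simp
  finally show ?thesis .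
qed

lemma ip_combination_self:
  assumes "f \<in> L2 \<Omega>" "g \<in> L2 \<Omega>"
  shows "ip \<Omega> (\<lambda>x. s * f x + t * g x) (\<lambda>x. s * f x + t * g x)
    = s\<^sup>2 * ip \<Omega> f f + 2 * s * t * ip \<Omega> f g + t\<^sup>2 * ip \<Omega> g g"
proof -
  have m: "(\<lambda>x. s * f x + t * g x) \<in> L2 \<Omega>" using assms by (intro L2_add L2_scale)
  let ?m = "\<lambda>x. s * f x + t * g x"
  have 1: "ip \<Omega> ?m ?m = s * ip \<Omega> ?m f + t * ip \<Omega> ?m g" by (rule ip_combination[OF m assms])
  have 2: "ip \<Omega> ?m f = s * ip \<Omega> f f + t * ip \<Omega> f g"
    unfolding ip_commute[of \<Omega> ?m f] by (rule ip_combination[OF assms(1) assms])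
  have 3: "ip \<Omega> ?m g = s * ip \<Omega> f g + t * ip \<Omega> g g"
    unfolding ip_commute[of \<Omega> ?m g] ip_commute[of \<Omega> f g] by (rule ip_combination[OF assms(2) assms])
  show ?thesis unfolding 1 2 3 by (simp add: power2_eq_square algebra_simps)
qed

lemma bessel_inequality:
  fixes u :: "'i \<Rightarrow> real ^ 'n \<Rightarrow> real"
  assumes A: "finite A" and u: "\<And>i. i \<in> A \<Longrightarrow> u i \<in> L2 \<Omega>" and g: "g \<in> L2 \<Omega>"
    and on: "\<And>i j. i \<in> A \<Longrightarrow> j \<in> A \<Longrightarrow> ip \<Omega> (u i) (u j) = (if i = j then 1 else 0)"
  shows "(\<Sum>i\<in>A. (ip \<Omega> (u i) g)\<^sup>2) \<le> ip \<Omega> g g"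
proof -
  let ?P = "\<lambda>x. \<Sum>i\<in>A. ip \<Omega> (u i) g * u i x"
  have P: "?P \<in> L2 \<Omega>" using A u by (intro L2_sum L2_scale)
  have uP: "ip \<Omega> v ?P = (\<Sum>i\<in>A. ip \<Omega> (u i) g * ip \<Omega> v (u i))" if "v \<in> L2 \<Omega>" for v
  proof -
    have "ip \<Omega> v ?P = (LINT x|lebesgue_on \<Omega>. (\<Sum>i\<in>A. ip \<Omega> (u i) g * (v x * u i x)))"
      by (simp add: sum_distrib_left mult_ac)
    also have "\<dots> = (\<Sum>i\<in>A. ip \<Omega> (u i) g * ip \<Omega> v (u i))"
      using that u by (subst Bochner_Integration.integral_sum) (auto intro!: L2_mult_integrable)
    finally show ?thesis .
  qed
  have "ip \<Omega> g ?P = (\<Sum>i\<in>A. (ip \<Omega> (u i) g)\<^sup>2)"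
    unfolding uP[OF g] by (simp add: power2_eq_square ip_commute[of \<Omega> g])
  moreover have "ip \<Omega> ?P ?P = (\<Sum>i\<in>A. (ip \<Omega> (u i) g)\<^sup>2)"
  proof -
    have "ip \<Omega> ?P (u i) = ip \<Omega> (u i) g" if i: "i \<in> A" for i
    proof -
      have "ip \<Omega> ?P (u i) = (\<Sum>j\<in>A. ip \<Omega> (u j) g * ip \<Omega> (u i) (u j))" by (simp only: ip_commute[of \<Omega> ?P] uP[OF u[OF i]])
      also have "\<dots> = (\<Sum>j\<in>A. if i = j then ip \<Omega> (u j) g else 0)" using on i by (intro sum.cong) auto
      finally show ?thesis using A i by simp
    qed
    thus ?thesis unfolding uP[OF P] by (simp add: power2_eq_square)
  qed
  moreover have "0 \<le> ip \<Omega> (\<lambda>x. 1 * g x + (-1) * ?P x) (\<lambda>x. 1 * g x + (-1) * ?P x)" by simp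
  ultimately show ?thesis unfolding ip_combination_self[OF g P] by simp
qed

text \<open>Minkowski's inequality for two vectors of a semidefinite form, in terms of the three
  coefficients alone. It thus applies to pairs of cosine and sine parts without a vector space of
  such pairs.\<close>

lemma psd_triangle:
  fixes A B C :: real
  assumes "\<And>s t. 0 \<le> s\<^sup>2 * A + 2 * s * t * B + t\<^sup>2 * C"
  shows "sqrt (A + 2 * B + C) \<le> sqrt A + sqrt C"
proof -
  have AC: "0 \<le> A" "0 \<le> C" using assms[of 1 0] assms[of 0 1] by simp_all
  have "B\<^sup>2 \<le> A * C" by (rule psd_form_cauchy_schwarz[OF assms])
  hence "\<bar>B\<bar> \<le> sqrt (A * C)" by (simp add: real_le_rsqrt)
  hence "A + 2 * B + C \<le> (sqrt A + sqrt C)\<^sup>2" using AC by (simp add: power2_sum real_sqrt_mult)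
  hence "sqrt (A + 2 * B + C) \<le> sqrt ((sqrt A + sqrt C)\<^sup>2)" by (rule real_sqrt_le_mono)
  thus ?thesis using AC by simp
qed

text \<open>
  A bounded positive semidefinite form \<open>Q\<close> on \<open>L\<^sup>2\<close> changes slowly along the plane waves
  \<open>exp (i \<xi> \<bullet> (x - c))\<close>, represented by their real and imaginary parts.
\<close>

lemma wave_form_lipschitz:
  fixes \<Omega> :: "(real ^ 'n) set" and c :: "real ^ 'n"
  assumes \<Omega>: "bounded \<Omega>" "open \<Omega>"
    and Q: "\<And>s t f g. f \<in> L2 \<Omega> \<Longrightarrow> g \<in> L2 \<Omega> \<Longrightarrow> Q (\<lambda>x. s * f x + t * g x) = s\<^sup>2 * Q f + 2 * s * t * B f g + t\<^sup>2 * Q g"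
    and Q0: "\<And>f. f \<in> L2 \<Omega> \<Longrightarrow> 0 \<le> Q f" and Q1: "\<And>f. f \<in> L2 \<Omega> \<Longrightarrow> Q f \<le> ip \<Omega> f f"
  defines "N \<equiv> \<lambda>\<xi>. sqrt (Q (\<lambda>x. cos (\<xi> \<bullet> (x - c))) + Q (\<lambda>x. sin (\<xi> \<bullet> (x - c))))"
  shows "N \<eta> \<le> N \<xi> + norm (\<eta> - \<xi>) * sqrt (LINT x|lebesgue_on \<Omega>. (norm (x - c))\<^sup>2)"
proof -
  let ?a1 = "\<lambda>x. cos (\<xi> \<bullet> (x - c))" and ?a2 = "\<lambda>x. sin (\<xi> \<bullet> (x - c))"
  let ?b1 = "\<lambda>x. cos (\<eta> \<bullet> (x - c))" and ?b2 = "\<lambda>x. sin (\<eta> \<bullet> (x - c))"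
  let ?d1 = "\<lambda>x. ?b1 x - ?a1 x" and ?d2 = "\<lambda>x. ?b2 x - ?a2 x"
  have L: "?a1 \<in> L2 \<Omega>" "?a2 \<in> L2 \<Omega>" "?d1 \<in> L2 \<Omega>" "?d2 \<in> L2 \<Omega>"
    by (intro L2_continuous \<Omega> continuous_intros)+
  define A where "A = Q ?a1 + Q ?a2"
  define C where "C = Q ?d1 + Q ?d2"
  define D where "D = B ?a1 ?d1 + B ?a2 ?d2"
  have psd: "0 \<le> s\<^sup>2 * A + 2 * s * t * D + t\<^sup>2 * C" for s t
  proof -
    have "0 \<le> Q (\<lambda>x. s * ?a1 x + t * ?d1 x) + Q (\<lambda>x. s * ?a2 x + t * ?d2 x)"
      using L by (intro add_nonneg_nonneg Q0 L2_add L2_scale)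
    thus ?thesis unfolding Q[OF L(1,3)] Q[OF L(2,4)] by (simp add: A_def C_def D_def algebra_simps)
  qed
  have "Q ?b1 + Q ?b2 = A + 2 * D + C"
    using Q[OF L(1,3), of 1 1] Q[OF L(2,4), of 1 1] by (simp add: A_def C_def D_def)
  hence "N \<eta> \<le> N \<xi> + sqrt C"
    using psd_triangle[OF psd] by (simp add: N_def A_def)
  moreover have "sqrt C \<le> norm (\<eta> - \<xi>) * sqrt (LINT x|lebesgue_on \<Omega>. (norm (x - c))\<^sup>2)"
  proof -
    \<comment> \<open>In real terms, |exp (i \<alpha>) - exp (i \<beta>)|^2 = 4 (sin ((\<alpha> -
      \<beta>) / 2))^2 \<le> (\<alpha> - \<beta>)^2, followed by Cauchy-Schwarz for the difference
      of the phases.\<close>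
    have pt: "?d1 x * ?d1 x + ?d2 x * ?d2 x \<le> (norm (\<eta> - \<xi>))\<^sup>2 * (norm (x - c))\<^sup>2" for x
    proof -
      define t where "t = (\<eta> - \<xi>) \<bullet> (x - c)"
      have "?d1 x * ?d1 x + ?d2 x * ?d2 x
        = ((cos (\<eta> \<bullet> (x - c)))\<^sup>2 + (sin (\<eta> \<bullet> (x - c)))\<^sup>2) + ((cos (\<xi> \<bullet> (x - c)))\<^sup>2 + (sin (\<xi> \<bullet> (x - c)))\<^sup>2) - 2 * cos (\<eta> \<bullet> (x - c) - \<xi> \<bullet> (x - c))"
        unfolding cos_diff by (simp add: power2_eq_square algebra_simps)
      also have "\<dots> = 2 - 2 * cos t" unfolding sin_cos_squared_add2 by (simp add: t_def inner_diff_left)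
      also have "\<dots> = 4 * (sin (t / 2))\<^sup>2" using cos_double_sin[of "t / 2"] by simp
      also have "\<dots> \<le> 4 * (t / 2)\<^sup>2" using abs_sin_x_le_abs_x[of "t / 2"] by (simp only: abs_le_square_iff)
      also have "\<dots> = t\<^sup>2" by (simp add: power_divide)
      also have "\<dots> \<le> (norm (\<eta> - \<xi>))\<^sup>2 * (norm (x - c))\<^sup>2"
        unfolding t_def power_mult_distrib[symmetric] using Cauchy_Schwarz_ineq2[of "\<eta> - \<xi>" "x - c"]
        by (intro abs_le_square_iff[THEN iffD1]) simp
      finally show ?thesis .
    qed
    have i: "integrable (lebesgue_on \<Omega>) (\<lambda>x. (norm (x - c))\<^sup>2)"
      by (intro L2_square_integrable L2_continuous \<Omega> continuous_intros)
    have "C \<le> ip \<Omega> ?d1 ?d1 + ip \<Omega> ?d2 ?d2" unfolding C_def using Q1 L by (intro add_mono) auto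
    also have "\<dots> = (LINT x|lebesgue_on \<Omega>. ?d1 x * ?d1 x + ?d2 x * ?d2 x)"
      using L by (intro Bochner_Integration.integral_add[symmetric] L2_mult_integrable)
    also have "\<dots> \<le> (LINT x|lebesgue_on \<Omega>. (norm (\<eta> - \<xi>))\<^sup>2 * (norm (x - c))\<^sup>2)"
    proof (rule integral_mono)
      show "integrable (lebesgue_on \<Omega>) (\<lambda>x. ?d1 x * ?d1 x + ?d2 x * ?d2 x)"
        using L by (intro Bochner_Integration.integrable_add L2_mult_integrable)
      show "integrable (lebesgue_on \<Omega>) (\<lambda>x. (norm (\<eta> - \<xi>))\<^sup>2 * (norm (x - c))\<^sup>2)"
        using i by simp
    qed (rule pt)
    also have "\<dots> = (norm (\<eta> - \<xi>))\<^sup>2 * (LINT x|lebesgue_on \<Omega>. (norm (x - c))\<^sup>2)" by simp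
    finally have "sqrt C \<le> sqrt ((norm (\<eta> - \<xi>))\<^sup>2 * (LINT x|lebesgue_on \<Omega>. (norm (x - c))\<^sup>2))"
      by (rule real_sqrt_le_mono)
    thus ?thesis by (simp add: real_sqrt_mult)
  qed
  ultimately show ?thesis by linarith
qed

lemma moment_of_inertia_greatest:
  fixes \<Omega> :: "(real ^ 'n) set"
  assumes "\<And>c. y \<le> (LINT x|lebesgue_on \<Omega>. (norm (x - c))\<^sup>2)"
  shows "y \<le> moment_of_inertia \<Omega>"
  unfolding moment_of_inertia_def by (rule cINF_greatest) (use assms in auto)

text \<open>Estimates valid for every centre c pass to the infimum, whether or not it is attained.
  The cases d = 0 and y \<le> 0 are split off so that dividing and squaring are harmless.\<close>

lemma moment_of_inertia_sqrt:
  fixes \<Omega> :: "(real ^ 'n) set"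
  assumes "\<And>c. y \<le> d * sqrt (LINT x|lebesgue_on \<Omega>. (norm (x - c))\<^sup>2)" "d \<ge> 0"
  shows "y \<le> d * sqrt (moment_of_inertia \<Omega>)"
proof (cases "d = 0 \<or> y \<le> 0")
  case True
  have "0 \<le> moment_of_inertia \<Omega>" by (rule moment_of_inertia_greatest) simp
  thus ?thesis using True assms by (auto intro: order_trans[of y 0])
next
  case False
  hence d: "d > 0" and y: "y > 0" using assms(2) by auto
  have "(y / d)\<^sup>2 \<le> moment_of_inertia \<Omega>"
  proof (rule moment_of_inertia_greatest)
    fix c
    have "y / d \<le> sqrt (LINT x|lebesgue_on \<Omega>. (norm (x - c))\<^sup>2)" using assms(1)[of c] d by (simp add: field_simps)
    hence "(y / d)\<^sup>2 \<le> (sqrt (LINT x|lebesgue_on \<Omega>. (norm (x - c))\<^sup>2))\<^sup>2" using y d by (intro power_mono) auto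
    thus "(y / d)\<^sup>2 \<le> (LINT x|lebesgue_on \<Omega>. (norm (x - c))\<^sup>2)" by simp
  qed
  hence "y / d \<le> sqrt (moment_of_inertia \<Omega>)" by (rule real_le_rsqrt)
  thus ?thesis using d by (simp add: field_simps)
qed

section \<open>Spectral density of an orthonormal family\<close>

locale orthonormal_family =
  fixes \<Omega> :: "(real ^ 'n) set" and A :: "'i set" and u :: "'i \<Rightarrow> real ^ 'n \<Rightarrow> real"
  assumes \<Omega>: "bounded \<Omega>" "open \<Omega>" and A: "finite A" and u: "\<And>i. i \<in> A \<Longrightarrow> u i \<in> L2 \<Omega>"
    and on: "\<And>i j. i \<in> A \<Longrightarrow> j \<in> A \<Longrightarrow> ip \<Omega> (u i) (u j) = (if i = j then 1 else 0)"
begin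

definition "spectral_density \<xi> = (\<Sum>i\<in>A. (fcos \<Omega> (u i) \<xi>)\<^sup>2 + (fsin \<Omega> (u i) \<xi>)\<^sup>2)"

text \<open>For f in L2, the squared norm of the orthogonal projection of f to the span of the
  family.\<close>

definition "proj f = (\<Sum>i\<in>A. (ip \<Omega> (u i) f)\<^sup>2)"

lemma proj_combination:
  assumes "f \<in> L2 \<Omega>" "g \<in> L2 \<Omega>"
  shows "proj (\<lambda>x. s * f x + t * g x) = s\<^sup>2 * proj f + 2 * s * t * (\<Sum>i\<in>A. ip \<Omega> (u i) f * ip \<Omega> (u i) g) + t\<^sup>2 * proj g"
proof -
  have "proj (\<lambda>x. s * f x + t * g x) = (\<Sum>i\<in>A. (s * ip \<Omega> (u i) f + t * ip \<Omega> (u i) g)\<^sup>2)"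
    unfolding proj_def using ip_combination[OF u assms] by (intro sum.cong) auto
  also have "\<dots> = (\<Sum>i\<in>A. s\<^sup>2 * (ip \<Omega> (u i) f)\<^sup>2 + 2 * s * t * (ip \<Omega> (u i) f * ip \<Omega> (u i) g) + t\<^sup>2 * (ip \<Omega> (u i) g)\<^sup>2)"
    by (intro sum.cong refl) (simp add: power2_sum power_mult_distrib mult_ac)
  finally show ?thesis by (simp add: proj_def sum.distrib sum_distrib_left)
qed

lemma proj_le: "f \<in> L2 \<Omega> \<Longrightarrow> proj f \<le> ip \<Omega> f f"
  unfolding proj_def by (rule bessel_inequality[OF A u _ on])

lemma proj_nonneg: "0 \<le> proj f"
  unfolding proj_def by (intro sum_nonneg) auto

text \<open>Moving the centre multiplies the plane wave by a phase, that is, rotates the pair of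
  cosine and sine. The sum of a quadratic form over the pair is invariant under rotations, so c
  remains free and can be optimized later.\<close>

lemma proj_wave: "proj (\<lambda>x. cos (\<xi> \<bullet> (x - c))) + proj (\<lambda>x. sin (\<xi> \<bullet> (x - c))) = spectral_density \<xi>"
proof -
  note T = trig_L2[OF \<Omega>, of \<xi>]
  have c: "(\<lambda>x. cos (\<xi> \<bullet> (x - c))) = (\<lambda>x. cos (\<xi> \<bullet> c) * cos (\<xi> \<bullet> x) + sin (\<xi> \<bullet> c) * sin (\<xi> \<bullet> x))"
    by (simp add: inner_diff_right cos_diff mult.commute)
  have s: "(\<lambda>x. sin (\<xi> \<bullet> (x - c))) = (\<lambda>x. - sin (\<xi> \<bullet> c) * cos (\<xi> \<bullet> x) + cos (\<xi> \<bullet> c) * sin (\<xi> \<bullet> x))"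
    by (simp add: inner_diff_right sin_diff mult.commute)
  define C where "C = (\<Sum>i\<in>A. (fcos \<Omega> (u i) \<xi>)\<^sup>2)"
  define S where "S = (\<Sum>i\<in>A. (fsin \<Omega> (u i) \<xi>)\<^sup>2)"
  have pc: "proj (\<lambda>x. cos (\<xi> \<bullet> x)) = C" "proj (\<lambda>x. sin (\<xi> \<bullet> x)) = S"
    by (simp_all add: proj_def fcos_def fsin_def C_def S_def)
  have e: "a\<^sup>2 * C + 2 * a * b * X + b\<^sup>2 * S + ((- b)\<^sup>2 * C + 2 * (- b) * a * X + a\<^sup>2 * S) = (b\<^sup>2 + a\<^sup>2) * (C + S)" for a b X
    by (simp add: power2_eq_square algebra_simps)
  show ?thesis
    unfolding c s proj_combination[OF T] pc spectral_density_def sum.distrib C_def[symmetric] S_def[symmetric] e by simp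
qed

lemma wave_norm: "ip \<Omega> (\<lambda>x. cos (\<xi> \<bullet> (x - c))) (\<lambda>x. cos (\<xi> \<bullet> (x - c))) + ip \<Omega> (\<lambda>x. sin (\<xi> \<bullet> (x - c))) (\<lambda>x. sin (\<xi> \<bullet> (x - c))) = volume \<Omega>"
proof -
  have L: "(\<lambda>x. cos (\<xi> \<bullet> (x - c))) \<in> L2 \<Omega>" "(\<lambda>x. sin (\<xi> \<bullet> (x - c))) \<in> L2 \<Omega>"
    by (intro L2_continuous \<Omega> continuous_intros)+
  have "ip \<Omega> (\<lambda>x. cos (\<xi> \<bullet> (x - c))) (\<lambda>x. cos (\<xi> \<bullet> (x - c))) + ip \<Omega> (\<lambda>x. sin (\<xi> \<bullet> (x - c))) (\<lambda>x. sin (\<xi> \<bullet> (x - c)))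
    = (LINT x|lebesgue_on \<Omega>. cos (\<xi> \<bullet> (x - c)) * cos (\<xi> \<bullet> (x - c)) + sin (\<xi> \<bullet> (x - c)) * sin (\<xi> \<bullet> (x - c)))"
    using L by (intro Bochner_Integration.integral_add[symmetric] L2_mult_integrable)
  also have "\<dots> = (LINT x|lebesgue_on \<Omega>. 1)"
    by (simp flip: power2_eq_square)
  also have "\<dots> = volume \<Omega>" using \<Omega> by (simp add: volume_def measure_restrict_space)
  finally show ?thesis .
qed

lemma spectral_density_bounds: "0 \<le> spectral_density \<xi>" "spectral_density \<xi> \<le> volume \<Omega>"
proof -
  show "0 \<le> spectral_density \<xi>" unfolding spectral_density_def by (intro sum_nonneg) auto
  have L: "(\<lambda>x. cos (\<xi> \<bullet> (x - 0))) \<in> L2 \<Omega>" "(\<lambda>x. sin (\<xi> \<bullet> (x - 0))) \<in> L2 \<Omega>"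
    by (intro L2_continuous \<Omega> continuous_intros)+
  have 1: "proj (\<lambda>x. cos (\<xi> \<bullet> (x - 0))) \<le> ip \<Omega> (\<lambda>x. cos (\<xi> \<bullet> (x - 0))) (\<lambda>x. cos (\<xi> \<bullet> (x - 0)))"
    by (rule proj_le[OF L(1)])
  have 2: "proj (\<lambda>x. sin (\<xi> \<bullet> (x - 0))) \<le> ip \<Omega> (\<lambda>x. sin (\<xi> \<bullet> (x - 0))) (\<lambda>x. sin (\<xi> \<bullet> (x - 0)))"
    by (rule proj_le[OF L(2)])
  show "spectral_density \<xi> \<le> volume \<Omega>"
    using 1 2 proj_wave[of \<xi> 0] wave_norm[of \<xi> 0] by linarith
qed

text \<open>\<open>proj\<close> and its complement are semidefinite forms bounded by the squared
  norm, so the estimate for plane waves applies to both, with the second moment about any centre c.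
  The infimum over c brings in the moment of inertia.\<close>

lemma spectral_density_lipschitz:
  "\<bar>sqrt (spectral_density \<xi>) - sqrt (spectral_density \<eta>)\<bar> \<le> sqrt (moment_of_inertia \<Omega>) * norm (\<xi> - \<eta>)"
  "\<bar>sqrt (volume \<Omega> - spectral_density \<xi>) - sqrt (volume \<Omega> - spectral_density \<eta>)\<bar> \<le> sqrt (moment_of_inertia \<Omega>) * norm (\<xi> - \<eta>)"
proof -
  let ?J = "\<lambda>c. LINT x|lebesgue_on \<Omega>. (norm (x - c))\<^sup>2"
  have one: "sqrt (spectral_density \<eta>) \<le> sqrt (spectral_density \<xi>) + norm (\<eta> - \<xi>) * sqrt (?J c)" for \<xi> \<eta> c
  proof -
    have "sqrt (proj (\<lambda>x. cos (\<eta> \<bullet> (x - c))) + proj (\<lambda>x. sin (\<eta> \<bullet> (x - c))))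
      \<le> sqrt (proj (\<lambda>x. cos (\<xi> \<bullet> (x - c))) + proj (\<lambda>x. sin (\<xi> \<bullet> (x - c)))) + norm (\<eta> - \<xi>) * sqrt (?J c)"
      by (rule wave_form_lipschitz[OF \<Omega>, where Q = proj and B = "\<lambda>f g. \<Sum>i\<in>A. ip \<Omega> (u i) f * ip \<Omega> (u i) g"])
         (rule proj_combination proj_nonneg proj_le; assumption)+
    thus ?thesis by (simp only: proj_wave)
  qed
  let ?Q = "\<lambda>f. ip \<Omega> f f - proj f"
  have two: "sqrt (volume \<Omega> - spectral_density \<eta>) \<le> sqrt (volume \<Omega> - spectral_density \<xi>) + norm (\<eta> - \<xi>) * sqrt (?J c)" for \<xi> \<eta> c
  proof -
    have q: "?Q (\<lambda>x. cos (\<xi> \<bullet> (x - c))) + ?Q (\<lambda>x. sin (\<xi> \<bullet> (x - c))) = volume \<Omega> - spectral_density \<xi>" for \<xi>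
      using proj_wave[of \<xi> c] wave_norm[of \<xi> c] by linarith
    have comb: "?Q (\<lambda>x. s * f x + t * g x) = s\<^sup>2 * ?Q f + 2 * s * t * (ip \<Omega> f g - (\<Sum>i\<in>A. ip \<Omega> (u i) f * ip \<Omega> (u i) g)) + t\<^sup>2 * ?Q g"
      if "f \<in> L2 \<Omega>" "g \<in> L2 \<Omega>" for s t f g
      using proj_combination[OF that, of s t] ip_combination_self[OF that, of s t] by (simp add: algebra_simps)
    have "sqrt (?Q (\<lambda>x. cos (\<eta> \<bullet> (x - c))) + ?Q (\<lambda>x. sin (\<eta> \<bullet> (x - c))))
      \<le> sqrt (?Q (\<lambda>x. cos (\<xi> \<bullet> (x - c))) + ?Q (\<lambda>x. sin (\<xi> \<bullet> (x - c)))) + norm (\<eta> - \<xi>) * sqrt (?J c)"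
    proof (rule wave_form_lipschitz[OF \<Omega>, where Q = ?Q and B = "\<lambda>f g. ip \<Omega> f g - (\<Sum>i\<in>A. ip \<Omega> (u i) f * ip \<Omega> (u i) g)"])
      fix f assume f: "f \<in> L2 \<Omega>"
      show "0 \<le> ?Q f" "?Q f \<le> ip \<Omega> f f" using proj_le[OF f] proj_nonneg[of f] by simp_all
    qed (rule comb)
    thus ?thesis by (simp only: q)
  qed
  have m: "y - z \<le> norm (\<eta> - \<xi>) * sqrt (moment_of_inertia \<Omega>)"
    if "\<And>c. y \<le> z + norm (\<eta> - \<xi>) * sqrt (?J c)" for y z and \<xi> \<eta> :: "real ^ 'n"
    using that by (intro moment_of_inertia_sqrt) (auto simp: diff_le_eq add.commute)
  show "\<bar>sqrt (spectral_density \<xi>) - sqrt (spectral_density \<eta>)\<bar> \<le> sqrt (moment_of_inertia \<Omega>) * norm (\<xi> - \<eta>)"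
    using m[OF one[of \<eta> \<xi>]] m[OF one[of \<xi> \<eta>]] by (simp add: abs_le_iff norm_minus_commute[of \<eta>] mult.commute)
  show "\<bar>sqrt (volume \<Omega> - spectral_density \<xi>) - sqrt (volume \<Omega> - spectral_density \<eta>)\<bar> \<le> sqrt (moment_of_inertia \<Omega>) * norm (\<xi> - \<eta>)"
    using m[OF two[of \<eta> \<xi>]] m[OF two[of \<xi> \<eta>]] by (simp add: abs_le_iff norm_minus_commute[of \<eta>] mult.commute)
qed

end

section \<open>Orthonormalization\<close>

text \<open>The bilinear form with Gram matrix G. Orthonormalizing coefficient vectors instead of
  functions keeps every eigenfunction an explicit combination of the given basis.\<close>

definition bform :: "nat \<Rightarrow> (nat \<Rightarrow> nat \<Rightarrow> real) \<Rightarrow> (nat \<Rightarrow> real) \<Rightarrow> (nat \<Rightarrow> real) \<Rightarrow> real" where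
  "bform M G c d = (\<Sum>i<M. \<Sum>j<M. c i * d j * G i j)"

lemma bform_diff: "bform M G (\<lambda>k. c k - d k) e = bform M G c e - bform M G d e"
  by (simp add: bform_def left_diff_distrib sum_subtractf)

lemma bform_scale: "bform M G (\<lambda>k. a * c k) e = a * bform M G c e"
  by (simp add: bform_def sum_distrib_left mult.assoc)

lemma bform_sum: "bform M G (\<lambda>k. \<Sum>i<(m::nat). c i k) e = (\<Sum>i<m. bform M G (c i) e)"
proof (induction m)
  case 0
  then show ?case by (simp add: bform_def)
next
  case (Suc m)
  then show ?case by (simp add: bform_def distrib_right sum.distrib)
qed

lemma bform_commute:
  assumes "\<And>i j. G i j = G j i"
  shows "bform M G c d = bform M G d c"
  unfolding bform_def
proof (subst sum.swap, intro sum.cong refl)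
  fix i j show "c j * d i * G j i = d i * c j * G i j" using assms[of i j] by simp
qed

text \<open>The induction also carries that the vectors found so far are supported on indices below
  m. The next vector therefore has coefficient 1 at m and is nonzero, so positivity of the form
  permits its normalization.\<close>

lemma gram_schmidt:
  assumes sym: "\<And>i j. G i j = G j i"
    and pos: "\<And>c. (\<exists>i<M. c i \<noteq> 0) \<Longrightarrow> bform M G c c > 0"
  shows "\<exists>C. \<forall>i<M. \<forall>j<M. bform M G (C i) (C j) = (if i = j then 1 else (0::real))"
proof -
  have "m \<le> M \<Longrightarrow> \<exists>C. (\<forall>i<m. \<forall>k\<ge>m. C i k = 0) \<and> (\<forall>i<m. \<forall>j<m. bform M G (C i) (C j) = (if i = j then 1 else 0))" for m
  proof (induction m)
    case 0
    then show ?case by simp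
  next
    case (Suc m)
    then obtain C where C0: "\<And>i k. i < m \<Longrightarrow> k \<ge> m \<Longrightarrow> C i k = 0"
      and C: "\<And>i j. i < m \<Longrightarrow> j < m \<Longrightarrow> bform M G (C i) (C j) = (if i = j then 1 else 0)"
      by (metis Suc_leD)
    define d where "d k = (if k = m then 1 else (0::real))" for k
    define a where "a i = bform M G d (C i)" for i
    define v where "v k = d k - (\<Sum>i<m. a i * C i k)" for k
    have vC: "bform M G v (C j) = 0" if "j < m" for j
    proof -
      have "bform M G v (C j) = a j - (\<Sum>i<m. a i * bform M G (C i) (C j))"
        unfolding v_def by (simp add: bform_diff bform_sum bform_scale a_def)
      also have "(\<Sum>i<m. a i * bform M G (C i) (C j)) = (\<Sum>i<m. if i = j then a i else 0)"
        using C that by (intro sum.cong) auto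
      finally show ?thesis using that by simp
    qed
    have "v m = 1" using C0 by (simp add: v_def d_def)
    hence "\<exists>i<M. v i \<noteq> 0" using Suc.prems by (intro exI[of _ m]) auto
    hence p: "bform M G v v > 0" by (rule pos)
    define w where "w k = 1 / sqrt (bform M G v v) * v k" for k
    have ww: "bform M G w w = 1"
    proof -
      have "bform M G w w = 1 / sqrt (bform M G v v) * (1 / sqrt (bform M G v v) * bform M G v v)"
        unfolding w_def bform_scale bform_commute[OF sym, where c = v and d = "\<lambda>k. 1 / sqrt (bform M G v v) * v k"] ..
      also have "\<dots> = 1" using p by (simp add: divide_simps)
      finally show ?thesis .
    qed
    have wC: "bform M G w (C j) = 0" if "j < m" for j using vC[OF that] unfolding w_def bform_scale by simp
    have Cw: "bform M G (C j) w = 0" if "j < m" for j 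
      using wC[OF that] bform_commute[OF sym, where c = "C j" and d = w] by simp
    show ?case
    proof (intro exI[of _ "C(m := w)"] conjI allI impI)
      fix i k assume "i < Suc m" "Suc m \<le> k"
      thus "(C(m := w)) i k = 0" using C0 by (auto simp: w_def v_def d_def)
    next
      fix i j assume "i < Suc m" "j < Suc m"
      thus "bform M G ((C(m := w)) i) ((C(m := w)) j) = (if i = j then 1 else 0)"
        using C ww wC Cw by (auto simp: less_Suc_eq)
    qed
  qed
  from this[OF order_refl] show ?thesis by blast
qed

lemma ip_sum_sum:
  assumes "\<And>l. l < m \<Longrightarrow> f l \<in> L2 \<Omega>" "\<And>l. l < m' \<Longrightarrow> g l \<in> L2 \<Omega>"
  shows "ip \<Omega> (\<lambda>x. \<Sum>l<m. c l * f l x) (\<lambda>x. \<Sum>l<m'. d l * g l x) = (\<Sum>l<m. \<Sum>l'<m'. c l * d l' * ip \<Omega> (f l) (g l'))"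
proof -
  have "ip \<Omega> (\<lambda>x. \<Sum>l<m. c l * f l x) (\<lambda>x. \<Sum>l<m'. d l * g l x)
     = (LINT x|lebesgue_on \<Omega>. (\<Sum>l<m. \<Sum>l'<m'. c l * d l' * (f l x * g l' x)))"
    by (simp add: sum_product mult_ac)
  also have "\<dots> = (\<Sum>l<m. LINT x|lebesgue_on \<Omega>. (\<Sum>l'<m'. c l * d l' * (f l x * g l' x)))"
    using assms by (intro Bochner_Integration.integral_sum Bochner_Integration.integrable_sum
        Bochner_Integration.integrable_mult_right L2_mult_integrable) auto
  also have "\<dots> = (\<Sum>l<m. \<Sum>l'<m'. LINT x|lebesgue_on \<Omega>. c l * d l' * (f l x * g l' x))"
    using assms by (intro sum.cong refl Bochner_Integration.integral_sum
        Bochner_Integration.integrable_mult_right L2_mult_integrable) auto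
  finally show ?thesis by simp
qed

section \<open>The Fourier transform of square-integrable functions on a bounded set\<close>

definition power_spectrum :: "(real ^ 'n) set \<Rightarrow> (real ^ 'n \<Rightarrow> real) \<Rightarrow> real ^ 'n \<Rightarrow> real" where
  "power_spectrum \<Omega> u \<xi> = (fcos \<Omega> u \<xi>)\<^sup>2 + (fsin \<Omega> u \<xi>)\<^sup>2"

context
  fixes \<Omega> :: "(real ^ 'n) set"
  assumes \<Omega>: "bounded \<Omega>" "open \<Omega>"
begin

lemma L2_integrable:
  assumes "u \<in> L2 \<Omega>"
  shows "integrable (lebesgue_on \<Omega>) u"
proof -
  have "(\<lambda>x. 1) \<in> L2 \<Omega>" by (intro L2_continuous \<Omega> continuous_intros)
  from L2_mult_integrable[OF assms this] show ?thesis by simp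
qed

text \<open>Functions in L2 are measurable only for Lebesgue measure on \<Omega>, while the
  Plancherel argument concerns Borel functions on the whole space. The condition
  \<open>h x 0 = 0\<close> makes integrands survive the extension by 0. A general h serves u, its
  square and its products with cosine and sine through one representative.\<close>

lemma borel_representative:
  assumes "u \<in> L2 \<Omega>"
  obtains u0 where "u0 \<in> borel_measurable borel"
    "\<And>h. (\<lambda>(x, y). h x y) \<in> borel_measurable (borel \<Otimes>\<^sub>M borel) \<Longrightarrow> (\<And>x. h x 0 = 0) \<Longrightarrow>
      (LINT x|lebesgue_on \<Omega>. h x (u x)) = (LINT x|lborel. h x (u0 x)) \<and>
      (integrable (lebesgue_on \<Omega>) (\<lambda>x. h x (u x)) \<longleftrightarrow> integrable lborel (\<lambda>x. h x (u0 x :: real) :: real))"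
proof -
  have \<Omega>m: "\<Omega> \<in> sets lebesgue" using \<Omega> by simp
  have w: "(\<lambda>x. indicator \<Omega> x *\<^sub>R u x) \<in> borel_measurable lebesgue"
    using L2_measurable[OF assms] \<Omega>m by (subst (asm) borel_measurable_restrict_space_iff) auto
  then obtain u0 where u0: "u0 \<in> borel_measurable lborel" "AE x in lborel. indicator \<Omega> x *\<^sub>R u x = u0 x"
    using completion_ex_borel_measurable_real by blast
  have AE: "AE x in lebesgue. indicator \<Omega> x *\<^sub>R u x = u0 x" by (rule AE_completion[OF u0(2)])
  have m[measurable]: "u0 \<in> borel_measurable borel" using u0(1) by simp
  show thesis
  proof (rule that[OF m])
    fix h :: "real ^ 'n \<Rightarrow> real \<Rightarrow> real"
    assume [measurable]: "(\<lambda>(x, y). h x y) \<in> borel_measurable (borel \<Otimes>\<^sub>M borel)" and h0: "\<And>x. h x 0 = 0"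
    have hm: "(\<lambda>x. h x (u0 x)) \<in> borel_measurable lborel" by measurable
    have hu: "(\<lambda>x. indicator \<Omega> x *\<^sub>R h x (u x)) \<in> borel_measurable lebesgue \<and> (AE x in lebesgue. indicator \<Omega> x *\<^sub>R h x (u x) = h x (u0 x))"
    proof
      show AE': "AE x in lebesgue. indicator \<Omega> x *\<^sub>R h x (u x) = h x (u0 x)"
        using AE by eventually_elim (auto simp: indicator_def h0 split: if_splits)
      have "(\<lambda>x. x) \<in> measurable lebesgue (borel :: (real ^ 'n) measure)" by (rule measurable_completion) simp
      hence "(\<lambda>x. (x, indicator \<Omega> x *\<^sub>R u x)) \<in> measurable lebesgue (borel \<Otimes>\<^sub>M borel)" using w by (rule measurable_Pair)
      hence "(\<lambda>x. case (x, indicator \<Omega> x *\<^sub>R u x) of (x, y) \<Rightarrow> h x y) \<in> borel_measurable lebesgue"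
        by (rule measurable_compose) measurable
      moreover have "(\<lambda>x. case (x, indicator \<Omega> x *\<^sub>R u x) of (x, y) \<Rightarrow> h x y) = (\<lambda>x. indicator \<Omega> x *\<^sub>R h x (u x))"
        by (auto simp: indicator_def h0 fun_eq_iff)
      ultimately show "(\<lambda>x. indicator \<Omega> x *\<^sub>R h x (u x)) \<in> borel_measurable lebesgue" by simp
    qed
    have hl: "(\<lambda>x. h x (u0 x)) \<in> borel_measurable lebesgue" using measurable_completion[OF hm] .
    have "(LINT x|lebesgue_on \<Omega>. h x (u x)) = (LINT x|lebesgue. indicator \<Omega> x *\<^sub>R h x (u x))"
      using \<Omega>m by (simp add: integral_restrict_space)
    also have "\<dots> = (LINT x|lebesgue. h x (u0 x))"
      using hu hl by (intro integral_cong_AE) auto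
    also have "\<dots> = (LINT x|lborel. h x (u0 x))" by (rule integral_completion[OF hm])
    finally have 1: "(LINT x|lebesgue_on \<Omega>. h x (u x)) = (LINT x|lborel. h x (u0 x))" .
    have "integrable (lebesgue_on \<Omega>) (\<lambda>x. h x (u x)) \<longleftrightarrow> integrable lebesgue (\<lambda>x. indicator \<Omega> x *\<^sub>R h x (u x))"
      using \<Omega>m by (simp add: integrable_restrict_space)
    also have "\<dots> \<longleftrightarrow> integrable lebesgue (\<lambda>x. h x (u0 x))"
      using hu hl by (intro integrable_cong_AE) auto
    also have "\<dots> \<longleftrightarrow> integrable lborel (\<lambda>x. h x (u0 x))" by (rule integrable_completion[OF hm])
    finally show "(LINT x|lebesgue_on \<Omega>. h x (u x)) = (LINT x|lborel. h x (u0 x)) \<and>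
      (integrable (lebesgue_on \<Omega>) (\<lambda>x. h x (u x)) \<longleftrightarrow> integrable lborel (\<lambda>x. h x (u0 x)))" using 1 by simp
  qed
qed

lemma power_spectrum_measurable:
  assumes "u \<in> L2 \<Omega>"
  shows "power_spectrum \<Omega> u \<in> borel_measurable borel"
    and "(\<integral>\<^sup>+\<xi>. ennreal (power_spectrum \<Omega> u \<xi>) \<partial>lborel) \<le> ennreal ((2 * pi) ^ CARD('n) * ip \<Omega> u u)"
proof -
  obtain u0 where u0[measurable]: "u0 \<in> borel_measurable borel" and
    h: "\<And>h. (\<lambda>(x, y). h x y) \<in> borel_measurable (borel \<Otimes>\<^sub>M borel) \<Longrightarrow> (\<And>x. h x 0 = 0) \<Longrightarrow>
      (LINT x|lebesgue_on \<Omega>. h x (u x)) = (LINT x|lborel. h x (u0 x)) \<and>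
      (integrable (lebesgue_on \<Omega>) (\<lambda>x. h x (u x)) \<longleftrightarrow> integrable lborel (\<lambda>x. h x (u0 x) :: real))"
    using borel_representative[OF assms] by blast
  have 1: "integrable lborel u0"
    using h[of "\<lambda>x y. y"] L2_integrable[OF assms] by simp
  have 2: "integrable lborel (\<lambda>x. (u0 x)\<^sup>2)" "ip \<Omega> u u = (LINT x|lborel. (u0 x)\<^sup>2)"
    using h[of "\<lambda>x y. y\<^sup>2"] L2_square_integrable[OF assms] by (simp_all add: power2_eq_square)
  interpret plancherel u0 by standard (fact 1 2)+
  have "fcos \<Omega> u \<xi> = tc \<xi>" "fsin \<Omega> u \<xi> = ts \<xi>" for \<xi>
    using h[of "\<lambda>x y. y * cos (\<xi> \<bullet> x)"] h[of "\<lambda>x y. y * sin (\<xi> \<bullet> x)"] by (simp_all add: fcos_def fsin_def tc_def ts_def)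
  hence p: "power_spectrum \<Omega> u = (\<lambda>\<xi>. (tc \<xi>)\<^sup>2 + (ts \<xi>)\<^sup>2)" by (simp add: power_spectrum_def fun_eq_iff)
  show "power_spectrum \<Omega> u \<in> borel_measurable borel" unfolding p by measurable
  show "(\<integral>\<^sup>+\<xi>. ennreal (power_spectrum \<Omega> u \<xi>) \<partial>lborel) \<le> ennreal ((2 * pi) ^ CARD('n) * ip \<Omega> u u)"
    unfolding p 2(2) using plancherel_le by simp
qed

lemma power_spectrum_test_function:
  assumes \<phi>: "\<phi> \<in> test_functions \<Omega>"
  shows "ennreal ((2 * pi) ^ CARD('n) * ip \<Omega> \<phi> \<phi>) \<le> (\<integral>\<^sup>+\<xi>. ennreal (power_spectrum \<Omega> \<phi> \<xi>) \<partial>lborel)"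
proof -
  have sq: "(\<lambda>x. \<phi> x * \<phi> x) \<in> test_functions \<Omega>" by (rule test_functions_mult[OF \<phi> test_functions_C_k[OF \<phi>]])
  note sq_int = test_functions_lebesgue[OF \<Omega>(2) sq]
  interpret plancherel \<phi>
    by standard (use test_functions_lebesgue(1)[OF \<Omega>(2) \<phi>] sq_int(1) in \<open>simp_all add: power2_eq_square\<close>)
  have "fcos \<Omega> \<phi> \<xi> = tc \<xi>" "fsin \<Omega> \<phi> \<xi> = ts \<xi>" for \<xi>
    using test_functions_lebesgue(2)[OF \<Omega>(2) test_functions_mult[OF \<phi> C_k_trig(1)], of \<xi>]
      test_functions_lebesgue(2)[OF \<Omega>(2) test_functions_mult[OF \<phi> C_k_trig(2)], of \<xi>]
    by (simp_all add: fcos_def fsin_def tc_def ts_def)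
  hence p: "power_spectrum \<Omega> \<phi> = (\<lambda>\<xi>. (tc \<xi>)\<^sup>2 + (ts \<xi>)\<^sup>2)" by (simp add: power_spectrum_def fun_eq_iff)
  obtain C where C: "\<And>x. \<bar>\<phi> x\<bar> \<le> C" using test_functions_bounded[OF \<phi>] by blast
  have "ip \<Omega> \<phi> \<phi> = (LINT x|lborel. (\<phi> x)\<^sup>2)" using sq_int(2) by (simp add: power2_eq_square)
  thus ?thesis unfolding p using plancherel_ge[OF C_k_continuous[OF test_functions_C_k[OF \<phi>, of 0]] C] by simp
qed

text \<open>Membership in the L2 closure of the test functions; e bounds the squared distance.
  Unlike membership in H2_0, it passes to linear combinations without any reference to chosen weak
  derivatives.\<close>

definition approximable :: "(real ^ 'n \<Rightarrow> real) \<Rightarrow> bool" where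
  "approximable u \<longleftrightarrow> u \<in> L2 \<Omega> \<and> (\<forall>e>0. \<exists>\<phi>\<in>test_functions \<Omega>. ip \<Omega> (\<lambda>x. u x - \<phi> x) (\<lambda>x. u x - \<phi> x) \<le> e)"

lemma square_sum_le: "t > 0 \<Longrightarrow> (a + b)\<^sup>2 \<le> (1 + t) * a\<^sup>2 + (1 + 1 / t) * (b::real)\<^sup>2"
proof -
  assume t: "t > 0"
  have "0 \<le> (t * a - b)\<^sup>2 / t" using t by simp
  thus ?thesis using t by (simp add: power2_eq_square field_simps)
qed

lemma ip_add_le:
  assumes "t > 0" "f \<in> L2 \<Omega>" "g \<in> L2 \<Omega>"
  shows "ip \<Omega> (\<lambda>x. f x + g x) (\<lambda>x. f x + g x) \<le> (1 + t) * ip \<Omega> f f + (1 + 1 / t) * ip \<Omega> g g"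
proof -
  have "ip \<Omega> (\<lambda>x. f x + g x) (\<lambda>x. f x + g x) \<le> (LINT x|lebesgue_on \<Omega>. (1 + t) * (f x * f x) + (1 + 1 / t) * (g x * g x))"
  proof (rule integral_mono)
    show "integrable (lebesgue_on \<Omega>) (\<lambda>x. (f x + g x) * (f x + g x))"
      using assms by (intro L2_mult_integrable L2_add)
    show "integrable (lebesgue_on \<Omega>) (\<lambda>x. (1 + t) * (f x * f x) + (1 + 1 / t) * (g x * g x))"
      using L2_mult_integrable[OF assms(2,2)] L2_mult_integrable[OF assms(3,3)] by simp
    show "(f x + g x) * (f x + g x) \<le> (1 + t) * (f x * f x) + (1 + 1 / t) * (g x * g x)" for x
      using square_sum_le[OF assms(1), of "f x" "g x"] by (simp add: power2_eq_square)
  qed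
  also have "\<dots> = (1 + t) * ip \<Omega> f f + (1 + 1 / t) * ip \<Omega> g g"
    using L2_mult_integrable[OF assms(2,2)] L2_mult_integrable[OF assms(3,3)] by simp
  finally show ?thesis .
qed

lemma approximable_add:
  assumes "approximable u" "approximable v"
  shows "approximable (\<lambda>x. u x + v x)"
  unfolding approximable_def
proof (intro conjI allI impI)
  show "(\<lambda>x. u x + v x) \<in> L2 \<Omega>" using assms by (auto simp: approximable_def intro: L2_add)
  fix e :: real assume "e > 0"
  hence e: "e / 4 > 0" by simp
  obtain \<phi> where \<phi>: "\<phi> \<in> test_functions \<Omega>" "ip \<Omega> (\<lambda>x. u x - \<phi> x) (\<lambda>x. u x - \<phi> x) \<le> e / 4"
    using assms(1) e unfolding approximable_def by blast
  obtain \<psi> where \<psi>: "\<psi> \<in> test_functions \<Omega>" "ip \<Omega> (\<lambda>x. v x - \<psi> x) (\<lambda>x. v x - \<psi> x) \<le> e / 4"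
    using assms(2) e unfolding approximable_def by blast
  have t: "(\<lambda>x. \<phi> x + \<psi> x) \<in> test_functions \<Omega>"
  proof -
    obtain K L where K: "compact K" "K \<subseteq> \<Omega>" "\<And>x. x \<notin> K \<Longrightarrow> \<phi> x = 0"
      and L: "compact L" "L \<subseteq> \<Omega>" "\<And>x. x \<notin> L \<Longrightarrow> \<psi> x = 0"
      using \<phi>(1) \<psi>(1) unfolding test_functions_def by blast
    show ?thesis
      by (rule test_functionsI[of _ "K \<union> L"])
         (use K L test_functions_C_k[OF \<phi>(1)] test_functions_C_k[OF \<psi>(1)] in \<open>auto intro: C_k_add\<close>)
  qed
  have L: "(\<lambda>x. u x - \<phi> x) \<in> L2 \<Omega>" "(\<lambda>x. v x - \<psi> x) \<in> L2 \<Omega>"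
    using assms test_functions_L2[OF \<Omega>] \<phi> \<psi> by (auto simp: approximable_def intro!: L2_diff)
  have "ip \<Omega> (\<lambda>x. (u x - \<phi> x) + (v x - \<psi> x)) (\<lambda>x. (u x - \<phi> x) + (v x - \<psi> x)) \<le> e"
    using ip_add_le[OF zero_less_one L] \<phi>(2) \<psi>(2) by simp
  thus "\<exists>\<phi>\<in>test_functions \<Omega>. ip \<Omega> (\<lambda>x. u x + v x - \<phi> x) (\<lambda>x. u x + v x - \<phi> x) \<le> e"
    by (intro bexI[OF _ t]) (simp add: algebra_simps)
qed

lemma approximable_scale:
  assumes "approximable u"
  shows "approximable (\<lambda>x. c * u x)"
  unfolding approximable_def
proof (intro conjI allI impI)
  show "(\<lambda>x. c * u x) \<in> L2 \<Omega>" using assms by (auto simp: approximable_def intro: L2_scale)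
  fix e :: real assume e: "e > 0"
  have c: "c\<^sup>2 + 1 > 0" by (simp add: add_nonneg_pos)
  have ec: "e / (c\<^sup>2 + 1) > 0" using e c by simp
  obtain \<phi> where \<phi>: "\<phi> \<in> test_functions \<Omega>" "ip \<Omega> (\<lambda>x. u x - \<phi> x) (\<lambda>x. u x - \<phi> x) \<le> e / (c\<^sup>2 + 1)"
    using assms ec unfolding approximable_def by blast
  have "(\<lambda>x. \<phi> x * c) \<in> test_functions \<Omega>" by (intro test_functions_mult \<phi> C_k_const)
  moreover have "ip \<Omega> (\<lambda>x. c * u x - \<phi> x * c) (\<lambda>x. c * u x - \<phi> x * c) \<le> e"
  proof -
    have "ip \<Omega> (\<lambda>x. c * u x - \<phi> x * c) (\<lambda>x. c * u x - \<phi> x * c) = (LINT x|lebesgue_on \<Omega>. c\<^sup>2 * ((u x - \<phi> x) * (u x - \<phi> x)))"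
      by (intro Bochner_Integration.integral_cong) (auto simp: power2_eq_square algebra_simps)
    also have "\<dots> = c\<^sup>2 * ip \<Omega> (\<lambda>x. u x - \<phi> x) (\<lambda>x. u x - \<phi> x)" by simp
    also have "\<dots> \<le> c\<^sup>2 * (e / (c\<^sup>2 + 1))" using \<phi>(2) by (intro mult_left_mono) auto
    also have "\<dots> \<le> e" using c e by (simp add: field_simps)
    finally show ?thesis .
  qed
  ultimately show "\<exists>\<phi>\<in>test_functions \<Omega>. ip \<Omega> (\<lambda>x. c * u x - \<phi> x) (\<lambda>x. c * u x - \<phi> x) \<le> e"
    by (intro bexI[of _ "\<lambda>x. \<phi> x * c"])
qed

lemma approximable_sum:
  fixes m :: nat
  assumes "\<And>l. l < m \<Longrightarrow> approximable (b l)"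
  shows "approximable (\<lambda>x. \<Sum>l<m. c l * b l x)"
  using assms
proof (induction m)
  case 0
  have "(\<lambda>x. 0) \<in> test_functions \<Omega>" by (rule test_functionsI[of _ "{}"]) (auto intro: C_k_const)
  thus ?case by (auto simp: approximable_def intro!: L2_zero bexI[of _ "\<lambda>x. 0"])
next
  case (Suc m)
  then show ?case by (auto intro!: approximable_add approximable_scale)
qed

lemma H2_0_approximable:
  assumes "u \<in> H2_0 \<Omega>"
  shows "approximable u"
  unfolding approximable_def
proof (intro conjI allI impI)
  show "u \<in> L2 \<Omega>" using H2_0_L2[OF assms] by simp
  fix e :: real assume e: "e > 0"
  hence "sqrt e > 0" by simp
  then obtain \<phi> where \<phi>: "\<phi> \<in> test_functions \<Omega>" "H2_norm \<Omega> (\<lambda>x. u x - \<phi> x) < sqrt e"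
    using assms unfolding H2_0_def by blast
  thus "\<exists>\<phi>\<in>test_functions \<Omega>. ip \<Omega> (\<lambda>x. u x - \<phi> x) (\<lambda>x. u x - \<phi> x) \<le> e"
    using H2_norm_bounds(1)[OF \<phi>(2)] e by (intro bexI[OF _ \<phi>(1)]) (simp add: power2_eq_square)
qed

lemma fourier_add:
  assumes "f \<in> L2 \<Omega>" "g \<in> L2 \<Omega>"
  shows "fcos \<Omega> (\<lambda>x. f x + g x) \<xi> = fcos \<Omega> f \<xi> + fcos \<Omega> g \<xi>" "fsin \<Omega> (\<lambda>x. f x + g x) \<xi> = fsin \<Omega> f \<xi> + fsin \<Omega> g \<xi>"
  unfolding fcos_def fsin_def distrib_right
  using assms trig_L2[OF \<Omega>] by (auto intro!: Bochner_Integration.integral_add L2_mult_integrable)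

lemma power_spectrum_add_le:
  assumes "t > 0" "f \<in> L2 \<Omega>" "g \<in> L2 \<Omega>"
  shows "power_spectrum \<Omega> (\<lambda>x. f x + g x) \<xi> \<le> (1 + t) * power_spectrum \<Omega> f \<xi> + (1 + 1 / t) * power_spectrum \<Omega> g \<xi>"
proof -
  have "power_spectrum \<Omega> (\<lambda>x. f x + g x) \<xi> = (fcos \<Omega> f \<xi> + fcos \<Omega> g \<xi>)\<^sup>2 + (fsin \<Omega> f \<xi> + fsin \<Omega> g \<xi>)\<^sup>2"
    by (simp add: power_spectrum_def fourier_add[OF assms(2,3)])
  also have "\<dots> \<le> ((1 + t) * (fcos \<Omega> f \<xi>)\<^sup>2 + (1 + 1 / t) * (fcos \<Omega> g \<xi>)\<^sup>2) + ((1 + t) * (fsin \<Omega> f \<xi>)\<^sup>2 + (1 + 1 / t) * (fsin \<Omega> g \<xi>)\<^sup>2)"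
    by (intro add_mono square_sum_le assms)
  also have "\<dots> = (1 + t) * power_spectrum \<Omega> f \<xi> + (1 + 1 / t) * power_spectrum \<Omega> g \<xi>"
    by (simp add: power_spectrum_def algebra_simps)
  finally show ?thesis .
qed

lemma power_spectrum_nonneg: "0 \<le> power_spectrum \<Omega> u \<xi>"
  by (simp add: power_spectrum_def)

text \<open>The upper half is the bound for L2. For the lower half a test function \<phi> near u
  mediates: the norm of u is compared with that of \<phi>, and the spectrum of \<phi> with that of
  u, both times by (x + y)^2 \<le> (1 + t) x^2 + (1 + 1 / t) y^2.\<close>

theorem plancherel_approximable:
  assumes "approximable u"
  shows "(\<integral>\<^sup>+\<xi>. ennreal (power_spectrum \<Omega> u \<xi>) \<partial>lborel) = ennreal ((2 * pi) ^ CARD('n) * ip \<Omega> u u)"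
proof (rule antisym)
  have u: "u \<in> L2 \<Omega>" using assms by (simp add: approximable_def)
  note um[measurable] = power_spectrum_measurable(1)[OF u]
  show le: "(\<integral>\<^sup>+\<xi>. ennreal (power_spectrum \<Omega> u \<xi>) \<partial>lborel) \<le> ennreal ((2 * pi) ^ CARD('n) * ip \<Omega> u u)"
    by (rule power_spectrum_measurable(2)[OF u])
  have "(\<integral>\<^sup>+\<xi>. ennreal (power_spectrum \<Omega> u \<xi>) \<partial>lborel) < top" using le by (simp add: le_less_trans)
  then obtain X where X: "X \<ge> 0" "(\<integral>\<^sup>+\<xi>. ennreal (power_spectrum \<Omega> u \<xi>) \<partial>lborel) = ennreal X"
    by (cases "(\<integral>\<^sup>+\<xi>. ennreal (power_spectrum \<Omega> u \<xi>) \<partial>lborel)") auto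
  define P where "P = (2 * pi) ^ CARD('n)"
  have P: "P > 0" by (simp add: P_def)
  \<comment> \<open>The squared error t^2 is tied to the parameter t, so that the error terms (1 + 1
    / t) t^2 = t^2 + t vanish with t.\<close>
  have bound: "P * ip \<Omega> u u \<le> (1 + t) * ((1 + t) * X + (1 + 1 / t) * (P * t\<^sup>2)) + (1 + 1 / t) * (P * t\<^sup>2)" if t: "t > 0" for t
  proof -
    obtain \<phi> where \<phi>: "\<phi> \<in> test_functions \<Omega>" "ip \<Omega> (\<lambda>x. u x - \<phi> x) (\<lambda>x. u x - \<phi> x) \<le> t\<^sup>2"
      using assms zero_less_power[OF t, of 2] unfolding approximable_def by blast
    let ?w = "\<lambda>x. u x - \<phi> x" and ?w' = "\<lambda>x. \<phi> x - u x"
    have L: "\<phi> \<in> L2 \<Omega>" "?w \<in> L2 \<Omega>" "?w' \<in> L2 \<Omega>"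
      using test_functions_L2[OF \<Omega> \<phi>(1)] u by (auto intro: L2_diff)
    note [measurable] = power_spectrum_measurable(1)[OF L(3)]
    have sw: "ip \<Omega> ?w' ?w' = ip \<Omega> ?w ?w" by (intro Bochner_Integration.integral_cong) (auto simp: algebra_simps)
    have "ennreal (P * ip \<Omega> \<phi> \<phi>) \<le> (\<integral>\<^sup>+\<xi>. ennreal (power_spectrum \<Omega> \<phi> \<xi>) \<partial>lborel)"
      unfolding P_def by (rule power_spectrum_test_function[OF \<phi>(1)])
    also have "\<dots> \<le> (\<integral>\<^sup>+\<xi>. ennreal (1 + t) * ennreal (power_spectrum \<Omega> u \<xi>) + ennreal (1 + 1 / t) * ennreal (power_spectrum \<Omega> ?w' \<xi>) \<partial>lborel)"
    proof (rule nn_integral_mono)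
      fix \<xi>
      have "power_spectrum \<Omega> \<phi> \<xi> \<le> (1 + t) * power_spectrum \<Omega> u \<xi> + (1 + 1 / t) * power_spectrum \<Omega> ?w' \<xi>"
        using power_spectrum_add_le[OF t u L(3), of \<xi>] by simp
      thus "ennreal (power_spectrum \<Omega> \<phi> \<xi>) \<le> ennreal (1 + t) * ennreal (power_spectrum \<Omega> u \<xi>) + ennreal (1 + 1 / t) * ennreal (power_spectrum \<Omega> ?w' \<xi>)"
        using t power_spectrum_nonneg by (simp add: ennreal_mult[symmetric] ennreal_plus[symmetric] ennreal_leI del: ennreal_plus)
    qed
    also have "\<dots> = ennreal (1 + t) * ennreal X + ennreal (1 + 1 / t) * (\<integral>\<^sup>+\<xi>. ennreal (power_spectrum \<Omega> ?w' \<xi>) \<partial>lborel)"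
      by (simp add: nn_integral_add nn_integral_cmult X(2))
    also have "\<dots> \<le> ennreal (1 + t) * ennreal X + ennreal (1 + 1 / t) * ennreal (P * t\<^sup>2)"
    proof (intro add_left_mono mult_left_mono)
      have "(\<integral>\<^sup>+\<xi>. ennreal (power_spectrum \<Omega> ?w' \<xi>) \<partial>lborel) \<le> ennreal (P * ip \<Omega> ?w' ?w')"
        unfolding P_def by (rule power_spectrum_measurable(2)[OF L(3)])
      also have "\<dots> \<le> ennreal (P * t\<^sup>2)" using \<phi>(2) P unfolding sw by (intro ennreal_leI mult_left_mono) auto
      finally show "(\<integral>\<^sup>+\<xi>. ennreal (power_spectrum \<Omega> ?w' \<xi>) \<partial>lborel) \<le> ennreal (P * t\<^sup>2)" .
    qed auto
    also have "\<dots> = ennreal ((1 + t) * X + (1 + 1 / t) * (P * t\<^sup>2))"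
    proof -
      have z: "0 \<le> 1 + t" "0 \<le> 1 + 1 / t" "0 \<le> P * t\<^sup>2" using t P by simp_all
      show ?thesis unfolding ennreal_add_mult[OF mult_nonneg_nonneg[OF z(1) X(1)] z(2,3)] ennreal_mult[OF z(1) X(1)] ..
    qed
    finally have "P * ip \<Omega> \<phi> \<phi> \<le> (1 + t) * X + (1 + 1 / t) * (P * t\<^sup>2)"
      using t X P by (subst (asm) ennreal_le_iff) auto
    moreover have "ip \<Omega> u u \<le> (1 + t) * ip \<Omega> \<phi> \<phi> + (1 + 1 / t) * ip \<Omega> ?w ?w"
      using ip_add_le[OF t L(1,2)] by simp
    hence "P * ip \<Omega> u u \<le> P * ((1 + t) * ip \<Omega> \<phi> \<phi> + (1 + 1 / t) * ip \<Omega> ?w ?w)"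
      using P by (intro mult_left_mono) auto
    moreover have "P * ((1 + t) * ip \<Omega> \<phi> \<phi> + (1 + 1 / t) * ip \<Omega> ?w ?w) = (1 + t) * (P * ip \<Omega> \<phi> \<phi>) + (1 + 1 / t) * (P * ip \<Omega> ?w ?w)"
      by (simp add: algebra_simps)
    moreover have "(1 + 1 / t) * (P * ip \<Omega> ?w ?w) \<le> (1 + 1 / t) * (P * t\<^sup>2)"
      using \<phi>(2) P t by (intro mult_left_mono) auto
    moreover have "(1 + t) * (P * ip \<Omega> \<phi> \<phi>) \<le> (1 + t) * ((1 + t) * X + (1 + 1 / t) * (P * t\<^sup>2))"
      using calculation(1) t by (intro mult_left_mono) auto
    ultimately show ?thesis by linarith
  qed
  have e: "(1 + t) * ((1 + t) * X + (1 + 1 / t) * (P * t\<^sup>2)) + (1 + 1 / t) * (P * t\<^sup>2)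
      = (1 + t) * ((1 + t) * X + (t\<^sup>2 + t) * P) + (t\<^sup>2 + t) * P" if "t > 0" for t
    using that by (simp add: field_simps power2_eq_square)
  have "((\<lambda>t. (1 + t) * ((1 + t) * X + (t\<^sup>2 + t) * P) + (t\<^sup>2 + t) * P) \<longlongrightarrow> (1 + 0) * ((1 + 0) * X + (0\<^sup>2 + 0) * P) + (0\<^sup>2 + 0) * P) (at_right 0)"
    by (intro tendsto_intros)
  moreover have "\<forall>\<^sub>F t in at_right 0. P * ip \<Omega> u u \<le> (1 + t) * ((1 + t) * X + (t\<^sup>2 + t) * P) + (t\<^sup>2 + t) * P"
    using eventually_at_right_less[of "0::real"] by eventually_elim (use bound e in auto)
  ultimately have "P * ip \<Omega> u u \<le> (1 + 0) * ((1 + 0) * X + (0\<^sup>2 + 0) * P) + (0\<^sup>2 + 0) * P"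
    by (rule tendsto_lowerbound) simp
  thus "ennreal ((2 * pi) ^ CARD('n) * ip \<Omega> u u) \<le> (\<integral>\<^sup>+\<xi>. ennreal (power_spectrum \<Omega> u \<xi>) \<partial>lborel)"
    unfolding X(2) P_def[symmetric] by (intro ennreal_leI) simp
qed

end

section \<open>Orthonormal eigenfunctions\<close>

lemma eigenspace_eq:
  assumes "f \<in> eigenspace a \<Omega> \<gamma>" "g \<in> H2_0 \<Omega>"
  shows "ip \<Omega> (weak_laplacian \<Omega> f) (weak_laplacian \<Omega> g)
    + a * (\<Sum>i\<in>UNIV. ip \<Omega> (weak_partial \<Omega> i f) (weak_partial \<Omega> i g)) = \<gamma> * ip \<Omega> f g"
proof -
  have f: "f \<in> H2_0 \<Omega>" using assms(1) by (simp add: eigenspace_def)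
  have "(LINT x|lebesgue_on \<Omega>. (\<Sum>i\<in>UNIV. weak_partial \<Omega> i f x * weak_partial \<Omega> i g x))
    = (\<Sum>i\<in>UNIV. ip \<Omega> (weak_partial \<Omega> i f) (weak_partial \<Omega> i g))"
    using H2_0_L2(2)[OF f] H2_0_L2(2)[OF assms(2)]
    by (intro Bochner_Integration.integral_sum L2_mult_integrable) auto
  moreover have "ip \<Omega> (weak_laplacian \<Omega> f) (weak_laplacian \<Omega> g) +
      a * (LINT x|lebesgue_on \<Omega>. (\<Sum>i\<in>UNIV. weak_partial \<Omega> i f x * weak_partial \<Omega> i g x)) = \<gamma> * ip \<Omega> f g"
    using assms unfolding eigenspace_def by blast
  ultimately show ?thesis by (simp only:)
qed

text \<open>The bilinear form is symmetric: testing the equation of each function with the other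
  yields \<gamma> and \<gamma>' times the same inner product.\<close>

lemma eigenspace_orthogonal:
  assumes "f \<in> eigenspace a \<Omega> \<gamma>" "g \<in> eigenspace a \<Omega> \<gamma>'" "\<gamma> \<noteq> \<gamma>'"
  shows "ip \<Omega> f g = 0"
proof -
  have H: "f \<in> H2_0 \<Omega>" "g \<in> H2_0 \<Omega>" using assms by (simp_all add: eigenspace_def)
  have "\<gamma> * ip \<Omega> f g = \<gamma>' * ip \<Omega> g f"
    using eigenspace_eq[OF assms(1) H(2)] eigenspace_eq[OF assms(2) H(1)]
    by (simp add: ip_commute[of \<Omega> "weak_laplacian \<Omega> g"] ip_commute[of \<Omega> "weak_partial \<Omega> _ g"])
  hence "(\<gamma> - \<gamma>') * ip \<Omega> f g = 0" by (simp add: ip_commute[of \<Omega> g] algebra_simps)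
  thus ?thesis using assms(3) by simp
qed

text \<open>Linear independence almost everywhere makes the Gram form positive definite, as
  Gram-Schmidt requires. Basis and coefficients are returned separately because the weak derivatives
  are at hand only for the basis functions.\<close>

lemma eigenspace_orthonormal_basis:
  assumes "has_dim_ae (lebesgue_on \<Omega>) (eigenspace a \<Omega> \<gamma>) m"
  shows "\<exists>b C. (\<forall>l<m. b l \<in> eigenspace a \<Omega> \<gamma>) \<and>
    (\<forall>i<m. \<forall>j<m. ip \<Omega> (\<lambda>x. \<Sum>l<m. C i l * b l x) (\<lambda>x. \<Sum>l<m. C j l * b l x) = (if i = j then 1 else 0))"
proof -
  obtain b where b: "\<And>l. l < m \<Longrightarrow> b l \<in> eigenspace a \<Omega> \<gamma>"
    and ind: "\<And>c. (AE x in lebesgue_on \<Omega>. (\<Sum>i<m. c i * b i x) = 0) \<Longrightarrow> \<forall>i<m. c i = 0"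
    using assms unfolding has_dim_ae_def by blast
  have L: "b l \<in> L2 \<Omega>" if "l < m" for l using b[OF that] by (auto simp: eigenspace_def H2_0_L2)
  define G where "G i j = ip \<Omega> (b i) (b j)" for i j
  have bf: "bform m G c d = ip \<Omega> (\<lambda>x. \<Sum>l<m. c l * b l x) (\<lambda>x. \<Sum>l<m. d l * b l x)" for c d
    unfolding bform_def G_def using L by (intro ip_sum_sum[symmetric]) auto
  have "bform m G c c > 0" if c: "\<exists>i<m. c i \<noteq> 0" for c
  proof -
    let ?w = "\<lambda>x. \<Sum>l<m. c l * b l x"
    have w: "?w \<in> L2 \<Omega>" using L by (intro L2_sum L2_scale) auto
    have "ip \<Omega> ?w ?w \<noteq> 0"
    proof
      assume "ip \<Omega> ?w ?w = 0"
      hence "AE x in lebesgue_on \<Omega>. ?w x * ?w x = 0"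
        using L2_mult_integrable[OF w w] by (subst (asm) integral_nonneg_eq_0_iff_AE) auto
      hence "AE x in lebesgue_on \<Omega>. ?w x = 0" by eventually_elim simp
      from ind[OF this] c show False by blast
    qed
    moreover have "0 \<le> ip \<Omega> ?w ?w" by simp
    ultimately show ?thesis unfolding bf by linarith
  qed
  moreover have "G i j = G j i" for i j unfolding G_def by (rule ip_commute)
  ultimately obtain C where "\<forall>i<m. \<forall>j<m. bform m G (C i) (C j) = (if i = j then 1 else 0)"
    using gram_schmidt[of G m] by blast
  thus ?thesis unfolding bf using b by blast
qed

text \<open>\<open>card\<close> of an infinite set is 0, so only finiteness lets the cardinality in
  \<open>eigenvalue_sequence\<close> match basis functions with indices.\<close>

lemma eigenvalue_multiplicity_finite:
  fixes \<Gamma> :: "nat \<Rightarrow> real"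
  assumes "filterlim \<Gamma> at_top sequentially"
  shows "finite {j. 1 \<le> j \<and> \<Gamma> j = \<gamma>}"
proof -
  have "\<forall>\<^sub>F j in sequentially. \<Gamma> j > \<gamma>" using assms by (simp add: filterlim_at_top_dense)
  then obtain N where "\<And>j. j \<ge> N \<Longrightarrow> \<Gamma> j > \<gamma>" by (auto simp: eventually_sequentially)
  hence "{j. 1 \<le> j \<and> \<Gamma> j = \<gamma>} \<subseteq> {..<N}" by (force simp: not_le[symmetric])
  thus ?thesis using finite_subset by blast
qed

text \<open>
  \<open>l\<close> and \<open>d i\<close> play the roles of the Laplacian and the partial derivatives of \<open>u\<close>. Only their
  Fourier transforms matter, so a linear combination of eigenfunctions needs no linearity of the
  chosen representatives \<open>weak_partial\<close>.
\<close>

definition eigenfunction_data :: "real \<Rightarrow> (real ^ 'n) set \<Rightarrow> real \<Rightarrow> (real ^ 'n \<Rightarrow> real) \<Rightarrow> bool" where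
  "eigenfunction_data a \<Omega> \<gamma> u \<longleftrightarrow> approximable \<Omega> u \<and> (\<exists>l (d :: 'n \<Rightarrow> real ^ 'n \<Rightarrow> real). l \<in> L2 \<Omega> \<and> (\<forall>i. d i \<in> L2 \<Omega>) \<and>
     (\<forall>\<xi>. power_spectrum \<Omega> l \<xi> = norm \<xi> ^ 4 * power_spectrum \<Omega> u \<xi>) \<and>
     (\<forall>\<xi>. (\<Sum>i\<in>UNIV. power_spectrum \<Omega> (d i) \<xi>) = (norm \<xi>)\<^sup>2 * power_spectrum \<Omega> u \<xi>) \<and>
     ip \<Omega> l l + a * (\<Sum>i\<in>UNIV. ip \<Omega> (d i) (d i)) = \<gamma> * ip \<Omega> u u)"

text \<open>The same combinations of the chosen Laplacians and partial derivatives of the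
  \<open>b l\<close> serve as witnesses. Their transforms are correct by linearity of the integral,
  and their energy follows by expanding the eigenvalue equation over pairs of basis
  functions.\<close>

lemma eigenfunction_data_combination:
  fixes \<Omega> :: "(real ^ 'n) set" and b :: "nat \<Rightarrow> real ^ 'n \<Rightarrow> real"
  assumes \<Omega>: "bounded \<Omega>" "open \<Omega>" and b: "\<And>l. l < m \<Longrightarrow> b l \<in> eigenspace a \<Omega> \<gamma>"
  shows "eigenfunction_data a \<Omega> \<gamma> (\<lambda>x. \<Sum>l<m. c l * b l x)"
proof -
  have H: "b l \<in> H2_0 \<Omega>" if "l < m" for l using b[OF that] by (simp add: eigenspace_def)
  note L = H2_0_L2[OF H]
  let ?u = "\<lambda>x. \<Sum>l<m. c l * b l x"
  let ?lap = "\<lambda>x. \<Sum>l<m. c l * weak_laplacian \<Omega> (b l) x"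
  let ?d = "\<lambda>i x. \<Sum>l<m. c l * weak_partial \<Omega> i (b l) x"
  have fs: "fcos \<Omega> (\<lambda>x. \<Sum>l<m. c l * f l x) \<xi> = (\<Sum>l<m. c l * fcos \<Omega> (f l) \<xi>)"
    "fsin \<Omega> (\<lambda>x. \<Sum>l<m. c l * f l x) \<xi> = (\<Sum>l<m. c l * fsin \<Omega> (f l) \<xi>)"
    if "\<And>l. l < m \<Longrightarrow> f l \<in> L2 \<Omega>" for f :: "nat \<Rightarrow> real ^ 'n \<Rightarrow> real" and \<xi>
    using fourier_sum[OF \<Omega>, of "{..<m}" "\<lambda>l x. c l * f l x" \<xi>] that by (simp_all add: fourier_scale L2_scale)
  have sc: "(\<Sum>l<m. c l * (t * g l)) = t * (\<Sum>l<m. c l * g l)" for t and g :: "nat \<Rightarrow> real"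
    by (simp add: sum_distrib_left mult_ac)
  have lap: "fcos \<Omega> ?lap \<xi> = - (norm \<xi>)\<^sup>2 * fcos \<Omega> ?u \<xi>" "fsin \<Omega> ?lap \<xi> = - (norm \<xi>)\<^sup>2 * fsin \<Omega> ?u \<xi>" for \<xi>
    using fourier_weak_laplacian[OF \<Omega> H] L by (simp_all add: fs sc[of "- (norm \<xi>)\<^sup>2", simplified])
  have d: "fcos \<Omega> (?d i) \<xi> = \<xi> $ i * fsin \<Omega> ?u \<xi>" "fsin \<Omega> (?d i) \<xi> = - \<xi> $ i * fcos \<Omega> ?u \<xi>" for i \<xi>
    using fourier_weak_partial[OF \<Omega> H] L by (simp_all add: fs sc[of "\<xi> $ i"] sc[of "- \<xi> $ i", simplified])
  have n: "(norm \<xi>)\<^sup>2 = (\<Sum>i\<in>UNIV. (\<xi> $ i)\<^sup>2)" for \<xi> :: "real ^ 'n"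
    by (simp add: norm_vec_def L2_set_def sum_nonneg)
  have e: "ip \<Omega> ?lap ?lap + a * (\<Sum>i\<in>UNIV. ip \<Omega> (?d i) (?d i)) = \<gamma> * ip \<Omega> ?u ?u"
  proof -
    let ?W = "\<lambda>l l'. ip \<Omega> (weak_laplacian \<Omega> (b l)) (weak_laplacian \<Omega> (b l'))"
    let ?D = "\<lambda>i l l'. ip \<Omega> (weak_partial \<Omega> i (b l)) (weak_partial \<Omega> i (b l'))"
    have "ip \<Omega> ?lap ?lap = (\<Sum>l<m. \<Sum>l'<m. c l * c l' * ?W l l')"
      by (rule ip_sum_sum[OF L(4) L(4)])
    moreover have "ip \<Omega> (?d i) (?d i) = (\<Sum>l<m. \<Sum>l'<m. c l * c l' * ?D i l l')" for i
      by (rule ip_sum_sum[OF L(2) L(2)])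
    hence "(\<Sum>i\<in>UNIV. ip \<Omega> (?d i) (?d i)) = (\<Sum>l<m. \<Sum>l'<m. c l * c l' * (\<Sum>i\<in>UNIV. ?D i l l'))"
      by (simp add: sum.swap[of _ UNIV] sum_distrib_left)
    moreover have "\<gamma> * ip \<Omega> ?u ?u = (\<Sum>l<m. \<Sum>l'<m. c l * c l' * (\<gamma> * ip \<Omega> (b l) (b l')))"
      using ip_sum_sum[of m b \<Omega> m b c c] L(1) by (simp add: sum_distrib_left mult_ac)
    moreover have "(\<Sum>l<m. \<Sum>l'<m. c l * c l' * (\<gamma> * ip \<Omega> (b l) (b l'))) = (\<Sum>l<m. \<Sum>l'<m. c l * c l' * (?W l l' + a * (\<Sum>i\<in>UNIV. ?D i l l')))"
      using eigenspace_eq[OF b H] by (intro sum.cong refl) simp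
    ultimately show ?thesis by (simp add: distrib_left sum.distrib sum_distrib_left mult_ac)
  qed
  show ?thesis unfolding eigenfunction_data_def
  proof (intro conjI exI allI)
    show "approximable \<Omega> ?u" using H by (intro approximable_sum[OF \<Omega>] H2_0_approximable[OF \<Omega>])
    show "?lap \<in> L2 \<Omega>" "?d i \<in> L2 \<Omega>" for i using L by (intro L2_sum L2_scale; simp)+
    show "power_spectrum \<Omega> ?lap \<xi> = norm \<xi> ^ 4 * power_spectrum \<Omega> ?u \<xi>" for \<xi>
      by (simp add: power_spectrum_def lap power_mult_distrib distrib_left flip: power_mult)
    show "(\<Sum>i\<in>UNIV. power_spectrum \<Omega> (?d i) \<xi>) = (norm \<xi>)\<^sup>2 * power_spectrum \<Omega> ?u \<xi>" for \<xi>
      unfolding n by (simp add: power_spectrum_def d power_mult_distrib sum_distrib_right sum.distrib algebra_simps)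
  qed (rule e)
qed

text \<open>For each eigenvalue a bijection \<open>\<sigma>\<close> assigns its indices to an
  orthonormal family of as many eigenfunctions; distinct eigenvalues are orthogonal anyway. By
  normalization \<open>\<Gamma> j\<close> becomes the energy of \<open>u j\<close>.\<close>

lemma orthonormal_eigenfunctions:
  fixes \<Omega> :: "(real ^ 'n) set"
  assumes \<Omega>: "bounded \<Omega>" "open \<Omega>" and es: "eigenvalue_sequence a \<Omega> \<Gamma>"
  obtains u where "\<And>j. j \<ge> 1 \<Longrightarrow> eigenfunction_data a \<Omega> (\<Gamma> j) (u j)"
    "\<And>i j. i \<ge> 1 \<Longrightarrow> j \<ge> 1 \<Longrightarrow> ip \<Omega> (u i) (u j) = (if i = j then 1 else 0)"
proof -
  define J where "J \<gamma> = {j. 1 \<le> j \<and> \<Gamma> j = \<gamma>}" for \<gamma>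
  have Jfin: "finite (J \<gamma>)" for \<gamma> unfolding J_def
    using es by (intro eigenvalue_multiplicity_finite) (simp add: eigenvalue_sequence_def)
  define m where "m \<gamma> = card (J \<gamma>)" for \<gamma>
  have dim: "has_dim_ae (lebesgue_on \<Omega>) (eigenspace a \<Omega> \<gamma>) (m \<gamma>)" for \<gamma>
    using es by (simp add: eigenvalue_sequence_def m_def J_def)
  have "\<forall>\<gamma>. \<exists>bC. (\<forall>l<m \<gamma>. fst bC l \<in> eigenspace a \<Omega> \<gamma>) \<and>
    (\<forall>i<m \<gamma>. \<forall>j<m \<gamma>. ip \<Omega> (\<lambda>x. \<Sum>l<m \<gamma>. snd bC i l * fst bC l x) (\<lambda>x. \<Sum>l<m \<gamma>. snd bC j l * fst bC l x) = (if i = j then 1 else 0))"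
  proof
    fix \<gamma>
    from eigenspace_orthonormal_basis[OF dim[of \<gamma>]] obtain b C where "(\<forall>l<m \<gamma>. b l \<in> eigenspace a \<Omega> \<gamma>) \<and>
    (\<forall>i<m \<gamma>. \<forall>j<m \<gamma>. ip \<Omega> (\<lambda>x. \<Sum>l<m \<gamma>. C i l * b l x) (\<lambda>x. \<Sum>l<m \<gamma>. C j l * b l x) = (if i = j then 1 else 0))" by blast
    thus "\<exists>bC. (\<forall>l<m \<gamma>. fst bC l \<in> eigenspace a \<Omega> \<gamma>) \<and>
    (\<forall>i<m \<gamma>. \<forall>j<m \<gamma>. ip \<Omega> (\<lambda>x. \<Sum>l<m \<gamma>. snd bC i l * fst bC l x) (\<lambda>x. \<Sum>l<m \<gamma>. snd bC j l * fst bC l x) = (if i = j then 1 else 0))"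
      by (intro exI[of _ "(b, C)"]) simp
  qed
  from choice[OF this] obtain bC where
    b: "\<And>\<gamma> l. l < m \<gamma> \<Longrightarrow> fst (bC \<gamma>) l \<in> eigenspace a \<Omega> \<gamma>" and
    on: "\<And>\<gamma> i j. i < m \<gamma> \<Longrightarrow> j < m \<gamma> \<Longrightarrow> ip \<Omega> (\<lambda>x. \<Sum>l<m \<gamma>. snd (bC \<gamma>) i l * fst (bC \<gamma>) l x) (\<lambda>x. \<Sum>l<m \<gamma>. snd (bC \<gamma>) j l * fst (bC \<gamma>) l x) = (if i = j then 1 else 0)"
    by blast
  have "\<forall>\<gamma>. \<exists>h. bij_betw h (J \<gamma>) {0..<m \<gamma>}" unfolding m_def using ex_bij_betw_finite_nat[OF Jfin] by blast
  from choice[OF this] obtain \<sigma> where \<sigma>: "\<And>\<gamma>. bij_betw (\<sigma> \<gamma>) (J \<gamma>) {0..<m \<gamma>}" by blast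
  have jJ: "j \<in> J (\<Gamma> j)" if "j \<ge> 1" for j using that by (simp add: J_def)
  have \<sigma>m: "\<sigma> (\<Gamma> j) j < m (\<Gamma> j)" if "j \<ge> 1" for j
    using bij_betw_apply[OF \<sigma> jJ[OF that]] by simp
  define u where "u j x = (\<Sum>l<m (\<Gamma> j). snd (bC (\<Gamma> j)) (\<sigma> (\<Gamma> j) j) l * fst (bC (\<Gamma> j)) l x)" for j x
  show thesis
  proof (rule that[of u])
    fix j :: nat assume "j \<ge> 1"
    show "eigenfunction_data a \<Omega> (\<Gamma> j) (u j)"
      unfolding u_def using b by (intro eigenfunction_data_combination[OF \<Omega>])
  next
    fix i j :: nat assume ij: "i \<ge> 1" "j \<ge> 1"
    show "ip \<Omega> (u i) (u j) = (if i = j then 1 else 0)"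
    proof (cases "\<Gamma> i = \<Gamma> j")
      case True
      have "\<sigma> (\<Gamma> j) i = \<sigma> (\<Gamma> j) j \<longleftrightarrow> i = j"
        using bij_betw_imp_inj_on[OF \<sigma>[of "\<Gamma> j"]] jJ[OF ij(1)] jJ[OF ij(2)] True by (auto simp: inj_on_eq_iff)
      thus ?thesis unfolding u_def True using on[OF \<sigma>m[OF ij(1), unfolded True] \<sigma>m[OF ij(2)]] by simp
    next
      case False
      have L: "fst (bC \<gamma>) l \<in> L2 \<Omega>" if "l < m \<gamma>" for \<gamma> l
        using b[OF that] by (auto simp: eigenspace_def H2_0_L2)
      have "ip \<Omega> (u i) (u j) = 0"
        unfolding u_def using L eigenspace_orthogonal[OF b b False] by (subst ip_sum_sum) auto
      thus ?thesis using False by auto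
    qed
  qed
qed

section \<open>The eigenvalue inequality\<close>

text \<open>Only the upper half of Plancherel enters, so the \<open>v i\<close> may be arbitrary
  functions in L2, as the combinations of weak derivatives are.\<close>

lemma moment_le_energy:
  fixes \<Omega> :: "(real ^ 'n) set"
  assumes \<Omega>: "bounded \<Omega>" "open \<Omega>" and v: "finite A" "\<And>i. i \<in> A \<Longrightarrow> v i \<in> L2 \<Omega>"
    and eq: "\<And>\<xi>. (\<Sum>i\<in>A. power_spectrum \<Omega> (v i) \<xi>) = norm \<xi> ^ p * F \<xi>"
  shows "(\<integral>\<^sup>+\<xi>. ennreal (norm \<xi> ^ p * F \<xi>) \<partial>lborel) \<le> ennreal ((2 * pi) ^ CARD('n) * (\<Sum>i\<in>A. ip \<Omega> (v i) (v i)))"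
proof -
  have "(\<integral>\<^sup>+\<xi>. ennreal (norm \<xi> ^ p * F \<xi>) \<partial>lborel) = (\<integral>\<^sup>+\<xi>. (\<Sum>i\<in>A. ennreal (power_spectrum \<Omega> (v i) \<xi>)) \<partial>lborel)"
    by (simp only: eq[symmetric] sum_ennreal power_spectrum_nonneg[OF \<Omega>])
  also have "\<dots> = (\<Sum>i\<in>A. \<integral>\<^sup>+\<xi>. ennreal (power_spectrum \<Omega> (v i) \<xi>) \<partial>lborel)"
    using power_spectrum_measurable(1)[OF \<Omega> v(2)] by (intro nn_integral_sum) auto
  also have "\<dots> \<le> (\<Sum>i\<in>A. ennreal ((2 * pi) ^ CARD('n) * ip \<Omega> (v i) (v i)))"
    by (intro sum_mono power_spectrum_measurable(2)[OF \<Omega>] v)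
  also have "\<dots> = ennreal ((2 * pi) ^ CARD('n) * (\<Sum>i\<in>A. ip \<Omega> (v i) (v i)))"
    by (simp add: sum_ennreal sum_distrib_left)
  finally show ?thesis .
qed

lemma volume_pos:
  fixes \<Omega> :: "(real ^ 'n) set"
  assumes \<Omega>: "bounded \<Omega>" "open \<Omega>" "\<Omega> \<noteq> {}"
  shows "volume \<Omega> > 0"
proof -
  have "\<Omega> \<in> lmeasurable" using \<Omega> by (simp add: lmeasurable_open)
  hence "volume \<Omega> \<noteq> 0"
    using open_not_negligible[OF \<Omega>(2,3)] by (simp add: volume_def negligible_iff_measure)
  thus ?thesis using measure_nonneg[of lebesgue \<Omega>] unfolding volume_def by linarith
qed

text \<open>The last assumption makes R the radius of the comparison ball for k eigenfunctions, and
  \<open>h2\<close> is h^2 = V / (4 I). The moment bound enters with p = 4 for the Laplacians and p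
  = 2 for the gradients.\<close>

lemma eigenvalue_sum_bound:
  fixes \<Omega> :: "(real ^ 'n) set"
  assumes n: "CARD('n) \<ge> 2" and a: "a \<ge> 0" and \<Omega>: "bounded \<Omega>" "open \<Omega>" "\<Omega> \<noteq> {}"
    and es: "eigenvalue_sequence a \<Omega> \<Gamma>" and k: "k \<ge> 1"
    and R: "R > 0" "volume \<Omega> * ball_volume TYPE(real ^ 'n) * R ^ CARD('n) = (2 * pi) ^ CARD('n) * k"
  defines "n \<equiv> real CARD('n)" and "h2 \<equiv> volume \<Omega> / (4 * moment_of_inertia \<Omega>)"
  shows "volume \<Omega> > 0" "moment_of_inertia \<Omega> > 0"
    "k * ((n / (n + 4) * R ^ 4 + n / 6 * h2 * R\<^sup>2) + a * (n / (n + 2) * R\<^sup>2 + n / 12 * h2)) \<le> (\<Sum>j=1..k. \<Gamma> j)"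
proof -
  let ?\<omega> = "ball_volume TYPE(real ^ 'n)" and ?N = "CARD('n)"
  define V where "V = volume \<Omega>"
  define I where "I = moment_of_inertia \<Omega>"
  have n2: "n \<ge> 2" using n by (simp add: n_def)
  have \<omega>_eq: "?\<omega> = unit_ball_vol n" using content_ball[of 1 "0::real ^ 'n"] by (simp add: n_def)
  have \<omega>: "?\<omega> > 0" unfolding \<omega>_eq using n2 by (intro unit_ball_vol_pos) simp
  show V: "volume \<Omega> > 0" by (rule volume_pos[OF \<Omega>])
  define \<rho> where "\<rho> = root ?N (V / ?\<omega>)"
  have \<rho>: "\<rho> > 0" "V = ?\<omega> * \<rho> ^ ?N"
    using V \<omega> n by (simp_all add: \<rho>_def V_def)
  have I: "n / (n + 2) * V * \<rho>\<^sup>2 \<le> I"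
    unfolding I_def n_def V_def
    using second_moment_lower_bound[OF \<Omega>(1,2) \<rho>(1) \<rho>(2)[unfolded V_def]] by (intro moment_of_inertia_greatest) (simp add: add_ac)
  have V0: "V > 0" using V by (simp add: V_def)
  have "0 < n / (n + 2) * V * \<rho>\<^sup>2" using n2 V0 \<rho> by simp
  hence I0: "I > 0" using I by linarith
  thus "moment_of_inertia \<Omega> > 0" by (simp add: I_def)
  define h where "h = sqrt V / (2 * sqrt I)"
  have h: "h > 0" "h\<^sup>2 = h2"
    using V0 I0 by (simp_all add: h_def h2_def V_def[symmetric] I_def[symmetric] power_divide power_mult_distrib)
  \<comment> \<open>An uncertainty principle: k \<ge> 1 forces (2 \<pi>)^n \<le> \<omega>^2 (R
    \<rho>)^n, where \<rho> is the radius of the ball of volume V. The upper bound for \<omega>^2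
    turns this into growth linear in n.\<close>
  have R\<rho>: "(n + 2) / exp 1 \<le> R * \<rho>"
  proof (rule power_le_imp_le_base)
    have "(2 * pi) ^ ?N \<le> (2 * pi) ^ ?N * k" using k by simp
    also have "\<dots> = ?\<omega>\<^sup>2 * (R * \<rho>) ^ ?N"
      using R(2) \<rho>(2) by (simp add: V_def power2_eq_square power_mult_distrib mult_ac)
    also have "\<dots> \<le> (2 * pi * exp 1 / (?N + 2)) ^ ?N * (R * \<rho>) ^ ?N"
      using unit_ball_vol_upper[of ?N] R \<rho> \<omega>_eq by (intro mult_right_mono) (simp_all add: n_def add.commute)
    finally have "1 \<le> (exp 1 / (n + 2)) ^ ?N * (R * \<rho>) ^ ?N"
      by (simp add: n_def power_mult_distrib power_divide field_simps)
    thus "((n + 2) / exp 1) ^ Suc (?N - 1) \<le> (R * \<rho>) ^ Suc (?N - 1)"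
      using n2 by (simp add: power_divide field_simps)
    show "0 \<le> R * \<rho>" using R \<rho> by simp
  qed
  define \<eta> where "\<eta> = h / R"
  \<comment> \<open>The lower bound for I gives h^2 \<le> (n + 2) / (4 n \<rho>^2). Division by R^2
    leaves only the product R \<rho>, so the result depends on n alone.\<close>
  have \<eta>: "\<eta>\<^sup>2 \<le> (exp 1)\<^sup>2 / (4 * n * (n + 2))"
  proof -
    have "h\<^sup>2 = V / (4 * I)" using h by (simp add: h2_def V_def I_def)
    also have "\<dots> \<le> V / (4 * (n / (n + 2) * V * \<rho>\<^sup>2))"
      using I V0 I0 n2 \<rho> by (intro divide_left_mono mult_left_mono mult_pos_pos) auto
    also have "\<dots> = (n + 2) / (4 * n * \<rho>\<^sup>2)" using V0 n2 \<rho> by (simp add: field_simps)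
    finally have "\<eta>\<^sup>2 \<le> (n + 2) / (4 * n * \<rho>\<^sup>2) / R\<^sup>2"
      unfolding \<eta>_def power_divide using R by (intro divide_right_mono) auto
    also have "\<dots> = (n + 2) / (4 * n * (R * \<rho>)\<^sup>2)" by (simp add: power_mult_distrib mult_ac)
    also have "\<dots> \<le> (n + 2) / (4 * n * ((n + 2) / exp 1)\<^sup>2)"
      using R\<rho> n2 R \<rho> by (intro divide_left_mono mult_left_mono power_mono mult_pos_pos) auto
    also have "\<dots> = (exp 1)\<^sup>2 / (4 * n * (n + 2))"
    proof -
      have "m / (4 * n * (m / E)\<^sup>2) = E\<^sup>2 / (4 * n * m)" if "m \<noteq> 0" for m E :: real
        using that by (simp add: power2_eq_square)
      from this[of "n + 2"] show ?thesis using n2 by simp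
    qed
    finally show ?thesis .
  qed
  have \<eta>0: "\<eta> \<ge> 0" using h R by (simp add: \<eta>_def)
  note pc = profile_constant[OF n \<eta>0 \<eta>[unfolded n_def]]
  have hR: "2 * h \<le> R" "(1 - 4 * h / (5 * R)) ^ (DIM(real ^ 'n) + 1) \<ge> 1 / 7"
    using pc R by (simp_all add: \<eta>_def field_simps)

  obtain u where u: "\<And>j. j \<ge> 1 \<Longrightarrow> eigenfunction_data a \<Omega> (\<Gamma> j) (u j)"
    and on: "\<And>i j. i \<ge> 1 \<Longrightarrow> j \<ge> 1 \<Longrightarrow> ip \<Omega> (u i) (u j) = (if i = j then 1 else 0)"
    using orthonormal_eigenfunctions[OF \<Omega>(1,2) es] by blast
  have ap: "approximable \<Omega> (u j)" if "j \<ge> 1" for j using u[OF that] by (simp add: eigenfunction_data_def)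
  have uL: "u j \<in> L2 \<Omega>" if "j \<ge> 1" for j using ap[OF that] approximable_def[OF \<Omega>(1,2)] by blast
  \<comment> \<open>The witnesses of \<open>eigenfunction_data\<close> are bundled into a pair, so
    that one choice function serves all indices j.\<close>
  define Q where "Q j ld \<longleftrightarrow> fst ld \<in> L2 \<Omega> \<and> (\<forall>i. snd ld i \<in> L2 \<Omega>) \<and>
     (\<forall>\<xi>. power_spectrum \<Omega> (fst ld) \<xi> = norm \<xi> ^ 4 * power_spectrum \<Omega> (u j) \<xi>) \<and>
     (\<forall>\<xi>. (\<Sum>i\<in>UNIV. power_spectrum \<Omega> (snd ld i) \<xi>) = (norm \<xi>)\<^sup>2 * power_spectrum \<Omega> (u j) \<xi>) \<and>
     ip \<Omega> (fst ld) (fst ld) + a * (\<Sum>i\<in>UNIV. ip \<Omega> (snd ld i) (snd ld i)) = \<Gamma> j * ip \<Omega> (u j) (u j)"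
    for j and ld :: "(real ^ 'n \<Rightarrow> real) \<times> ('n \<Rightarrow> real ^ 'n \<Rightarrow> real)"
  have "\<exists>ld. Q j ld" if j: "j \<ge> 1" for j
  proof -
    obtain l d where "Q j (l, d)" using u[OF j] unfolding eigenfunction_data_def Q_def fst_conv snd_conv by blast
    thus ?thesis by blast
  qed
  hence "\<forall>j. \<exists>ld. j \<ge> 1 \<longrightarrow> Q j ld" by blast
  from choice[OF this] obtain ld where ldQ: "\<And>j. j \<ge> 1 \<Longrightarrow> Q j (ld j)" by blast
  have ld: "\<And>j. j \<ge> 1 \<Longrightarrow> fst (ld j) \<in> L2 \<Omega>" "\<And>j i. j \<ge> 1 \<Longrightarrow> snd (ld j) i \<in> L2 \<Omega>"
     "\<And>j \<xi>. j \<ge> 1 \<Longrightarrow> power_spectrum \<Omega> (fst (ld j)) \<xi> = norm \<xi> ^ 4 * power_spectrum \<Omega> (u j) \<xi>"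
     "\<And>j \<xi>. j \<ge> 1 \<Longrightarrow> (\<Sum>i\<in>UNIV. power_spectrum \<Omega> (snd (ld j) i) \<xi>) = (norm \<xi>)\<^sup>2 * power_spectrum \<Omega> (u j) \<xi>"
     "\<And>j. j \<ge> 1 \<Longrightarrow> ip \<Omega> (fst (ld j)) (fst (ld j)) + a * (\<Sum>i\<in>UNIV. ip \<Omega> (snd (ld j) i) (snd (ld j) i)) = \<Gamma> j * ip \<Omega> (u j) (u j)"
    using ldQ unfolding Q_def by simp_all
  interpret orthonormal_family \<Omega> "{1..k}" u
    by standard (use \<Omega> uL on in auto)
  define S where "S = spectral_density"
  note S_bounds = spectral_density_bounds[folded S_def] and S_lipschitz = spectral_density_lipschitz[folded S_def]
  have sd: "S \<xi> = (\<Sum>j=1..k. power_spectrum \<Omega> (u j) \<xi>)" for \<xi>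
    unfolding S_def spectral_density_def power_spectrum_def ..
  have sdm: "S \<in> borel_measurable borel"
    unfolding sd[abs_def] using power_spectrum_measurable(1)[OF \<Omega>(1,2) uL] by (intro borel_measurable_sum) auto
  \<comment> \<open>The moment bound requires this mass exactly; here equality in Plancherel, and
    thus approximability of the eigenfunctions, is indispensable.\<close>
  have total: "(\<integral>\<^sup>+\<xi>. ennreal (S \<xi>) \<partial>lborel) = ennreal (V * ?\<omega> * R ^ DIM(real ^ 'n))"
  proof -
    have "(\<integral>\<^sup>+\<xi>. ennreal (S \<xi>) \<partial>lborel) = (\<integral>\<^sup>+\<xi>. (\<Sum>j=1..k. ennreal (power_spectrum \<Omega> (u j) \<xi>)) \<partial>lborel)"
      by (simp only: sd sum_ennreal power_spectrum_nonneg[OF \<Omega>(1,2)])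
    also have "\<dots> = (\<Sum>j=1..k. \<integral>\<^sup>+\<xi>. ennreal (power_spectrum \<Omega> (u j) \<xi>) \<partial>lborel)"
      using power_spectrum_measurable(1)[OF \<Omega>(1,2) uL] by (intro nn_integral_sum) auto
    also have "\<dots> = (\<Sum>j=1..k. ennreal ((2 * pi) ^ ?N))"
      using plancherel_approximable[OF \<Omega>(1,2) ap] on by (intro sum.cong refl) simp
    also have "\<dots> = ennreal ((2 * pi) ^ ?N * k)" by (subst sum_ennreal) (simp_all add: mult.commute)
    finally show ?thesis using R(2) by (simp add: V_def)
  qed
  \<comment> \<open>The common factor (2 \<pi>)^n cancels between mass and energy. The coefficient n
    p / 24 becomes n / 6 for p = 4 and n / 12 for p = 2.\<close>
  have mom: "k * (n / (n + p) * R ^ p + n * p / 24 * h2 * R ^ (p - 2)) \<le> E"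
    if p: "p = 2 \<or> p = (4::nat)" and E: "(\<integral>\<^sup>+\<xi>. ennreal (norm \<xi> ^ p * S \<xi>) \<partial>lborel) \<le> ennreal ((2 * pi) ^ ?N * E)"
      "E \<ge> 0" for p E
  proof -
    have "ennreal (V * ?\<omega> * R ^ DIM(real ^ 'n) * (DIM(real ^ 'n) / (DIM(real ^ 'n) + p) * R ^ p + DIM(real ^ 'n) * p / 24 * h\<^sup>2 * R ^ (p - 2)))
      \<le> ennreal ((2 * pi) ^ ?N * E)"
    proof (rule order_trans[OF moment_lower_bound E(1)])
      show "0 < sqrt (moment_of_inertia \<Omega>)" using I0 by (simp add: I_def)
      show "h = sqrt V / (2 * sqrt (moment_of_inertia \<Omega>))" by (simp add: h_def I_def)
    qed (use p sdm S_bounds S_lipschitz V0 hR total in \<open>auto simp: V_def\<close>)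
    hence le: "V * ?\<omega> * R ^ DIM(real ^ 'n) * (DIM(real ^ 'n) / (DIM(real ^ 'n) + p) * R ^ p + DIM(real ^ 'n) * p / 24 * h\<^sup>2 * R ^ (p - 2)) \<le> (2 * pi) ^ ?N * E"
      using E(2) by (subst (asm) ennreal_le_iff) auto
    have "V * ?\<omega> * R ^ DIM(real ^ 'n) = (2 * pi) ^ ?N * k" using R(2) by (simp add: V_def)
    moreover have "DIM(real ^ 'n) / (DIM(real ^ 'n) + p) * R ^ p + DIM(real ^ 'n) * p / 24 * h\<^sup>2 * R ^ (p - 2)
        = n / (n + p) * R ^ p + n * p / 24 * h2 * R ^ (p - 2)" by (simp add: n_def h(2))
    ultimately have "(2 * pi) ^ ?N * (k * (n / (n + p) * R ^ p + n * p / 24 * h2 * R ^ (p - 2))) \<le> (2 * pi) ^ ?N * E"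
      using le by (simp only: mult.assoc)
    thus ?thesis by (rule mult_left_le_imp_le) simp
  qed
  define E4 where "E4 = (\<Sum>j=1..k. ip \<Omega> (fst (ld j)) (fst (ld j)))"
  define E2 where "E2 = (\<Sum>j=1..k. \<Sum>i\<in>UNIV. ip \<Omega> (snd (ld j) i) (snd (ld j) i))"
  have m4: "k * (n / (n + 4) * R ^ 4 + n / 6 * h2 * R\<^sup>2) \<le> E4"
  proof -
    have "(\<integral>\<^sup>+\<xi>. ennreal (norm \<xi> ^ 4 * S \<xi>) \<partial>lborel) \<le> ennreal ((2 * pi) ^ ?N * E4)"
      unfolding E4_def
      by (rule moment_le_energy[OF \<Omega>(1,2)]) (use ld(1,3) in \<open>auto simp: sd sum_distrib_left\<close>)
    from mom[OF _ this] show ?thesis by (simp add: E4_def sum_nonneg)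
  qed
  have m2: "k * (n / (n + 2) * R\<^sup>2 + n / 12 * h2) \<le> E2"
  proof -
    have E2: "E2 = (\<Sum>(j,i)\<in>{1..k} \<times> UNIV. ip \<Omega> (snd (ld j) i) (snd (ld j) i))"
      unfolding E2_def by (simp add: sum.cartesian_product)
    have "(\<integral>\<^sup>+\<xi>. ennreal (norm \<xi> ^ 2 * S \<xi>) \<partial>lborel) \<le> ennreal ((2 * pi) ^ ?N * (\<Sum>ji\<in>{1..k} \<times> UNIV. ip \<Omega> (snd (ld (fst ji)) (snd ji)) (snd (ld (fst ji)) (snd ji))))"
    proof (rule moment_le_energy[OF \<Omega>(1,2)])
      fix \<xi> :: "real ^ 'n"
      have "(\<Sum>ji\<in>{1..k} \<times> UNIV. power_spectrum \<Omega> (snd (ld (fst ji)) (snd ji)) \<xi>) = (\<Sum>j=1..k. \<Sum>i\<in>UNIV. power_spectrum \<Omega> (snd (ld j) i) \<xi>)"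
        by (simp add: sum.cartesian_product split_beta)
      also have "\<dots> = norm \<xi> ^ 2 * S \<xi>"
        using ld(4) by (simp add: sd sum_distrib_left)
      finally show "(\<Sum>ji\<in>{1..k} \<times> UNIV. power_spectrum \<Omega> (snd (ld (fst ji)) (snd ji)) \<xi>) = norm \<xi> ^ 2 * S \<xi>" .
    qed (use ld(2) in auto)
    hence "(\<integral>\<^sup>+\<xi>. ennreal (norm \<xi> ^ 2 * S \<xi>) \<partial>lborel) \<le> ennreal ((2 * pi) ^ ?N * E2)"
      by (simp add: E2 split_beta)
    from mom[OF _ this] show ?thesis by (simp add: E2_def sum_nonneg)
  qed
  have "(\<Sum>j=1..k. \<Gamma> j) = E4 + a * E2"
  proof -
    have "(\<Sum>j=1..k. \<Gamma> j) = (\<Sum>j=1..k. ip \<Omega> (fst (ld j)) (fst (ld j)) + a * (\<Sum>i\<in>UNIV. ip \<Omega> (snd (ld j) i) (snd (ld j) i)))"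
      using ld(5) on by (intro sum.cong refl) simp
    thus ?thesis by (simp add: E4_def E2_def sum.distrib sum_distrib_left)
  qed
  moreover have "a * (k * (n / (n + 2) * R\<^sup>2 + n / 12 * h2)) \<le> a * E2" using m2 a by (rule mult_left_mono)
  ultimately show "k * ((n / (n + 4) * R ^ 4 + n / 6 * h2 * R\<^sup>2) + a * (n / (n + 2) * R\<^sup>2 + n / 12 * h2)) \<le> (\<Sum>j=1..k. \<Gamma> j)"
    using m4 by (simp add: distrib_left mult.left_commute)
qed

theorem theorem2:
  fixes \<Omega> :: "(real ^ 'n) set" and a :: real and \<Gamma> :: "nat \<Rightarrow> real"
    and n :: nat and \<omega> V I :: real
  assumes "n = CARD('n)" and "n \<ge> 2"
    and "a \<ge> 0"
    and "open \<Omega>" and "connected \<Omega>" and "bounded \<Omega>" and "\<Omega> \<noteq> {}"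
    and "eigenvalue_sequence a \<Omega> \<Gamma>"
    and "\<omega> = volume (ball (0 :: real ^ 'n) 1)"
    and "V = volume \<Omega>"
    and "I = moment_of_inertia \<Omega>"
  shows "\<exists>\<epsilon> :: nat \<Rightarrow> real.
     (\<forall>k\<ge>1. \<epsilon> k \<ge> 0) \<and>
     \<epsilon> \<in> O(\<lambda>k. real k powr (- 2 / real n)) \<and>
     (\<forall>k\<ge>1.
        1 / real k * (\<Sum>j=1..k. \<Gamma> j) \<ge>
          real n / (real n + 4) * ((2 * pi) ^ 4 / (\<omega> * V) powr (4 / real n)) * real k powr (4 / real n)
          + (real n / 24 * (V / I) + real n * a / (real n + 2))
              * ((2 * pi)\<^sup>2 / (\<omega> * V) powr (2 / real n)) * real k powr (2 / real n)
          + (- (real n * ((real n)\<^sup>2 - 4) / 3840) * (V / I) + real n * a / 48) * (V / I) * (1 - \<epsilon> k))"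
proof (intro exI[of _ "\<lambda>_. 0"] conjI allI impI)
  fix k :: nat assume k: "k \<ge> 1"
  have n: "real n \<ge> 2" using assms(2) by simp
  have \<omega>_eq: "\<omega> = ball_volume TYPE(real ^ 'n)"
    unfolding assms(9) volume_def by (rule measure_completion) simp
  have \<omega>: "\<omega> > 0" unfolding \<omega>_eq using content_ball_pos[of 1 "0::real ^ 'n"] by simp
  have V: "V > 0" unfolding assms(10) by (rule volume_pos[OF assms(6,4,7)])
  \<comment> \<open>The solution of V \<omega> R^n = (2 \<pi>)^n k. Its powers R^4 and R^2 carry the
    dependence on k in the asserted bound.\<close>
  define R where "R = 2 * pi * (k / (\<omega> * V)) powr (1 / n)"
  have q: "k / (\<omega> * V) > 0" using k \<omega> V by simp
  have "(k / (\<omega> * V)) powr (1 / n) > 0" using q by (subst powr_gt_zero) linarith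
  hence R: "R > 0" by (simp add: R_def)
  have Rp: "R ^ p = (2 * pi) ^ p / (\<omega> * V) powr (p / n) * real k powr (p / n)" for p :: nat
  proof -
    have "R ^ p = (2 * pi) ^ p * (k / (\<omega> * V)) powr (p / n)"
    proof -
      have x: "(k / (\<omega> * V)) powr (1 / n) > 0" using q by (subst powr_gt_zero) linarith
      show ?thesis unfolding R_def power_mult_distrib powr_realpow[OF x, symmetric] powr_powr by simp
    qed
    also have "(k / (\<omega> * V)) powr (p / n) = real k powr (p / n) / (\<omega> * V) powr (p / n)"
      by (rule powr_divide)
    finally show ?thesis by simp
  qed
  have Rn: "V * \<omega> * R ^ n = (2 * pi) ^ n * k"
    using Rp[of n] n k \<omega> V by (simp add: field_simps)
  note b = eigenvalue_sum_bound[OF _ assms(3,6,4,7,8) k R, folded assms(10,11) \<omega>_eq assms(1), OF assms(2) Rn]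
  have I: "I > 0" by (rule b(2))
  let ?c = "real n * ((real n)\<^sup>2 - 4) / 3840" and ?S = "1 / real k * (\<Sum>j=1..k. \<Gamma> j)"
  have 1: "?c * (V / I) * (V / I) \<ge> 0"
    using n V I power_mono[of 2 "real n" 2] by (intro mult_nonneg_nonneg divide_nonneg_nonneg) auto
  have 2: "(n / (n + 4) * R ^ 4 + n / 6 * (V / (4 * I)) * R\<^sup>2) + a * (n / (n + 2) * R\<^sup>2 + n / 12 * (V / (4 * I))) \<le> ?S"
    using b(3) k by (simp add: field_simps)
  \<comment> \<open>With h^2 = V / (4 I) the two excess terms become n / 24 and n a / 48 times V /
    I, the first with the factor R^2: exactly the coefficients of the bound.\<close>
  have 3: "n / (n + 4) * R ^ 4 + n / 6 * (V / (4 * I)) * R\<^sup>2 + a * (n / (n + 2) * R\<^sup>2 + n / 12 * (V / (4 * I)))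
    = n / (n + 4) * R ^ 4 + (n / 24 * (V / I) + n * a / (n + 2)) * R\<^sup>2 + n * a / 48 * (V / I)"
    using n I by (simp add: algebra_simps)
  have R4: "R ^ 4 = (2 * pi) ^ 4 / (\<omega> * V) powr (4 / real n) * real k powr (4 / real n)"
    and R2: "R\<^sup>2 = (2 * pi)\<^sup>2 / (\<omega> * V) powr (2 / real n) * real k powr (2 / real n)"
    using Rp[of 4] Rp[of 2] by simp_all
  have 4: "(- ?c * (V / I) + real n * a / 48) * (V / I) * (1 - 0) = - (?c * (V / I) * (V / I)) + n * a / 48 * (V / I)"
    by (simp add: algebra_simps)
  have "n / (n + 4) * R ^ 4 + (n / 24 * (V / I) + n * a / (n + 2)) * R\<^sup>2 + (- ?c * (V / I) + real n * a / 48) * (V / I) * (1 - 0) \<le> ?S"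
    unfolding 4 using 1 2 3 by linarith
  thus "?S \<ge> real n / (real n + 4) * ((2 * pi) ^ 4 / (\<omega> * V) powr (4 / real n)) * real k powr (4 / real n)
          + (real n / 24 * (V / I) + real n * a / (real n + 2))
              * ((2 * pi)\<^sup>2 / (\<omega> * V) powr (2 / real n)) * real k powr (2 / real n)
          + (- ?c * (V / I) + real n * a / 48) * (V / I) * (1 - 0)"
    by (simp only: R4 R2 mult.assoc of_nat_add of_nat_numeral)
qed simp_all

end
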